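(* Let $\Gamma$ be a limit cycle of $\dot u=F(u)$ at a strong resonance 1:4 (R4) bifurcation, with the critical center manifold near $\Gamma$ parametrized by $(\tau,\xi)$ as in the context, so that the restricted dynamics has the R4 periodic normal form with coefficients $\alpha_1,c,d$. Let $v,\varphi^*,v^*$ be as in the context. Then $h_{20}$ is the unique solution on $[0,T]$ of $$\dot h_{20}-Ah_{20}-B(\tau;v,v)=0,\qquad h_{20}(T)+h_{20}(0)=0,$$ $$\alpha_1=\int_0^T\langle\varphi^*,B(\tau;v,\bar v)\rangle d\tau,$$ $h_{11}$ is the unique solution on $[0,T]$ of $$\dot h_{11}-Ah_{11}-B(\tau;v,\bar v)+\alpha_1\dot u_0=0,\quad h_{11}(T)-h_{11}(0)=0,\quad\int_0^T\langle\varphi^*,h_{11}\rangle d\tau=0,$$ and, with $h_{02}=\bar h_{20}$, $$\bar c=\frac12\int_0^T\langle\bar v^*,C(\tau;v,\bar v,\bar v)+B(\tau;v,h_{02})+2B(\tau;\bar v,h_{11})-2\alpha_1A(\tau)\bar v\rangle d\tau,$$ $$d=\frac16\int_0^T\langle v^*,C(\tau;\bar v,\bar v,\bar v)+3B(\tau;\bar v,h_{02})\rangle d\tau .$$ If $v$ is replaced by $\gamma v$ with $\gamma\in\mathbb C$, $|\gamma|=1$, then $c$ is unchanged and $d$ is replaced by $\bar\gamma^4d$.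
   Context: Setting. $F:\mathbb R^n\to\mathbb R^n$ is sufficiently smooth and $u_0$ is a nonconstant periodic solution of $\dot u=F(u)$ with minimal period $T>0$; $\Gamma$ is its orbit. $A(\tau)=F_u(u_0(\tau))$, and $B(\tau;\cdot,\cdot)$, $C(\tau;\cdot,\cdot,\cdot)$ are the symmetric multilinear forms of second and third derivatives of $F$ at $u_0(\tau)$, extended $\mathbb C$-multilinearly. Dots over functions of $\tau$ denote $d/d\tau$; $\langle a,b\rangle=a^{\rm H}b$ (conjugate-linear in the first argument). Let $Y$ solve $\dot Y=A(\tau)Y$, $Y(0)=I_n$; the eigenvalues of $Y(T)$ are the multipliers, critical if of modulus 1. R4 bifurcation: the multiplier $1$ is simple and the only other critical multipliers are $e^{\pm i\pi/2}$, both simple. The three-dimensional critical center manifold near $\Gamma$ is parametrized as $u(\tau,\xi,\bar\xi)=u_0(\tau)+\xi v(\tau)+\bar\xi\bar v(\tau)+H(\tau,\xi,\bar\xi)$, $\xi\in\mathbb C$ small, $H$ real, smooth, $4T$-periodic in $\tau$, $$H=\sum_{2\le k+l\le3}\frac1{k!\,l!}h_{kl}(\tau)\xi^k\bar\xi^l+O(|\xi|^4),\qquad h_{kl}=\bar h_{lk},$$ with $h_{kl}(\tau)=h_{kl}(\tau+T)(e^{-i\pi/2})^k(e^{i\pi/2})^l$, and with the remaining freedom in $h_{11}$ fixed by $\int_0^T\langle\varphi^*,h_{11}\rangle d\tau=0$. The dynamics restricted to it is $$\frac{d\tau}{dt}=1+\alpha_1|\xi|^2+\alpha_2\xi^4+\alpha_3\bar\xi^4+\dots,\qquad\frac{d\xi}{dt}=c\,\xi|\xi|^2+d\,\bar\xi^3+\dots,$$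 with $\alpha_1\in\mathbb R$, $\alpha_2,\alpha_3,c,d\in\mathbb C$, $\alpha_3=\bar\alpha_2$, and dots denoting $O(|\xi|^5)$ terms $4T$-periodic in $\tau$; that is, if $(\tau(t),\xi(t))$ solves this system then $u(\tau(t),\xi(t),\bar\xi(t))$ solves $\dot u=F(u)$. The following are on $[0,T]$: $\dot v-Av=0$, $v(T)=e^{i\pi/2}v(0)$, $\int_0^T\langle v,v\rangle d\tau=1$ (extended by $v(\tau+T)=iv(\tau)$); $\dot\varphi^*+A^{\rm T}\varphi^*=0$, $\varphi^*(T)=\varphi^*(0)$, $\int_0^T\langle\varphi^*,F(u_0)\rangle d\tau=1$ ($\varphi^*$ real); $\dot v^*+A^{\rm T}v^*=0$, $v^*(T)=e^{i\pi/2}v^*(0)$, $\int_0^T\langle v^*,v\rangle d\tau=1$. $\bar v^*$ is the complex conjugate of $v^*$. *)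

theory Defs
  imports "HOL-Analysis.Analysis" "HOL-Computational_Algebra.Polynomial"
begin

definition dir_deriv ::
  "'a::real_normed_vector \<Rightarrow> ('a \<Rightarrow> 'b::real_normed_vector) \<Rightarrow> 'a \<Rightarrow> 'b" where
  "dir_deriv w f x = frechet_derivative f (at x) w"

text \<open>Class \<open>C\<^sup>k\<close> on an open subset of a finite-dimensional space.\<close>

primrec Ck_on ::
  "nat \<Rightarrow> ('a::real_normed_vector \<Rightarrow> 'b::real_normed_vector) \<Rightarrow> 'a set \<Rightarrow> bool" where
  "Ck_on 0 f S \<longleftrightarrow> continuous_on S f"
| "Ck_on (Suc k) f S \<longleftrightarrow>
     (\<forall>x\<in>S. f differentiable (at x)) \<and> (\<forall>w. Ck_on k (dir_deriv w f) S)"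

definition cvec :: "real^'n \<Rightarrow> complex^'n" where
  "cvec a = (\<chi> i. complex_of_real (a $ i))"

definition vcnj :: "complex^'n \<Rightarrow> complex^'n" where
  "vcnj a = (\<chi> i. cnj (a $ i))"

definition vRe :: "complex^'n \<Rightarrow> real^'n" where
  "vRe a = (\<chi> i. Re (a $ i))"

abbreviation cmat :: "real^'n^'m \<Rightarrow> complex^'n^'m" where
  "cmat M \<equiv> map_matrix complex_of_real M"

definition hinner :: "complex^'n \<Rightarrow> complex^'n \<Rightarrow> complex" where
  "hinner a b = (\<Sum>i\<in>UNIV. cnj (a $ i) * b $ i)"

text \<open>Linearization of \<open>F\<close> along \<open>u0\<close>, and the complex-multilinear extensions of the second
  and third derivatives of \<open>F\<close> along \<open>u0\<close>.\<close>

definition Amat :: "(real^'n \<Rightarrow> real^'n) \<Rightarrow> (real \<Rightarrow> real^'n) \<Rightarrow> real \<Rightarrow> real^'n^'n" where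
  "Amat F u0 \<tau> = jacobian F (at (u0 \<tau>))"

definition Bform :: "(real^'n \<Rightarrow> real^'n) \<Rightarrow> (real \<Rightarrow> real^'n) \<Rightarrow> real
    \<Rightarrow> complex^'n \<Rightarrow> complex^'n \<Rightarrow> complex^'n" where
  "Bform F u0 \<tau> a b = (\<Sum>i\<in>UNIV. \<Sum>j\<in>UNIV. (a $ i * b $ j) *s
     cvec (dir_deriv (axis i 1) (dir_deriv (axis j 1) F) (u0 \<tau>)))"

definition Cform :: "(real^'n \<Rightarrow> real^'n) \<Rightarrow> (real \<Rightarrow> real^'n) \<Rightarrow> real
    \<Rightarrow> complex^'n \<Rightarrow> complex^'n \<Rightarrow> complex^'n \<Rightarrow> complex^'n" where
  "Cform F u0 \<tau> a b e = (\<Sum>i\<in>UNIV. \<Sum>j\<in>UNIV. \<Sum>k\<in>UNIV. (a $ i * b $ j * e $ k) *s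
     cvec (dir_deriv (axis i 1) (dir_deriv (axis j 1) (dir_deriv (axis k 1) F)) (u0 \<tau>)))"

definition periodic_orbit ::
  "(real^'n \<Rightarrow> real^'n) \<Rightarrow> (real \<Rightarrow> real^'n) \<Rightarrow> real \<Rightarrow> bool" where
  "periodic_orbit F u0 T \<longleftrightarrow>
     (\<forall>t. (u0 has_vector_derivative F (u0 t)) (at t)) \<and>
     \<not> u0 constant_on UNIV \<and>
     T > 0 \<and> (\<forall>t. u0 (t + T) = u0 t) \<and>
     (\<forall>S. 0 < S \<and> S < T \<longrightarrow> \<not> (\<forall>t. u0 (t + S) = u0 t))"

definition fundamental_solution ::
  "(real^'n \<Rightarrow> real^'n) \<Rightarrow> (real \<Rightarrow> real^'n) \<Rightarrow> (real \<Rightarrow> real^'n^'n) \<Rightarrow> bool" where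
  "fundamental_solution F u0 Y \<longleftrightarrow>
     (\<forall>\<tau>. (Y has_vector_derivative Amat F u0 \<tau> ** Y \<tau>) (at \<tau>)) \<and> Y 0 = mat 1"

definition eigenvalue_of :: "complex^'n^'n \<Rightarrow> complex \<Rightarrow> bool" where
  "eigenvalue_of M \<mu> \<longleftrightarrow> (\<exists>x. x \<noteq> 0 \<and> M *v x = \<mu> *s x)"

definition charpoly :: "complex^'n^'n \<Rightarrow> complex poly" where
  "charpoly M = det (\<chi> i j. (if i = j then [:0, 1:] else 0) - [:M $ i $ j:])"

definition simple_eigenvalue :: "complex^'n^'n \<Rightarrow> complex \<Rightarrow> bool" where
  "simple_eigenvalue M \<mu> \<longleftrightarrow> eigenvalue_of M \<mu> \<and> order \<mu> (charpoly M) = 1"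

definition R4_multipliers :: "complex^'n^'n \<Rightarrow> bool" where
  "R4_multipliers M \<longleftrightarrow>
     {\<mu>. eigenvalue_of M \<mu> \<and> cmod \<mu> = 1}
       = {1, exp (\<i> * of_real (pi/2)), exp (- (\<i> * of_real (pi/2)))} \<and>
     simple_eigenvalue M 1 \<and>
     simple_eigenvalue M (exp (\<i> * of_real (pi/2))) \<and>
     simple_eigenvalue M (exp (- (\<i> * of_real (pi/2))))"

text \<open>The eigenfunction \<open>v\<close> and the adjoint eigenfunctions \<open>\<phi>\<close> (real) and \<open>vs\<close>
  (the latter two written \<open>\<phi>\<^sup>*\<close> and \<open>v\<^sup>*\<close> on paper).\<close>

definition R4_eigenfunctions ::
  "(real^'n \<Rightarrow> real^'n) \<Rightarrow> (real \<Rightarrow> real^'n) \<Rightarrow> real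
    \<Rightarrow> (real \<Rightarrow> complex^'n) \<Rightarrow> (real \<Rightarrow> real^'n) \<Rightarrow> (real \<Rightarrow> complex^'n) \<Rightarrow> bool" where
  "R4_eigenfunctions F u0 T v \<phi> vs \<longleftrightarrow>
     (\<forall>\<tau>\<in>{0..T}. (v has_vector_derivative cmat (Amat F u0 \<tau>) *v v \<tau>) (at \<tau> within {0..T})) \<and>
     v T = exp (\<i> * of_real (pi/2)) *s v 0 \<and>
     integral {0..T} (\<lambda>\<tau>. hinner (v \<tau>) (v \<tau>)) = 1 \<and>
     (\<forall>\<tau>. v (\<tau> + T) = \<i> *s v \<tau>) \<and>
     (\<forall>\<tau>\<in>{0..T}. (\<phi> has_vector_derivative - (transpose (Amat F u0 \<tau>) *v \<phi> \<tau>))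
                   (at \<tau> within {0..T})) \<and>
     \<phi> T = \<phi> 0 \<and>
     integral {0..T} (\<lambda>\<tau>. \<phi> \<tau> \<bullet> F (u0 \<tau>)) = 1 \<and>
     (\<forall>\<tau>\<in>{0..T}. (vs has_vector_derivative - (cmat (transpose (Amat F u0 \<tau>)) *v vs \<tau>))
                   (at \<tau> within {0..T})) \<and>
     vs T = exp (\<i> * of_real (pi/2)) *s vs 0 \<and>
     integral {0..T} (\<lambda>\<tau>. hinner (vs \<tau>) (v \<tau>)) = 1"

text \<open>The sum \<open>\<xi> v + cnj \<xi> cnj v\<close> is a real vector, so \<^const>\<open>vRe\<close> only changes its type.\<close>

definition cm_param :: "(real \<Rightarrow> real^'n) \<Rightarrow> (real \<Rightarrow> complex^'n) \<Rightarrow> (real \<Rightarrow> complex \<Rightarrow> real^'n)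
    \<Rightarrow> real \<Rightarrow> complex \<Rightarrow> real^'n" where
  "cm_param u0 v H \<tau> \<xi> = u0 \<tau> + vRe (\<xi> *s v \<tau> + cnj \<xi> *s vcnj (v \<tau>)) + H \<tau> \<xi>"

text \<open>\<open>R1\<close> and \<open>R2\<close> are the higher-order terms in the equations for \<open>\<tau>\<close> and \<open>\<xi>\<close>.
  They are required to be \<open>C\<^sup>1\<close> so that the restricted system has local solutions through
  every point: with merely bounded remainders the invariance condition could be vacuous.
  \<open>C\<^sup>4\<close> regularity of \<open>H\<close> lets the \<open>h\<^sub>k\<^sub>l\<close> be differentiated in \<open>\<tau>\<close>.\<close>

definition R4_normal_form ::
  "(real^'n \<Rightarrow> real^'n) \<Rightarrow> (real \<Rightarrow> real^'n) \<Rightarrow> real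
    \<Rightarrow> (real \<Rightarrow> complex^'n) \<Rightarrow> (real \<Rightarrow> real^'n)
    \<Rightarrow> (real \<Rightarrow> complex \<Rightarrow> real^'n) \<Rightarrow> (nat \<Rightarrow> nat \<Rightarrow> real \<Rightarrow> complex^'n)
    \<Rightarrow> real \<Rightarrow> complex \<Rightarrow> complex \<Rightarrow> complex \<Rightarrow> complex \<Rightarrow> bool" where
  "R4_normal_form F u0 T v \<phi> H h \<alpha>1 \<alpha>2 \<alpha>3 c d \<longleftrightarrow>
     (\<forall>k l. 2 \<le> k + l \<and> k + l \<le> 3 \<longrightarrow>
        (\<forall>\<tau>. h k l \<tau> = vcnj (h l k \<tau>)) \<and>
        (\<forall>\<tau>. h k l \<tau> = (exp (- (\<i> * of_real (pi/2))) ^ k * exp (\<i> * of_real (pi/2)) ^ l)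
                           *s h k l (\<tau> + T))) \<and>
     integral {0..T} (\<lambda>\<tau>. hinner (cvec (\<phi> \<tau>)) (h 1 1 \<tau>)) = 0 \<and>
     \<alpha>3 = cnj \<alpha>2 \<and>
     (\<exists>\<delta>>0. \<exists>K. \<exists>R1 :: real \<Rightarrow> complex \<Rightarrow> real. \<exists>R2 :: real \<Rightarrow> complex \<Rightarrow> complex.
        Ck_on 4 (\<lambda>(\<tau>, \<xi>). H \<tau> \<xi>) (UNIV \<times> ball 0 \<delta>) \<and>
        Ck_on 1 (\<lambda>(\<tau>, \<xi>). R1 \<tau> \<xi>) (UNIV \<times> ball 0 \<delta>) \<and>
        Ck_on 1 (\<lambda>(\<tau>, \<xi>). R2 \<tau> \<xi>) (UNIV \<times> ball 0 \<delta>) \<and>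
        (\<forall>\<tau>. \<forall>\<xi>\<in>ball 0 \<delta>.
           H (\<tau> + 4 * T) \<xi> = H \<tau> \<xi> \<and>
           R1 (\<tau> + 4 * T) \<xi> = R1 \<tau> \<xi> \<and>
           R2 (\<tau> + 4 * T) \<xi> = R2 \<tau> \<xi> \<and>
           norm (cvec (H \<tau> \<xi>)
             - (\<Sum>k\<le>3. \<Sum>l | 2 \<le> k + l \<and> k + l \<le> 3.
                  (1 / (fact k * fact l) * \<xi> ^ k * cnj \<xi> ^ l) *s h k l \<tau>)) \<le> K * cmod \<xi> ^ 4 \<and>
           \<bar>R1 \<tau> \<xi>\<bar> \<le> K * cmod \<xi> ^ 5 \<and>
           cmod (R2 \<tau> \<xi>) \<le> K * cmod \<xi> ^ 5) \<and>
        (\<forall>a b. \<forall>\<theta> :: real \<Rightarrow> real. \<forall>z :: real \<Rightarrow> complex.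
           (\<forall>t\<in>{a<..<b}.
              z t \<in> ball 0 \<delta> \<and>
              ((\<lambda>s. complex_of_real (\<theta> s)) has_vector_derivative
                 1 + of_real \<alpha>1 * of_real (cmod (z t) ^ 2) + \<alpha>2 * z t ^ 4 + \<alpha>3 * cnj (z t) ^ 4
                   + of_real (R1 (\<theta> t) (z t))) (at t) \<and>
              (z has_vector_derivative
                 c * z t * of_real (cmod (z t) ^ 2) + d * cnj (z t) ^ 3 + R2 (\<theta> t) (z t)) (at t))
           \<longrightarrow>
           (\<forall>t\<in>{a<..<b}.
              ((\<lambda>s. cm_param u0 v H (\<theta> s) (z s)) has_vector_derivative
                 F (cm_param u0 v H (\<theta> t) (z t))) (at t))))"

definition h20_problem ::
  "(real^'n \<Rightarrow> real^'n) \<Rightarrow> (real \<Rightarrow> real^'n) \<Rightarrow> real \<Rightarrow> (real \<Rightarrow> complex^'n)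
    \<Rightarrow> (real \<Rightarrow> complex^'n) \<Rightarrow> bool" where
  "h20_problem F u0 T v x \<longleftrightarrow>
     (\<forall>\<tau>\<in>{0..T}. \<exists>x'. (x has_vector_derivative x') (at \<tau> within {0..T}) \<and>
        x' - cmat (Amat F u0 \<tau>) *v x \<tau> - Bform F u0 \<tau> (v \<tau>) (v \<tau>) = 0) \<and>
     x T + x 0 = 0"

definition h11_problem ::
  "(real^'n \<Rightarrow> real^'n) \<Rightarrow> (real \<Rightarrow> real^'n) \<Rightarrow> real \<Rightarrow> (real \<Rightarrow> complex^'n)
    \<Rightarrow> (real \<Rightarrow> real^'n) \<Rightarrow> real \<Rightarrow> (real \<Rightarrow> complex^'n) \<Rightarrow> bool" where
  "h11_problem F u0 T v \<phi> \<alpha>1 x \<longleftrightarrow>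
     (\<forall>\<tau>\<in>{0..T}. \<exists>x'. (x has_vector_derivative x') (at \<tau> within {0..T}) \<and>
        x' - cmat (Amat F u0 \<tau>) *v x \<tau> - Bform F u0 \<tau> (v \<tau>) (vcnj (v \<tau>))
          + of_real \<alpha>1 *s cvec (vector_derivative u0 (at \<tau>)) = 0) \<and>
     x T - x 0 = 0 \<and>
     integral {0..T} (\<lambda>\<tau>. hinner (cvec (\<phi> \<tau>)) (x \<tau>)) = 0"

definition unique_solution_on ::
  "real set \<Rightarrow> ((real \<Rightarrow> 'a) \<Rightarrow> bool) \<Rightarrow> (real \<Rightarrow> 'a) \<Rightarrow> bool" where
  "unique_solution_on I P x \<longleftrightarrow> P x \<and> (\<forall>y. P y \<longrightarrow> (\<forall>\<tau>\<in>I. y \<tau> = x \<tau>))"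

end

theory Submission
  imports Defs
begin

text \<open>Fix \<open>w\<close> with \<open>cmod w = 1\<close> and put \<open>\<xi> = s w\<close>. Picard iteration gives a solution of the restricted
  system through every point, so invariance of the manifold becomes a partial differential equation
  for \<open>H\<close>. Along the ray it says that
  \<open>(1 + \<alpha>\<^sub>1 s\<^sup>2) H(\<tau>, s w) - s\<^sup>2 \<integral> G\<^sub>2 - s\<^sup>3 \<integral> G\<^sub>3\<close> has a \<open>\<tau>\<close>-derivative that is \<open>o(s\<^sup>3)\<close> uniformly in \<open>\<tau>\<close>;
  by the mean value theorem the quadratic and cubic parts of \<open>H\<close> then satisfy the linear equations
  with right-hand sides \<open>G\<^sub>2\<close> and \<open>G\<^sub>3\<close>, and no Taylor expansion of \<open>\<partial>H/\<partial>\<tau>\<close> is needed. Averaging over a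
  few \<open>w\<close> isolates the equation of each coefficient. Pairing with the adjoint eigenfunctions
  (Fredholm solvability) yields \<open>\<alpha>\<^sub>1\<close>, \<open>c\<close> and \<open>d\<close>; uniqueness of \<open>h\<^sub>2\<^sub>0\<close> and \<open>h\<^sub>1\<^sub>1\<close> holds because \<open>-1\<close> is not a
  multiplier and \<open>1\<close> is a simple one. For the rotated \<open>\<gamma> v\<close>, composing \<open>H\<close> with multiplication by \<open>\<gamma>\<close>
  gives one normal form, and the formulas show that every other one has the same coefficients.\<close>

section \<open>Directional derivatives\<close>

text \<open>The bound on \<open>H\<close> controls values only: nothing is said about derivatives of
  its remainder, and the \<open>h k l\<close> carry no regularity in \<tau>. So continuity of the
  homogeneous parts comes from uniform limits of combinations of \<open>H\<close>, and their
  differentiability from an integral equation. The displacement along a ray is kept exact, with the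
  cubic quotient \<open>y3\<close> in place of its limit, so that every error has a name and an
  estimate. The \<xi>-derivative of \<open>H\<close> is multiplied by a velocity of order
  \<open>s ^ 3\<close> and vanishes at \<xi> = 0, since \<open>H\<close> is quadratically small; it
  therefore stays below third order. The resonance shows in the boundary conditions over one period:
  h12 and h03 pick up the factors -i and i, exactly those of \<open>vcnj v\<close> and
  \<open>v\<close>, so their equations can be solved for one value of \<open>c\<close> and of
  \<open>d\<close> only. For h11, which is periodic, the same mechanism fixes
  \<open>\<alpha>1\<close>, and a multiple of the orbit velocity remains free until the integral
  condition removes it.\<close>

lemma Ck_on_SucD: "Ck_on (Suc k) f S \<Longrightarrow> Ck_on k f S"
proof (induction k arbitrary: f)
  case 0
  then show ?case
    by (auto intro!: continuous_at_imp_continuous_on differentiable_imp_continuous_within)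
next
  case (Suc k)
  then show ?case by simp
qed

lemma Ck_on_mono: "Ck_on m f S \<Longrightarrow> k \<le> m \<Longrightarrow> Ck_on k f S"
proof (induction m)
  case (Suc m)
  then show ?case using Ck_on_SucD le_Suc_eq by blast
qed simp

lemma dir_deriv_eqI: "(f has_derivative f') (at x) \<Longrightarrow> dir_deriv w f x = f' w"
  unfolding dir_deriv_def by (metis frechet_derivative_at)

lemma has_derivative_dir_deriv:
  "f differentiable (at x) \<Longrightarrow> (f has_derivative (\<lambda>w. dir_deriv w f x)) (at x)"
  unfolding dir_deriv_def by (simp add: frechet_derivative_works)

lemma bounded_linear_dir_deriv:
  "f differentiable (at x) \<Longrightarrow> bounded_linear (\<lambda>w. dir_deriv w f x)"
  by (rule has_derivative_bounded_linear[OF has_derivative_dir_deriv])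

text \<open>On an open set the derivative at a point depends only on values inside the set; this
  passes to all orders by induction.\<close>

lemma Ck_on_cong:
  assumes "open S" "\<And>x. x \<in> S \<Longrightarrow> f x = g x" "Ck_on k f S"
  shows "Ck_on k g S"
  using assms(2,3)
proof (induction k arbitrary: f g)
  case 0
  then show ?case by (simp cong: continuous_on_cong)
next
  case (Suc k)
  have D: "(g has_derivative (\<lambda>w. dir_deriv w f x)) (at x)" if "x \<in> S" for x
    using Suc.prems that assms(1)
    by (intro has_derivative_transform_within_open[OF has_derivative_dir_deriv]) auto
  have "Ck_on k (dir_deriv w g) S" for w
    by (rule Suc.IH[of "dir_deriv w f"]) (use Suc.prems dir_deriv_eqI[OF D] in auto)
  then show ?case using D by (auto simp: differentiable_def)
qed

text \<open>Meant for the rotation: \<open>L\<close> is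
  \<open>(\<tau>, \<xi>) \<mapsto> (\<tau>, \<gamma> * \<xi>)\<close> and \<open>M\<close> the
  identity or multiplication by \<open>cnj \<gamma>\<close>. Linearity closes the induction, because
  a directional derivative has the same shape again, with \<open>dir_deriv (L w) f\<close> in place
  of \<open>f\<close>.\<close>

lemma Ck_on_linear_compose:
  assumes S: "open S" "open S'" and L: "bounded_linear L" and M: "bounded_linear M"
    and L': "\<And>x. x \<in> S' \<Longrightarrow> L x \<in> S" and f: "Ck_on k f S"
  shows "Ck_on k (\<lambda>x. M (f (L x))) S'"
  using f
proof (induction k arbitrary: f)
  case 0
  have "continuous_on S' (f \<circ> L)"
    unfolding o_def by (rule continuous_on_compose2[OF 0[unfolded Ck_on.simps] linear_continuous_on[OF L]])
      (use L' in auto)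
  then show ?case using continuous_on_compose2[OF linear_continuous_on[OF M, of UNIV]]
    by (auto simp: o_def)
next
  case (Suc k)
  have D: "((\<lambda>x. M (f (L x))) has_derivative (\<lambda>w. M (dir_deriv (L w) f (L x)))) (at x)"
    if "x \<in> S'" for x
  proof -
    have "((f \<circ> L) has_derivative (\<lambda>w. dir_deriv w f (L x)) \<circ> L) (at x)"
      by (rule diff_chain_at) (use Suc.prems L' that in
        \<open>auto intro!: bounded_linear_imp_has_derivative L has_derivative_dir_deriv\<close>)
    from bounded_linear.has_derivative[OF M this] show ?thesis by (simp add: o_def)
  qed
  have "Ck_on k (dir_deriv w (\<lambda>x. M (f (L x)))) S'" for w
    by (rule Ck_on_cong[OF S(2) _ Suc.IH[of "dir_deriv (L w) f"]])
      (use Suc.prems dir_deriv_eqI[OF D] in auto)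
  then show ?case using D by (auto simp: differentiable_def)
qed

section \<open>Restriction to lines and symmetry of second derivatives\<close>

lemma has_vector_derivative_line:
  assumes "f differentiable (at (p + s *\<^sub>R a))"
  shows "((\<lambda>s. f (p + s *\<^sub>R a)) has_vector_derivative dir_deriv a f (p + s *\<^sub>R a)) (at s within X)"
proof -
  interpret L: bounded_linear "\<lambda>w. dir_deriv w f (p + s *\<^sub>R a)"
    by (rule bounded_linear_dir_deriv[OF assms])
  have "(f has_derivative (\<lambda>w. dir_deriv w f (p + s *\<^sub>R a))) (at (p + s *\<^sub>R a) within (\<lambda>s. p + s *\<^sub>R a) ` X)"
    by (rule has_derivative_at_withinI[OF has_derivative_dir_deriv[OF assms]])
  then have "((f \<circ> (\<lambda>s. p + s *\<^sub>R a)) has_derivative (\<lambda>w. dir_deriv w f (p + s *\<^sub>R a)) \<circ> (\<lambda>h. h *\<^sub>R a)) (at s within X)"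
    by (intro diff_chain_within) (auto intro!: derivative_eq_intros)
  then show ?thesis
    by (simp add: has_vector_derivative_def o_def L.scaleR)
qed

lemma dir_deriv_axis_expand:
  fixes f :: "real^'n \<Rightarrow> 'b::real_normed_vector"
  assumes "f differentiable (at x)"
  shows "dir_deriv w f x = (\<Sum>i\<in>UNIV. (w $ i) *\<^sub>R dir_deriv (axis i 1) f x)"
proof -
  interpret L: bounded_linear "\<lambda>w. dir_deriv w f x"
    by (rule bounded_linear_dir_deriv[OF assms])
  have "dir_deriv w f x = dir_deriv (\<Sum>i\<in>UNIV. (w $ i) *\<^sub>R axis i 1) f x"
    using basis_expansion[of w] by (simp add: scalar_mult_eq_scaleR)
  then show ?thesis by (simp add: L.sum L.scaleR)
qed

text \<open>The mean value theorem is applied twice, in direction \<open>b\<close> to an increment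
  in direction \<open>a\<close>, and then in direction \<open>a\<close>. Pairing with
  \<open>u\<close> makes the functions real-valued, as the theorem with equality fails for
  vectors.\<close>

lemma second_difference_mvt:
  fixes f :: "'a::real_normed_vector \<Rightarrow> 'b::real_inner"
  assumes f: "Ck_on 2 f UNIV" and s: "s > 0"
  shows "\<exists>r r'. 0 < r \<and> r < s \<and> 0 < r' \<and> r' < s \<and>
    u \<bullet> (f (p + s *\<^sub>R a + s *\<^sub>R b) - f (p + s *\<^sub>R b) - (f (p + s *\<^sub>R a) - f p))
      = s\<^sup>2 * (u \<bullet> dir_deriv a (dir_deriv b f) (p + r *\<^sub>R b + r' *\<^sub>R a))"
proof -
  have d1: "f differentiable (at x)" and d2: "dir_deriv w f differentiable (at x)" for x w
    using f by (auto simp: numeral_2_eq_2)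
  define g where "g r = u \<bullet> (f ((p + s *\<^sub>R a) + r *\<^sub>R b) - f (p + r *\<^sub>R b))" for r
  have "(g has_derivative (*) (u \<bullet> (dir_deriv b f ((p + s *\<^sub>R a) + r *\<^sub>R b) - dir_deriv b f (p + r *\<^sub>R b)))) (at r within {0..s})" for r
  proof -
    have "((\<lambda>r. f ((p + s *\<^sub>R a) + r *\<^sub>R b) - f (p + r *\<^sub>R b)) has_vector_derivative
      (dir_deriv b f ((p + s *\<^sub>R a) + r *\<^sub>R b) - dir_deriv b f (p + r *\<^sub>R b))) (at r within {0..s})"
      by (intro has_vector_derivative_diff has_vector_derivative_line d1)
    from bounded_linear.has_vector_derivative[OF bounded_linear_inner_right this, of u]
    show ?thesis unfolding g_def has_real_derivative_iff_has_vector_derivative[symmetric] has_field_derivative_def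
      by (simp add: mult.commute)
  qed
  from mvt_simple[OF s this] obtain r where r: "0 < r" "r < s" and
    gr: "g s - g 0 = (u \<bullet> (dir_deriv b f ((p + s *\<^sub>R a) + r *\<^sub>R b) - dir_deriv b f (p + r *\<^sub>R b))) * s"
    by auto
  define k where "k r' = u \<bullet> dir_deriv b f ((p + r *\<^sub>R b) + r' *\<^sub>R a)" for r'
  have "(k has_derivative (*) (u \<bullet> dir_deriv a (dir_deriv b f) ((p + r *\<^sub>R b) + r' *\<^sub>R a))) (at r' within {0..s})" for r'
  proof -
    have "((\<lambda>r'. dir_deriv b f ((p + r *\<^sub>R b) + r' *\<^sub>R a)) has_vector_derivative
      dir_deriv a (dir_deriv b f) ((p + r *\<^sub>R b) + r' *\<^sub>R a)) (at r' within {0..s})"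
      by (intro has_vector_derivative_line d2)
    from bounded_linear.has_vector_derivative[OF bounded_linear_inner_right this, of u]
    show ?thesis unfolding k_def has_real_derivative_iff_has_vector_derivative[symmetric] has_field_derivative_def
      by (simp add: mult.commute)
  qed
  from mvt_simple[OF s this] obtain r' where r': "0 < r'" "r' < s" and
    kr: "k s - k 0 = (u \<bullet> dir_deriv a (dir_deriv b f) (p + r *\<^sub>R b + r' *\<^sub>R a)) * s"
    by auto
  have "p + s *\<^sub>R a + r *\<^sub>R b = p + r *\<^sub>R b + s *\<^sub>R a" by simp
  then have "g s - g 0 = (k s - k 0) * s"
    by (simp only: gr k_def inner_diff_right) simp
  then have "g s - g 0 = s\<^sup>2 * (u \<bullet> dir_deriv a (dir_deriv b f) (p + r *\<^sub>R b + r' *\<^sub>R a))"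
    by (simp add: kr power2_eq_square)
  then show ?thesis using r r' unfolding g_def
    by (intro exI[of _ r] exI[of _ r']) (simp add: inner_diff_right)
qed

lemma second_difference_tendsto:
  fixes f :: "'a::real_normed_vector \<Rightarrow> 'b::real_inner"
  assumes f: "Ck_on 2 f UNIV"
  shows "((\<lambda>s. u \<bullet> (f (p + s *\<^sub>R a + s *\<^sub>R b) - f (p + s *\<^sub>R b) - (f (p + s *\<^sub>R a) - f p)) / s\<^sup>2)
    \<longlongrightarrow> u \<bullet> dir_deriv a (dir_deriv b f) p) (at_right 0)"
proof -
  let ?D = "\<lambda>s. u \<bullet> (f (p + s *\<^sub>R a + s *\<^sub>R b) - f (p + s *\<^sub>R b) - (f (p + s *\<^sub>R a) - f p))"
  have "\<exists>r r'. \<forall>s>0. 0 < r s \<and> r s < s \<and> 0 < r' s \<and> r' s < s \<and>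
     ?D s = s\<^sup>2 * (u \<bullet> dir_deriv a (dir_deriv b f) (p + r s *\<^sub>R b + r' s *\<^sub>R a))"
    using second_difference_mvt[OF f, of _ u p a b] by metis
  then obtain r r' where rr: "\<And>s::real. s > 0 \<Longrightarrow> 0 < r s \<and> r s < s \<and> 0 < r' s \<and> r' s < s \<and>
     ?D s = s\<^sup>2 * (u \<bullet> dir_deriv a (dir_deriv b f) (p + r s *\<^sub>R b + r' s *\<^sub>R a))" by blast
  have r0: "(r \<longlongrightarrow> 0) (at_right 0)"
    by (rule tendsto_sandwich[of "\<lambda>_. 0" _ _ "\<lambda>s. s"])
      (use rr in \<open>auto simp: eventually_at_filter less_imp_le\<close>)
  have r'0: "(r' \<longlongrightarrow> 0) (at_right 0)"
    by (rule tendsto_sandwich[of "\<lambda>_. 0" _ _ "\<lambda>s. s"])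
      (use rr in \<open>auto simp: eventually_at_filter less_imp_le\<close>)
  have "continuous_on UNIV (dir_deriv a (dir_deriv b f))"
    using f by (simp add: numeral_2_eq_2)
  then have c: "isCont (dir_deriv a (dir_deriv b f)) (p + 0 *\<^sub>R b + 0 *\<^sub>R a)"
    by (simp add: continuous_on_eq_continuous_at)
  have "((\<lambda>s. p + r s *\<^sub>R b + r' s *\<^sub>R a) \<longlongrightarrow> p + 0 *\<^sub>R b + 0 *\<^sub>R a) (at_right 0)"
    by (intro tendsto_intros r0 r'0)
  from isCont_tendsto_compose[OF c this]
  have "((\<lambda>s. u \<bullet> dir_deriv a (dir_deriv b f) (p + r s *\<^sub>R b + r' s *\<^sub>R a)) \<longlongrightarrow>
      u \<bullet> dir_deriv a (dir_deriv b f) p) (at_right 0)"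
    by (intro tendsto_intros) simp
  then show ?thesis
  proof (rule Lim_transform_eventually)
    show "\<forall>\<^sub>F s in at_right 0. u \<bullet> dir_deriv a (dir_deriv b f) (p + r s *\<^sub>R b + r' s *\<^sub>R a) = ?D s / s\<^sup>2"
      using eventually_at_right_less[of 0]
    proof eventually_elim
      case (elim s)
      then have "?D s = s\<^sup>2 * (u \<bullet> dir_deriv a (dir_deriv b f) (p + r s *\<^sub>R b + r' s *\<^sub>R a))"
        using rr by blast
      then show ?case using elim by simp
    qed
  qed
qed

text \<open>The second difference is symmetric in \<open>a\<close> and \<open>b\<close>, so both
  iterated derivatives are limits of the same quotient.\<close>

lemma dir_deriv_commute:
  fixes f :: "'a::real_normed_vector \<Rightarrow> 'b::real_inner"
  assumes f: "Ck_on 2 f UNIV"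
  shows "dir_deriv a (dir_deriv b f) p = dir_deriv b (dir_deriv a f) p"
proof -
  have "u \<bullet> dir_deriv a (dir_deriv b f) p = u \<bullet> dir_deriv b (dir_deriv a f) p" for u
  proof -
    have eq: "(\<lambda>s. u \<bullet> (f (p + s *\<^sub>R a + s *\<^sub>R b) - f (p + s *\<^sub>R b) - (f (p + s *\<^sub>R a) - f p)) / s\<^sup>2)
       = (\<lambda>s. u \<bullet> (f (p + s *\<^sub>R b + s *\<^sub>R a) - f (p + s *\<^sub>R a) - (f (p + s *\<^sub>R b) - f p)) / s\<^sup>2)"
    proof
      fix s :: real
      have "p + s *\<^sub>R b + s *\<^sub>R a = p + s *\<^sub>R a + s *\<^sub>R b" by simp
      show "u \<bullet> (f (p + s *\<^sub>R a + s *\<^sub>R b) - f (p + s *\<^sub>R b) - (f (p + s *\<^sub>R a) - f p)) / s\<^sup>2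
        = u \<bullet> (f (p + s *\<^sub>R b + s *\<^sub>R a) - f (p + s *\<^sub>R a) - (f (p + s *\<^sub>R b) - f p)) / s\<^sup>2"
        unfolding \<open>p + s *\<^sub>R b + s *\<^sub>R a = _\<close> by (simp add: inner_diff_right)
    qed
    show ?thesis
      by (rule tendsto_unique[OF trivial_limit_at_right_real second_difference_tendsto[OF f, of u p a b, unfolded eq]
          second_difference_tendsto[OF f]])
  qed
  \<comment> \<open>Testing against the difference of the two sides makes its squared norm
    vanish.\<close>
  note eq = this[of "dir_deriv a (dir_deriv b f) p - dir_deriv b (dir_deriv a f) p"]
  have "(dir_deriv a (dir_deriv b f) p - dir_deriv b (dir_deriv a f) p) \<bullet>
      (dir_deriv a (dir_deriv b f) p - dir_deriv b (dir_deriv a f) p) = 0"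
    using eq by (simp only: inner_diff_right[of "dir_deriv a (dir_deriv b f) p - dir_deriv b (dir_deriv a f) p"
      "dir_deriv a (dir_deriv b f) p" "dir_deriv b (dir_deriv a f) p"])
  then show ?thesis by simp
qed

section \<open>Uniform third-order Taylor expansion\<close>

lemma dir_deriv_dir_deriv_expand:
  fixes f :: "real^'n \<Rightarrow> 'b::real_normed_vector"
  assumes "\<And>q. f differentiable (at q)" and d: "\<And>j. dir_deriv (axis j 1) f differentiable (at p)"
  shows "dir_deriv w (dir_deriv x f) p = (\<Sum>j\<in>UNIV. (x $ j) *\<^sub>R dir_deriv w (dir_deriv (axis j 1) f) p)"
proof -
  have "dir_deriv x f = (\<lambda>q. \<Sum>j\<in>UNIV. (x $ j) *\<^sub>R dir_deriv (axis j 1) f q)"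
    using dir_deriv_axis_expand assms by blast
  moreover have "((\<lambda>q. \<Sum>j\<in>UNIV. (x $ j) *\<^sub>R dir_deriv (axis j 1) f q) has_derivative
     (\<lambda>w. \<Sum>j\<in>UNIV. (x $ j) *\<^sub>R dir_deriv w (dir_deriv (axis j 1) f) p)) (at p)"
    by (intro has_derivative_sum has_derivative_scaleR_right has_derivative_dir_deriv d)
  ultimately show ?thesis by (simp add: dir_deriv_eqI)
qed

text \<open>The real forms behind \<open>Bform\<close> and \<open>Cform\<close>, at an arbitrary
  point. Taylor estimates are made in real space; \<open>cvec_B2\<close> and \<open>cvec_C3\<close>
  pass to the complex extension afterwards.\<close>

definition B2 :: "(real^'n \<Rightarrow> real^'n) \<Rightarrow> real^'n \<Rightarrow> real^'n \<Rightarrow> real^'n \<Rightarrow> real^'n" where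
  "B2 F p x y = (\<Sum>i\<in>UNIV. \<Sum>j\<in>UNIV. (x $ i * y $ j) *\<^sub>R
     dir_deriv (axis i 1) (dir_deriv (axis j 1) F) p)"

definition C3 :: "(real^'n \<Rightarrow> real^'n) \<Rightarrow> real^'n \<Rightarrow> real^'n \<Rightarrow> real^'n \<Rightarrow> real^'n \<Rightarrow> real^'n" where
  "C3 F p x y z = (\<Sum>i\<in>UNIV. \<Sum>j\<in>UNIV. \<Sum>k\<in>UNIV. (x $ i * y $ j * z $ k) *\<^sub>R
     dir_deriv (axis i 1) (dir_deriv (axis j 1) (dir_deriv (axis k 1) F)) p)"

lemma B2_eq_dir_deriv:
  assumes F: "Ck_on 2 F UNIV"
  shows "B2 F p x y = dir_deriv x (dir_deriv y F) p"
proof -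
  have d: "F differentiable (at q)" "dir_deriv w F differentiable (at q)" for q w
    using F by (auto simp: numeral_2_eq_2)
  show ?thesis
    unfolding B2_def dir_deriv_dir_deriv_expand[OF d(1) d(2), of x y]
    unfolding dir_deriv_axis_expand[OF d(2), of x] scaleR_sum_right by (subst sum.swap) (simp add: mult.commute)
qed

lemma C3_eq_dir_deriv:
  assumes F: "Ck_on 3 F UNIV"
  shows "C3 F p x y z = dir_deriv x (dir_deriv y (dir_deriv z F)) p"
proof -
  have d: "F differentiable (at q)" "dir_deriv w F differentiable (at q)"
     "dir_deriv w' (dir_deriv w F) differentiable (at q)" for q w w'
    using F by (auto simp: numeral_3_eq_3)
  have 1: "dir_deriv y (dir_deriv z F) = (\<lambda>q. \<Sum>k\<in>UNIV. (z $ k) *\<^sub>R dir_deriv y (dir_deriv (axis k 1) F) q)"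
    by (rule ext, rule dir_deriv_dir_deriv_expand[OF d(1) d(2)])
  have 2: "dir_deriv x (dir_deriv y (dir_deriv z F)) p =
      (\<Sum>k\<in>UNIV. (z $ k) *\<^sub>R dir_deriv x (dir_deriv y (dir_deriv (axis k 1) F)) p)"
    unfolding 1 by (intro dir_deriv_eqI has_derivative_sum has_derivative_scaleR_right has_derivative_dir_deriv d)
  have 3: "dir_deriv x (dir_deriv y (dir_deriv a F)) p =
      (\<Sum>i\<in>UNIV. (x $ i) *\<^sub>R (\<Sum>j\<in>UNIV. (y $ j) *\<^sub>R dir_deriv (axis i 1) (dir_deriv (axis j 1) (dir_deriv a F)) p))" for a
    unfolding dir_deriv_dir_deriv_expand[OF d(2) d(3), of x y]
    unfolding dir_deriv_axis_expand[OF d(3), of x] scaleR_sum_right by (subst sum.swap) (simp add: mult.commute)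
  have "C3 F p x y z = (\<Sum>i\<in>UNIV. \<Sum>k\<in>UNIV. \<Sum>j\<in>UNIV. (x $ i * y $ j * z $ k) *\<^sub>R
     dir_deriv (axis i 1) (dir_deriv (axis j 1) (dir_deriv (axis k 1) F)) p)"
    unfolding C3_def by (rule sum.cong[OF refl], rule sum.swap)
  also have "\<dots> = (\<Sum>k\<in>UNIV. \<Sum>i\<in>UNIV. \<Sum>j\<in>UNIV. (x $ i * y $ j * z $ k) *\<^sub>R
     dir_deriv (axis i 1) (dir_deriv (axis j 1) (dir_deriv (axis k 1) F)) p)"
    by (rule sum.swap)
  also have "\<dots> = dir_deriv x (dir_deriv y (dir_deriv z F)) p"
    unfolding 2 unfolding 3 by (simp add: scaleR_sum_right mult_ac)
  finally show ?thesis .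
qed

text \<open>There are \<open>CARD('n) ^ 3\<close> index triples, and each product of three
  coordinates is at most \<open>norm x ^ 3\<close>.\<close>

lemma abs_C3_nth_le:
  assumes "\<And>i j k. \<bar>dir_deriv (axis i 1) (dir_deriv (axis j 1) (dir_deriv (axis k 1) F)) p $ l
     - dir_deriv (axis i 1) (dir_deriv (axis j 1) (dir_deriv (axis k 1) F)) q $ l\<bar> \<le> e"
  shows "\<bar>(C3 F p x x x - C3 F q x x x) $ l\<bar> \<le> real (CARD('n)) ^ 3 * e * norm (x :: real^'n) ^ 3"
proof -
  let ?d = "\<lambda>i j k. dir_deriv (axis i 1) (dir_deriv (axis j 1) (dir_deriv (axis k 1) F)) p $ l
     - dir_deriv (axis i 1) (dir_deriv (axis j 1) (dir_deriv (axis k 1) F)) q $ l"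
  have eq: "(C3 F p x x x - C3 F q x x x) $ l = (\<Sum>i\<in>UNIV. \<Sum>j\<in>UNIV. \<Sum>k\<in>UNIV. (x $ i * x $ j * x $ k) * ?d i j k)"
    by (simp add: C3_def sum_subtractf[symmetric] right_diff_distrib)
  have "\<bar>(C3 F p x x x - C3 F q x x x) $ l\<bar> \<le> (\<Sum>i\<in>(UNIV::'n set). \<Sum>j\<in>(UNIV::'n set). \<Sum>k\<in>(UNIV::'n set). (norm x * norm x * norm x) * e)"
    unfolding eq
  proof (intro order_trans[OF sum_abs] sum_mono)
    fix i j k
    have "0 \<le> e" using assms[of i j k] by linarith
    then show "\<bar>x $ i * x $ j * x $ k * ?d i j k\<bar> \<le> norm x * norm x * norm x * e"
      unfolding abs_mult using assms[of i j k] Finite_Cartesian_Product.norm_nth_le[of x]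
      by (intro mult_mono) (auto intro!: mult_nonneg_nonneg)
  qed
  also have "\<dots> = real (CARD('n)) ^ 3 * e * norm x ^ 3"
    by (simp only: sum_constant power3_eq_cube mult_ac)
  finally show ?thesis .
qed

text \<open>With three continuous derivatives the error is only o of \<open>norm x ^ 3\<close>. The
  Lagrange form leaves the difference of \<open>C3\<close> at an intermediate point and at
  \<open>p\<close>, which uniform continuity of the third derivatives near \<open>K\<close> makes
  small for all \<open>p\<close> at once.\<close>

lemma taylor_order_3_uniform:
  fixes F :: "real^'n \<Rightarrow> real^'n"
  assumes F: "Ck_on 3 F UNIV" and K: "compact K" and e: "e > 0"
  shows "\<exists>\<eta>>0. \<forall>p\<in>K. \<forall>x. norm x < \<eta> \<longrightarrow>
    norm (F (p + x) - F p - dir_deriv x F p - (1/2) *\<^sub>R B2 F p x x - (1/6) *\<^sub>R C3 F p x x x) \<le> e * norm x ^ 3"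
proof -
  let ?T = "\<lambda>i j k. dir_deriv (axis i 1) (dir_deriv (axis j 1) (dir_deriv (axis k 1) F))"
  define T where "T q = (\<chi> i j k. ?T i j k q)" for q
  let ?n = "real (CARD('n))"
  \<comment> \<open>Three factors \<open>?n\<close> pay for the triple sum in
    \<open>abs_C3_nth_le\<close>, the fourth for bounding the norm by the sum of the
    components.\<close>
  define e' where "e' = e / ?n ^ 4"
  have e': "e' > 0" using e by (simp add: e'_def)
  have d: "F differentiable (at q)" "dir_deriv w F differentiable (at q)"
     "dir_deriv w' (dir_deriv w F) differentiable (at q)"
     "continuous_on UNIV (dir_deriv w'' (dir_deriv w' (dir_deriv w F)))" for q w w' w''
    using F by (auto simp: numeral_3_eq_3)
  have F2: "Ck_on 2 F UNIV" using F by (rule Ck_on_mono) simp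
  \<comment> \<open>The closed unit neighbourhood of \<open>K\<close> contains every segment from
    \<open>p\<close> to \<open>p + x\<close> with \<open>norm x \<le> 1\<close>.\<close>
  define K' where "K' = {p + x | p x. p \<in> K \<and> x \<in> cball 0 1}"
  have K'I: "p + x \<in> K'" if "p \<in> K" "norm x \<le> 1" for p x
    using that by (auto simp: K'_def)
  have K': "compact K'" unfolding K'_def by (rule compact_sums[OF K compact_cball])
  have "continuous_on K' T" unfolding T_def
    by (intro continuous_on_vec_lambda continuous_on_subset[OF d(4)]) auto
  then have "uniformly_continuous_on K' T" using K' by (rule compact_uniformly_continuous)
  then obtain \<eta> where \<eta>: "\<eta> > 0" "\<And>p q. p \<in> K' \<Longrightarrow> q \<in> K' \<Longrightarrow> dist q p < \<eta> \<Longrightarrow> dist (T q) (T p) < e'"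
    unfolding uniformly_continuous_on_def using e' by metis
  show ?thesis
  proof (intro exI[of _ "min \<eta> 1"] conjI ballI allI impI)
    fix p x :: "real^'n" assume p: "p \<in> K" and x: "norm x < min \<eta> 1"
    let ?r = "F (p + x) - F p - dir_deriv x F p - (1/2) *\<^sub>R B2 F p x x - (1/6) *\<^sub>R C3 F p x x x"
    \<comment> \<open>Componentwise, because the intermediate point \<open>t\<close> of the Lagrange
      remainder depends on \<open>l\<close>.\<close>
    have "\<bar>?r $ l\<bar> \<le> ?n ^ 3 * e' * norm x ^ 3" for l
    proof -
      define D where "D m = (if m = 0 then F else if m = 1 then dir_deriv x F else
        if m = 2 then dir_deriv x (dir_deriv x F) else dir_deriv x (dir_deriv x (dir_deriv x F)))" for m :: nat
      define g where "g m t = D m (p + t *\<^sub>R x) $ l" for m t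
      have "DERIV (g m) t :> g (Suc m) t" if "m < 3" for m t
      proof -
        have DS: "D (Suc m) = dir_deriv x (D m)" "D m differentiable (at q)" for q
          using that d by (auto simp: D_def less_Suc_eq numeral_3_eq_3 numeral_2_eq_2)
        have "((\<lambda>t. D m (p + t *\<^sub>R x)) has_vector_derivative D (Suc m) (p + t *\<^sub>R x)) (at t)"
          unfolding DS(1) by (rule has_vector_derivative_line[OF DS(2)])
        from bounded_linear.has_vector_derivative[OF bounded_linear_vec_nth[of l] this]
        show ?thesis unfolding g_def has_real_derivative_iff_has_vector_derivative .
      qed
      then have Mac: "\<exists>t>0. t < 1 \<and> g 0 1 = (\<Sum>m<3. g m 0 / fact m * 1 ^ m) + g 3 t / fact 3 * 1 ^ 3"
        by (intro Maclaurin[of 1 3 g "g 0"]) auto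
      obtain t where t: "0 < t" "t < 1" "g 0 1 = g 0 0 + g 1 0 + g 2 0 / 2 + g 3 t / 6"
      proof -
        have "(\<Sum>m<3. f m) = f 0 + f 1 + f 2" for f :: "nat \<Rightarrow> real" by (simp add: eval_nat_numeral)
        moreover have "fact 3 = (6 :: real)" by (simp add: eval_nat_numeral)
        ultimately show ?thesis using Mac that by auto
      qed
      have "?r $ l = g 0 1 - g 0 0 - g 1 0 - g 2 0 / 2 - g 3 0 / 6"
        by (simp add: g_def D_def B2_eq_dir_deriv[OF F2] C3_eq_dir_deriv[OF F])
      also have "\<dots> = (C3 F (p + t *\<^sub>R x) x x x - C3 F p x x x) $ l / 6"
        unfolding t by (simp add: g_def D_def C3_eq_dir_deriv[OF F] diff_divide_distrib)
      finally have r: "?r $ l = (C3 F (p + t *\<^sub>R x) x x x - C3 F p x x x) $ l / 6" .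
      have tx: "norm (t *\<^sub>R x) \<le> norm x" using t by (simp add: mult_left_le_one_le)
      have "\<bar>(C3 F (p + t *\<^sub>R x) x x x - C3 F p x x x) $ l\<bar> \<le> ?n ^ 3 * e' * norm x ^ 3"
      proof (rule abs_C3_nth_le)
        fix i j k
        have "p + t *\<^sub>R x \<in> K'" "p \<in> K'"
          using K'I[OF p, of "t *\<^sub>R x"] K'I[OF p, of 0] tx x by auto
        then have "dist (T (p + t *\<^sub>R x)) (T p) < e'"
          using tx x by (intro \<eta>(2)) (auto simp: dist_norm)
        moreover have "\<bar>(T (p + t *\<^sub>R x) - T p) $ i $ j $ k $ l\<bar> \<le> norm (T (p + t *\<^sub>R x) - T p)"
          unfolding real_norm_def[symmetric] by (intro order_trans[OF Finite_Cartesian_Product.norm_nth_le] order_refl)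
        ultimately show "\<bar>?T i j k (p + t *\<^sub>R x) $ l - ?T i j k p $ l\<bar> \<le> e'"
          by (simp add: T_def dist_norm)
      qed
      then show ?thesis unfolding r by (simp add: abs_divide)
    qed
    then have "norm ?r \<le> (\<Sum>l\<in>(UNIV::'n set). ?n ^ 3 * e' * norm x ^ 3)"
      by (intro order_trans[OF norm_le_l1_cart] sum_mono)
    also have "\<dots> = e * norm x ^ 3" by (simp add: e'_def power4_eq_xxxx power3_eq_cube)
    finally show "norm ?r \<le> e * norm x ^ 3" .
  qed (use \<eta> in auto)
qed

section \<open>Local solutions of differential equations\<close>

text \<open>Continuity of the derivative is asked for one direction at a time, as in
  \<open>Ck_on\<close>. The bounds along the basis vectors add up to a bound of the operator norm,
  and convexity turns it into a Lipschitz constant.\<close>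

lemma lipschitz_on_compact_convex:
  fixes G :: "'a::euclidean_space \<Rightarrow> 'b::real_normed_vector"
  assumes C: "compact C" "convex C"
    and G: "\<And>x. x \<in> C \<Longrightarrow> (G has_derivative G' x) (at x)"
    and G': "\<And>w. continuous_on C (\<lambda>x. G' x w)"
  shows "\<exists>L\<ge>0. \<forall>x\<in>C. \<forall>y\<in>C. dist (G x) (G y) \<le> L * dist x y"
proof -
  have "\<exists>M. \<forall>x\<in>C. norm (G' x b) \<le> M" for b
    using compact_imp_bounded[OF compact_continuous_image[OF G' C(1)], of b]
    by (auto simp: bounded_iff)
  then obtain M where M: "\<And>b x. x \<in> C \<Longrightarrow> norm (G' x b) \<le> M b" by metis
  define L where "L = (\<Sum>b\<in>(Basis::'a set). \<bar>M b\<bar>)"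
  have L: "L \<ge> 0" by (simp add: L_def sum_nonneg)
  have "onorm (G' x) \<le> L" if x: "x \<in> C" for x
  proof (rule onorm_le)
    fix w
    interpret bounded_linear "G' x" using G[OF x] by (rule has_derivative_bounded_linear)
    have "norm (G' x w) = norm (\<Sum>b\<in>Basis. (w \<bullet> b) *\<^sub>R G' x b)"
      by (subst (1) euclidean_representation[symmetric, of w]) (simp only: sum scaleR)
    also have "\<dots> \<le> (\<Sum>b\<in>Basis. \<bar>M b\<bar> * norm w)"
    proof (intro order_trans[OF norm_sum] sum_mono)
      fix b :: 'a assume b: "b \<in> Basis"
      have "\<bar>w \<bullet> b\<bar> * norm (G' x b) \<le> norm w * \<bar>M b\<bar>"
        using M[OF x, of b] b by (intro mult_mono) (auto simp: Basis_le_norm)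
      then show "norm ((w \<bullet> b) *\<^sub>R G' x b) \<le> \<bar>M b\<bar> * norm w" by (simp add: mult.commute)
    qed
    also have "\<dots> = L * norm w" by (simp add: L_def sum_distrib_right)
    finally show "norm (G' x w) \<le> L * norm w" .
  qed
  then have "dist (G x) (G y) \<le> L * dist x y" if "x \<in> C" "y \<in> C" for x y
    using differentiable_bound[OF C(2) has_derivative_at_withinI[OF G], of L x y] that
    by (simp add: dist_norm)
  then show ?thesis using L by blast
qed

text \<open>Picard iteration: \<open>G\<close> composed with the projection onto the ball is globally Lipschitz and
  bounded, so the integral operator contracts the space of all bounded continuous curves.\<close>

lemma local_solution_lipschitz:
  fixes G :: "'a::euclidean_space \<Rightarrow> 'a"
  assumes r: "r > 0" and L: "L \<ge> 0"
    and lip: "\<And>x y. x \<in> cball x0 r \<Longrightarrow> y \<in> cball x0 r \<Longrightarrow> dist (G x) (G y) \<le> L * dist x y"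
  shows "\<exists>h>0. \<exists>x. x 0 = x0 \<and>
    (\<forall>t\<in>{-h<..<h}. x t \<in> cball x0 r \<and> (x has_vector_derivative G (x t)) (at t))"
proof -
  define P where "P = closest_point (cball x0 r)"
  have P: "P x \<in> cball x0 r" for x
    unfolding P_def using r by (intro closest_point_in_set) auto
  have PP: "P x = x" if "x \<in> cball x0 r" for x
    unfolding P_def by (rule closest_point_self[OF that])
  define g where "g x = G (P x)" for x
  have glip: "dist (g x) (g y) \<le> L * dist x y" for x y
  proof -
    have "dist (P x) (P y) \<le> dist x y" unfolding P_def using r by (intro closest_point_lipschitz) auto
    then have "L * dist (P x) (P y) \<le> L * dist x y" using L by (rule mult_left_mono)
    then show ?thesis using lip[OF P[of x] P[of y]] by (simp add: g_def)
  qed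
  have "continuous_on UNIV g"
    by (rule continuous_on_subset[OF lipschitz_on_continuous_on[of L]])
      (auto intro!: lipschitz_onI glip L)
  then have gc: "continuous_on X (\<lambda>t. g (x t))" if "continuous_on X x" for X :: "real set" and x
    by (rule continuous_on_compose2[OF _ that]) auto
  define M where "M = norm (G x0) + L * r"
  have M: "norm (g x) \<le> M" for x
  proof -
    have "dist (g x) (G x0) \<le> L * dist (P x) x0"
      unfolding g_def using r by (intro lip P) auto
    also have "\<dots> \<le> L * r" using P[of x] L by (intro mult_left_mono) (auto simp: dist_commute)
    finally show ?thesis using norm_triangle_sub[of "g x" "G x0"] by (simp add: M_def dist_norm)
  qed
  have M0: "M \<ge> 0" using L r by (simp add: M_def)
  \<comment> \<open>\<open>J\<close> is a difference of integrals over intervals of length at most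
    \<open>2 * h\<close> and \<open>h\<close>, hence the factor 3 below. The first bound makes the
    contraction constant 1/2, the second keeps the fixed point in the ball, where \<open>P\<close>
    is the identity.\<close>
  define h where "h = min (1 / (6 * (L + 1))) (r / (3 * (M + 1)))"
  have h: "h > 0" using L M0 r by (simp add: h_def)
  have hL: "3 * h * L \<le> 1/2"
  proof -
    have "3 * h * L \<le> 3 * (1 / (6 * (L + 1))) * L" using L by (intro mult_right_mono) (auto simp: h_def)
    also have "\<dots> \<le> 1/2" using L by (simp add: field_simps)
    finally show ?thesis .
  qed
  have hM: "3 * h * M \<le> r"
  proof -
    have "3 * h * M \<le> 3 * (r / (3 * (M + 1))) * M" using M0 by (intro mult_right_mono) (auto simp: h_def)
    also have "\<dots> \<le> r" using M0 r by (simp add: field_simps)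
    finally show ?thesis .
  qed
  \<comment> \<open>Clamping time to \<open>{-h..h}\<close> makes the integral curve bounded and
    defined on the whole line, as the type of bounded continuous functions demands.\<close>
  define cl where "cl t = max (-h) (min h t)" for t :: real
  have cl: "cl t \<in> {-h..h}" for t using h by (auto simp: cl_def)
  \<comment> \<open>The oriented integral from 0 to \<open>cl t\<close>. It is a difference because
    an integral over \<open>{0..cl t}\<close> would be 0 for negative \<open>t\<close>.\<close>
  define J where "J f t = integral {-h..cl t} f - integral {-h..0} f" for f :: "real \<Rightarrow> 'a" and t
  have Jbound: "norm (J f t) \<le> 3 * h * c"
    if f: "continuous_on {-h..h} f" and c: "\<And>s. norm (f s) \<le> c" for f c t
  proof -
    have "norm (integral {-h..cl t} f) \<le> c * (cl t - - h)"
      using cl[of t] c by (intro integral_bound continuous_on_subset[OF f]) auto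
    also have "\<dots> \<le> c * (2 * h)"
      using cl[of t] order_trans[OF norm_ge_zero c] by (intro mult_left_mono) auto
    finally have 1: "norm (integral {-h..cl t} f) \<le> c * (2 * h)" .
    have "norm (integral {-h..0} f) \<le> c * (0 - - h)"
      using h c by (intro integral_bound continuous_on_subset[OF f]) auto
    then show ?thesis using 1 norm_triangle_ineq4[of "integral {-h..cl t} f" "integral {-h..0} f"]
      unfolding J_def by (simp add: algebra_simps)
  qed
  have Jbc: "(\<lambda>t. x0 + J (\<lambda>s. g (x s)) t) \<in> bcontfun" if x: "continuous_on {-h..h} x" for x
  proof -
    have c: "continuous_on {-h..h} (\<lambda>s. g (x s))" by (rule gc[OF x])
    have "continuous_on {-h..h} (\<lambda>t. integral {-h..t} (\<lambda>s. g (x s)))"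
      by (intro indefinite_integral_continuous_1 integrable_continuous_real c)
    then have "continuous_on UNIV (\<lambda>t. integral {-h..cl t} (\<lambda>s. g (x s)))"
      by (rule continuous_on_compose2) (use cl in \<open>auto simp: cl_def intro!: continuous_intros\<close>)
    then have "continuous_on UNIV (\<lambda>t. x0 + J (\<lambda>s. g (x s)) t)"
      unfolding J_def by (intro continuous_intros)
    moreover have "bounded (range (\<lambda>t. x0 + J (\<lambda>s. g (x s)) t))"
    proof (rule boundedI)
      fix y assume "y \<in> range (\<lambda>t. x0 + J (\<lambda>s. g (x s)) t)"
      then obtain t where "y = x0 + J (\<lambda>s. g (x s)) t" by auto
      then show "norm y \<le> norm x0 + 3 * h * M"
        using norm_triangle_ineq[of x0] Jbound[OF c M, of t] by (metis add_left_mono order_trans)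
    qed
    ultimately show ?thesis by (simp add: bcontfun_def)
  qed
  define \<Phi> where "\<Phi> x = Bcontfun (\<lambda>t. x0 + J (\<lambda>s. g (apply_bcontfun x s)) t)" for x :: "real \<Rightarrow>\<^sub>C 'a"
  have \<Phi>: "apply_bcontfun (\<Phi> x) t = x0 + J (\<lambda>s. g (apply_bcontfun x s)) t" for x t
    unfolding \<Phi>_def by (subst Bcontfun_inverse) (auto intro: Jbc)
  have "dist (\<Phi> x) (\<Phi> y) \<le> (1/2) * dist x y" for x y
  proof (rule dist_bound)
    fix t
    have cx: "continuous_on X (\<lambda>s. g (apply_bcontfun x s))" "continuous_on X (\<lambda>s. g (apply_bcontfun y s))" for X
      by (intro gc; simp)+
    have "J (\<lambda>s. g (apply_bcontfun x s)) t - J (\<lambda>s. g (apply_bcontfun y s)) t =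
       J (\<lambda>s. g (apply_bcontfun x s) - g (apply_bcontfun y s)) t"
      unfolding J_def by (simp add: Henstock_Kurzweil_Integration.integral_diff integrable_continuous_real cx)
    moreover have "norm (J (\<lambda>s. g (apply_bcontfun x s) - g (apply_bcontfun y s)) t) \<le> 3 * h * (L * dist x y)"
    proof (rule Jbound)
      show "norm (g (apply_bcontfun x s) - g (apply_bcontfun y s)) \<le> L * dist x y" for s
        using order_trans[OF glip[of "apply_bcontfun x s" "apply_bcontfun y s"]
            mult_left_mono[OF dist_bounded[of x s y] L]] by (simp add: dist_norm)
    qed (intro continuous_intros cx)
    moreover have "3 * h * (L * dist x y) \<le> 1/2 * dist x y"
      using mult_right_mono[OF hL, of "dist x y"] by (simp add: mult.assoc)
    ultimately show "dist (apply_bcontfun (\<Phi> x) t) (apply_bcontfun (\<Phi> y) t) \<le> 1/2 * dist x y"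
      by (simp add: \<Phi> dist_norm)
  qed
  then obtain x where x: "\<Phi> x = x"
    using banach_fix_type[of "1/2" \<Phi>] by auto
  let ?x = "apply_bcontfun x"
  have xJ: "?x t = x0 + J (\<lambda>s. g (?x s)) t" for t using \<Phi>[of x t] x by simp
  have cx: "continuous_on X (\<lambda>s. g (?x s))" for X by (intro gc) simp
  have in_ball: "?x t \<in> cball x0 r" for t
  proof -
    have "norm (J (\<lambda>s. g (?x s)) t) \<le> r"
      using Jbound[OF cx M] hM by (rule order_trans)
    then show ?thesis by (subst xJ) (simp add: dist_norm)
  qed
  have "(?x has_vector_derivative G (?x t)) (at t)" if t: "t \<in> {-h<..<h}" for t
  proof -
    have "((\<lambda>u. integral {-h..u} (\<lambda>s. g (?x s))) has_vector_derivative g (?x t)) (at t within {-h..h})"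
      by (rule integral_has_vector_derivative[OF cx]) (use t in auto)
    from has_vector_derivative_add[OF has_vector_derivative_const
        has_vector_derivative_diff[OF this has_vector_derivative_const]]
    have "((\<lambda>u. x0 + (integral {-h..u} (\<lambda>s. g (?x s)) - integral {-h..0} (\<lambda>s. g (?x s))))
      has_vector_derivative g (?x t)) (at t within {-h..h})"
      by simp
    moreover have "at t within {-h..h} = at t" using t by (intro at_within_Icc_at) auto
    ultimately have deriv: "((\<lambda>u. x0 + (integral {-h..u} (\<lambda>s. g (?x s)) - integral {-h..0} (\<lambda>s. g (?x s))))
      has_vector_derivative g (?x t)) (at t)"
      by (simp only:)
    have eq: "x0 + (integral {-h..u} (\<lambda>s. g (?x s)) - integral {-h..0} (\<lambda>s. g (?x s))) = ?x u"
      if "u \<in> {-h<..<h}" for u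
    proof -
      have "cl u = u" using that by (simp add: cl_def)
      show ?thesis using xJ[of u, symmetric] unfolding J_def \<open>cl u = u\<close> .
    qed
    have "(?x has_vector_derivative g (?x t)) (at t)"
      by (rule has_vector_derivative_transform_within_open[OF deriv open_greaterThanLessThan t eq])
    then show ?thesis by (simp add: g_def PP[OF in_ball])
  qed
  moreover have "?x 0 = x0" using h by (subst xJ) (simp add: J_def cl_def)
  ultimately show ?thesis using h in_ball by blast
qed

lemma local_solution_C1:
  fixes G :: "'a::euclidean_space \<Rightarrow> 'a"
  assumes S: "open S" "x0 \<in> S"
    and G: "\<And>x. x \<in> S \<Longrightarrow> (G has_derivative G' x) (at x)"
    and G': "\<And>w. continuous_on S (\<lambda>x. G' x w)"
  shows "\<exists>h>0. \<exists>x. x 0 = x0 \<and>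
    (\<forall>t\<in>{-h<..<h}. x t \<in> S \<and> (x has_vector_derivative G (x t)) (at t))"
proof -
  obtain r where r: "r > 0" "cball x0 r \<subseteq> S" using S open_contains_cball by blast
  obtain L where "L \<ge> 0" "\<forall>x\<in>cball x0 r. \<forall>y\<in>cball x0 r. dist (G x) (G y) \<le> L * dist x y"
    using lipschitz_on_compact_convex[OF compact_cball convex_cball, of x0 r G G'] G r(2)
      continuous_on_subset[OF G' r(2)] by blast
  then show ?thesis using local_solution_lipschitz[of r L x0 G] r by blast
qed

section \<open>The invariance equation\<close>

text \<open>The sum of \<open>z *s a\<close> and its conjugate, read as a real vector: the shape in
  which conjugate pairs of terms occur in the parametrization. It is real-bilinear and commutes with
  real matrices.\<close>

definition rpair :: "complex \<Rightarrow> complex^'n \<Rightarrow> real^'n" where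
  "rpair z a = (\<chi> i. 2 * Re (z * a $ i))"

lemma vRe_add_vcnj: "vRe (z *s a + cnj z *s vcnj a) = rpair z a"
  by (simp add: vec_eq_iff vRe_def vcnj_def rpair_def)

lemma bounded_bilinear_rpair: "bounded_bilinear (rpair :: complex \<Rightarrow> complex^'n \<Rightarrow> real^'n)"
  unfolding bilinear_conv_bounded_bilinear[symmetric] bilinear_def
  by (intro conjI allI linearI) (simp_all add: vec_eq_iff rpair_def algebra_simps)

lemma matrix_mult_rpair: "M *v rpair z a = rpair z (cmat M *v a)"
  by (simp add: vec_eq_iff matrix_vector_mult_def rpair_def sum_distrib_left map_matrix_def algebra_simps)

lemma Ck_on_1D:
  assumes "Ck_on 1 f S"
  shows "x \<in> S \<Longrightarrow> f differentiable (at x)" and "continuous_on S (dir_deriv w f)"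
  using assms by auto

text \<open>This and \<open>higher_order_bounds\<close> copy conjuncts of
  \<open>R4_normal_form\<close> verbatim, so that \<open>R4_normal_form_iff\<close> holds by
  reflexivity and the long conditions can stay folded.\<close>

definition invariant_for_reduced_system ::
  "(real^'n \<Rightarrow> real^'n) \<Rightarrow> (real \<Rightarrow> real^'n) \<Rightarrow> (real \<Rightarrow> complex^'n) \<Rightarrow> (real \<Rightarrow> complex \<Rightarrow> real^'n) \<Rightarrow> real
    \<Rightarrow> (real \<Rightarrow> complex \<Rightarrow> real) \<Rightarrow> (real \<Rightarrow> complex \<Rightarrow> complex)
    \<Rightarrow> real \<Rightarrow> complex \<Rightarrow> complex \<Rightarrow> complex \<Rightarrow> complex \<Rightarrow> bool" where
  "invariant_for_reduced_system F u0 v H \<delta> R1 R2 \<alpha>1 \<alpha>2 \<alpha>3 c d \<longleftrightarrow>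
    (\<forall>a b. \<forall>\<theta> :: real \<Rightarrow> real. \<forall>z :: real \<Rightarrow> complex.
      (\<forall>t\<in>{a<..<b}.
        z t \<in> ball 0 \<delta> \<and>
        ((\<lambda>s. complex_of_real (\<theta> s)) has_vector_derivative
          1 + of_real \<alpha>1 * of_real (cmod (z t) ^ 2) + \<alpha>2 * z t ^ 4 + \<alpha>3 * cnj (z t) ^ 4
            + of_real (R1 (\<theta> t) (z t))) (at t) \<and>
        (z has_vector_derivative
          c * z t * of_real (cmod (z t) ^ 2) + d * cnj (z t) ^ 3 + R2 (\<theta> t) (z t)) (at t))
      \<longrightarrow>
      (\<forall>t\<in>{a<..<b}. ((\<lambda>s. cm_param u0 v H (\<theta> s) (z s)) has_vector_derivative
          F (cm_param u0 v H (\<theta> t) (z t))) (at t)))"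

definition higher_order_bounds ::
  "real \<Rightarrow> (real \<Rightarrow> complex \<Rightarrow> real^'n) \<Rightarrow> (nat \<Rightarrow> nat \<Rightarrow> real \<Rightarrow> complex^'n) \<Rightarrow> real \<Rightarrow> real
    \<Rightarrow> (real \<Rightarrow> complex \<Rightarrow> real) \<Rightarrow> (real \<Rightarrow> complex \<Rightarrow> complex) \<Rightarrow> bool" where
  "higher_order_bounds T H h \<delta> K R1 R2 \<longleftrightarrow>
    (\<forall>\<tau>. \<forall>\<xi>\<in>ball 0 \<delta>.
      H (\<tau> + 4 * T) \<xi> = H \<tau> \<xi> \<and> R1 (\<tau> + 4 * T) \<xi> = R1 \<tau> \<xi> \<and> R2 (\<tau> + 4 * T) \<xi> = R2 \<tau> \<xi> \<and>
      norm (cvec (H \<tau> \<xi>)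
        - (\<Sum>k\<le>3. \<Sum>l | 2 \<le> k + l \<and> k + l \<le> 3.
            (1 / (fact k * fact l) * \<xi> ^ k * cnj \<xi> ^ l) *s h k l \<tau>)) \<le> K * cmod \<xi> ^ 4 \<and>
      \<bar>R1 \<tau> \<xi>\<bar> \<le> K * cmod \<xi> ^ 5 \<and> cmod (R2 \<tau> \<xi>) \<le> K * cmod \<xi> ^ 5)"

lemma R4_normal_form_iff:
  "R4_normal_form F u0 T v \<phi> H h \<alpha>1 \<alpha>2 \<alpha>3 c d \<longleftrightarrow>
    (\<forall>k l. 2 \<le> k + l \<and> k + l \<le> 3 \<longrightarrow>
      (\<forall>\<tau>. h k l \<tau> = vcnj (h l k \<tau>)) \<and>
      (\<forall>\<tau>. h k l \<tau> = (exp (- (\<i> * of_real (pi/2))) ^ k * exp (\<i> * of_real (pi/2)) ^ l) *s h k l (\<tau> + T))) \<and>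
    integral {0..T} (\<lambda>\<tau>. hinner (cvec (\<phi> \<tau>)) (h 1 1 \<tau>)) = 0 \<and>
    \<alpha>3 = cnj \<alpha>2 \<and>
    (\<exists>\<delta>>0. \<exists>K R1 R2.
      Ck_on 4 (\<lambda>(\<tau>, \<xi>). H \<tau> \<xi>) (UNIV \<times> ball 0 \<delta>) \<and>
      Ck_on 1 (\<lambda>(\<tau>, \<xi>). R1 \<tau> \<xi>) (UNIV \<times> ball 0 \<delta>) \<and>
      Ck_on 1 (\<lambda>(\<tau>, \<xi>). R2 \<tau> \<xi>) (UNIV \<times> ball 0 \<delta>) \<and>
      higher_order_bounds T H h \<delta> K R1 R2 \<and>
      invariant_for_reduced_system F u0 v H \<delta> R1 R2 \<alpha>1 \<alpha>2 \<alpha>3 c d)"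
  unfolding R4_normal_form_def higher_order_bounds_def invariant_for_reduced_system_def by (rule refl)

text \<open>Both sides are the derivative at time 0 of one curve on the manifold: the chain rule
  gives the left-hand side, \<open>inv\<close> the right-hand side.\<close>

lemma invariance_equation:
  fixes F :: "real^'n \<Rightarrow> real^'n" and H :: "real \<Rightarrow> complex \<Rightarrow> real^'n"
    and R1 :: "real \<Rightarrow> complex \<Rightarrow> real" and R2 :: "real \<Rightarrow> complex \<Rightarrow> complex"
  assumes H: "Ck_on 1 (\<lambda>(\<tau>, \<xi>). H \<tau> \<xi>) (UNIV \<times> ball 0 \<delta>)"
    and R1: "Ck_on 1 (\<lambda>(\<tau>, \<xi>). R1 \<tau> \<xi>) (UNIV \<times> ball 0 \<delta>)"
    and R2: "Ck_on 1 (\<lambda>(\<tau>, \<xi>). R2 \<tau> \<xi>) (UNIV \<times> ball 0 \<delta>)"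
    and \<alpha>3: "\<alpha>3 = cnj \<alpha>2"
    and inv: "invariant_for_reduced_system F u0 v H \<delta> R1 R2 \<alpha>1 \<alpha>2 \<alpha>3 c d"
    and u0: "(u0 has_vector_derivative F (u0 \<tau>)) (at \<tau>)"
    and v: "(v has_vector_derivative v') (at \<tau>)"
    and \<xi>: "\<xi> \<in> ball 0 \<delta>"
  shows "(1 + \<alpha>1 * (cmod \<xi>)\<^sup>2 + 2 * Re (\<alpha>2 * \<xi> ^ 4) + R1 \<tau> \<xi>) *\<^sub>R
      (F (u0 \<tau>) + rpair \<xi> v' + dir_deriv (1, 0) (\<lambda>(\<tau>, \<xi>). H \<tau> \<xi>) (\<tau>, \<xi>))
    + rpair (c * \<xi> * of_real ((cmod \<xi>)\<^sup>2) + d * cnj \<xi> ^ 3 + R2 \<tau> \<xi>) (v \<tau>)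
    + dir_deriv (0, c * \<xi> * of_real ((cmod \<xi>)\<^sup>2) + d * cnj \<xi> ^ 3 + R2 \<tau> \<xi>) (\<lambda>(\<tau>, \<xi>). H \<tau> \<xi>) (\<tau>, \<xi>)
    = F (u0 \<tau> + rpair \<xi> (v \<tau>) + H \<tau> \<xi>)"
proof -
  let ?S = "(UNIV :: real set) \<times> ball (0::complex) \<delta>"
  define m where "m \<tau> \<xi> = 1 + \<alpha>1 * (cmod \<xi>)\<^sup>2 + 2 * Re (\<alpha>2 * \<xi> ^ 4) + R1 \<tau> \<xi>" for \<tau> \<xi>
  define Z where "Z \<tau> \<xi> = c * \<xi> * of_real ((cmod \<xi>)\<^sup>2) + d * cnj \<xi> ^ 3 + R2 \<tau> \<xi>" for \<tau> \<xi>
  define G where "G p = (m (fst p) (snd p), Z (fst p) (snd p))" for p :: "real \<times> complex"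
  define G' where "G' p w =
     (\<alpha>1 * (2 * Re (snd p) * Re (snd w) + 2 * Im (snd p) * Im (snd w)) + 2 * Re (\<alpha>2 * (4 * snd p ^ 3 * snd w))
        + dir_deriv w (\<lambda>(\<tau>, \<xi>). R1 \<tau> \<xi>) p,
      c * (snd w * (snd p * cnj (snd p)) + snd p * (snd w * cnj (snd p) + snd p * cnj (snd w)))
        + d * (3 * cnj (snd p) ^ 2 * cnj (snd w)) + dir_deriv w (\<lambda>(\<tau>, \<xi>). R2 \<tau> \<xi>) p)"
    for p w :: "real \<times> complex"
  have dR1: "((\<lambda>p. R1 (fst p) (snd p)) has_derivative (\<lambda>w. dir_deriv w (\<lambda>(\<tau>, \<xi>). R1 \<tau> \<xi>) p)) (at p)"
    and dR2: "((\<lambda>p. R2 (fst p) (snd p)) has_derivative (\<lambda>w. dir_deriv w (\<lambda>(\<tau>, \<xi>). R2 \<tau> \<xi>) p)) (at p)"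
    and dH: "((\<lambda>(\<tau>, \<xi>). H \<tau> \<xi>) has_derivative (\<lambda>w. dir_deriv w (\<lambda>(\<tau>, \<xi>). H \<tau> \<xi>) p)) (at p)"
    if "p \<in> ?S" for p
    using has_derivative_dir_deriv[OF Ck_on_1D(1)[OF R1 that]] has_derivative_dir_deriv[OF Ck_on_1D(1)[OF R2 that]]
      has_derivative_dir_deriv[OF Ck_on_1D(1)[OF H that]] by (simp_all only: case_prod_unfold)
  have dG: "(G has_derivative G' p) (at p)" if p: "p \<in> ?S" for p
  proof -
    \<comment> \<open>\<open>cmod\<close> is not differentiable at 0. Its square is written with
      real and imaginary parts here and as \<open>\<xi> * cnj \<xi>\<close> in the second component,
      so that both become polynomial.\<close>
    have "((\<lambda>p. 1 + \<alpha>1 * ((Re (snd p))\<^sup>2 + (Im (snd p))\<^sup>2) + 2 * Re (\<alpha>2 * snd p ^ 4) + R1 (fst p) (snd p))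
      has_derivative (\<lambda>w. \<alpha>1 * (2 * Re (snd p) * Re (snd w) + 2 * Im (snd p) * Im (snd w)) + 2 * Re (\<alpha>2 * (4 * snd p ^ 3 * snd w))
        + dir_deriv w (\<lambda>(\<tau>, \<xi>). R1 \<tau> \<xi>) p)) (at p)"
      by (auto intro!: derivative_eq_intros dR1[OF p] simp: fun_eq_iff algebra_simps)
    moreover have "((\<lambda>p. c * (snd p * (snd p * cnj (snd p))) + d * cnj (snd p) ^ 3 + R2 (fst p) (snd p))
      has_derivative (\<lambda>w. c * (snd w * (snd p * cnj (snd p)) + snd p * (snd w * cnj (snd p) + snd p * cnj (snd w)))
        + d * (3 * cnj (snd p) ^ 2 * cnj (snd w)) + dir_deriv w (\<lambda>(\<tau>, \<xi>). R2 \<tau> \<xi>) p)) (at p)"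
      by (auto intro!: derivative_eq_intros dR2[OF p] simp: fun_eq_iff algebra_simps)
    moreover have "G = (\<lambda>p. (1 + \<alpha>1 * ((Re (snd p))\<^sup>2 + (Im (snd p))\<^sup>2) + 2 * Re (\<alpha>2 * snd p ^ 4) + R1 (fst p) (snd p),
       c * (snd p * (snd p * cnj (snd p))) + d * cnj (snd p) ^ 3 + R2 (fst p) (snd p)))"
      by (simp add: fun_eq_iff G_def m_def Z_def cmod_power2 complex_norm_square[symmetric] mult.assoc
          flip: of_real_add of_real_power)
    ultimately show ?thesis unfolding G'_def by (simp only: has_derivative_Pair)
  qed
  have cR: "continuous_on ?S (dir_deriv w (\<lambda>(\<tau>, \<xi>). R1 \<tau> \<xi>))" "continuous_on ?S (dir_deriv w (\<lambda>(\<tau>, \<xi>). R2 \<tau> \<xi>))" for w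
    by (rule Ck_on_1D(2)[OF R1], rule Ck_on_1D(2)[OF R2])
  have cG: "continuous_on ?S (\<lambda>p. G' p w)" for w
    unfolding G'_def by (intro continuous_intros cR)
  have oS: "open ?S" by (intro open_Times) auto
  obtain h X where h: "h > 0" and X0: "X 0 = (\<tau>, \<xi>)"
    and X: "\<And>t. t \<in> {-h<..<h} \<Longrightarrow> X t \<in> ?S \<and> (X has_vector_derivative G (X t)) (at t)"
    using local_solution_C1[OF oS _ dG cG, of "(\<tau>, \<xi>)"] \<xi> by auto
  define \<theta> where "\<theta> t = fst (X t)" for t
  define z where "z t = snd (X t)" for t
  have d\<theta>: "(\<theta> has_vector_derivative m (\<theta> t) (z t)) (at t)" if "t \<in> {-h<..<h}" for t
    using bounded_linear.has_vector_derivative[OF bounded_linear_fst conjunct2[OF X[OF that]]]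
    by (simp add: G_def \<theta>_def[abs_def] z_def[abs_def])
  have dz: "(z has_vector_derivative Z (\<theta> t) (z t)) (at t)" if "t \<in> {-h<..<h}" for t
    using bounded_linear.has_vector_derivative[OF bounded_linear_snd conjunct2[OF X[OF that]]]
    by (simp add: G_def \<theta>_def[abs_def] z_def[abs_def])
  have "((\<lambda>s. cm_param u0 v H (\<theta> s) (z s)) has_vector_derivative F (cm_param u0 v H (\<theta> 0) (z 0))) (at 0)"
  proof (rule inv[unfolded invariant_for_reduced_system_def, rule_format, of "-h" h])
    show "0 \<in> {-h<..<h}" using h by simp
    fix t assume t: "t \<in> {-h<..<h}"
    show "z t \<in> ball 0 \<delta> \<and>
              ((\<lambda>s. complex_of_real (\<theta> s)) has_vector_derivative
                 1 + of_real \<alpha>1 * of_real (cmod (z t) ^ 2) + \<alpha>2 * z t ^ 4 + \<alpha>3 * cnj (z t) ^ 4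
                   + of_real (R1 (\<theta> t) (z t))) (at t) \<and>
              (z has_vector_derivative
                 c * z t * of_real (cmod (z t) ^ 2) + d * cnj (z t) ^ 3 + R2 (\<theta> t) (z t)) (at t)"
    proof (intro conjI)
      show "z t \<in> ball 0 \<delta>" using X[OF t] by (auto simp: z_def)
      \<comment> \<open>The reduced equation for \<tau> is stated in the complex numbers;
        \<open>\<alpha>3 = cnj \<alpha>2\<close> is what makes its right-hand side real and equal to
        \<open>m\<close>.\<close>
      have "complex_of_real (2 * Re (\<alpha>2 * z t ^ 4)) = \<alpha>2 * z t ^ 4 + \<alpha>3 * cnj (z t) ^ 4"
        using complex_add_cnj[of "\<alpha>2 * z t ^ 4"] by (simp add: \<alpha>3)
      then have "complex_of_real (m (\<theta> t) (z t)) = 1 + of_real \<alpha>1 * of_real (cmod (z t) ^ 2) + \<alpha>2 * z t ^ 4 + \<alpha>3 * cnj (z t) ^ 4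
                   + of_real (R1 (\<theta> t) (z t))"
        unfolding m_def of_real_add by simp
      with has_vector_derivative_of_real[where 'a=complex, OF d\<theta>[OF t, folded has_real_derivative_iff_has_vector_derivative]]
      show "((\<lambda>s. complex_of_real (\<theta> s)) has_vector_derivative
                 1 + of_real \<alpha>1 * of_real (cmod (z t) ^ 2) + \<alpha>2 * z t ^ 4 + \<alpha>3 * cnj (z t) ^ 4
                   + of_real (R1 (\<theta> t) (z t))) (at t)" by simp
    qed (use dz[OF t] in \<open>simp add: Z_def\<close>)
  qed
  moreover have "((\<lambda>s. cm_param u0 v H (\<theta> s) (z s)) has_vector_derivative
      (m \<tau> \<xi> *\<^sub>R F (u0 \<tau>) + (rpair \<xi> (m \<tau> \<xi> *\<^sub>R v') + rpair (Z \<tau> \<xi>) (v \<tau>))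
       + dir_deriv (m \<tau> \<xi>, Z \<tau> \<xi>) (\<lambda>(\<tau>, \<xi>). H \<tau> \<xi>) (\<tau>, \<xi>))) (at 0)"
  proof -
    have 0: "\<theta> 0 = \<tau>" "z 0 = \<xi>" by (simp_all add: \<theta>_def z_def X0)
    have d0: "(\<theta> has_vector_derivative m \<tau> \<xi>) (at 0)" "(z has_vector_derivative Z \<tau> \<xi>) (at 0)"
      "(X has_vector_derivative (m \<tau> \<xi>, Z \<tau> \<xi>)) (at 0)"
      using d\<theta>[of 0] dz[of 0] X[of 0] h by (simp_all add: 0 X0 G_def)
    have 1: "((\<lambda>s. u0 (\<theta> s)) has_vector_derivative m \<tau> \<xi> *\<^sub>R F (u0 \<tau>)) (at 0)"
      using vector_diff_chain_at[OF d0(1), of u0] u0 by (simp add: 0 o_def)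
    have 2: "((\<lambda>s. v (\<theta> s)) has_vector_derivative m \<tau> \<xi> *\<^sub>R v') (at 0)"
      using vector_diff_chain_at[OF d0(1), of v] v by (simp add: 0 o_def)
    have 3: "((\<lambda>s. H (\<theta> s) (z s)) has_vector_derivative
        dir_deriv (m \<tau> \<xi>, Z \<tau> \<xi>) (\<lambda>(\<tau>, \<xi>). H \<tau> \<xi>) (\<tau>, \<xi>)) (at 0)"
      using vector_derivative_diff_chain_within[OF d0(3) has_derivative_at_withinI[OF dH]] \<xi>
      by (simp add: X0 o_def case_prod_unfold \<theta>_def[abs_def] z_def[abs_def])
    show ?thesis unfolding cm_param_def vRe_add_vcnj
      using has_vector_derivative_add[OF has_vector_derivative_add[OF 1
        bounded_bilinear.has_vector_derivative[OF bounded_bilinear_rpair d0(2) 2]] 3] by (simp add: 0)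
  qed
  ultimately have "F (cm_param u0 v H (\<theta> 0) (z 0)) =
     m \<tau> \<xi> *\<^sub>R F (u0 \<tau>) + (rpair \<xi> (m \<tau> \<xi> *\<^sub>R v') + rpair (Z \<tau> \<xi>) (v \<tau>))
       + dir_deriv (m \<tau> \<xi>, Z \<tau> \<xi>) (\<lambda>(\<tau>, \<xi>). H \<tau> \<xi>) (\<tau>, \<xi>)"
    by (rule vector_derivative_unique_at)
  moreover have "dir_deriv (m \<tau> \<xi>, Z \<tau> \<xi>) (\<lambda>(\<tau>, \<xi>). H \<tau> \<xi>) (\<tau>, \<xi>) =
     m \<tau> \<xi> *\<^sub>R dir_deriv (1, 0) (\<lambda>(\<tau>, \<xi>). H \<tau> \<xi>) (\<tau>, \<xi>) + dir_deriv (0, Z \<tau> \<xi>) (\<lambda>(\<tau>, \<xi>). H \<tau> \<xi>) (\<tau>, \<xi>)"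
  proof -
    interpret L: bounded_linear "\<lambda>w. dir_deriv w (\<lambda>(\<tau>, \<xi>). H \<tau> \<xi>) (\<tau>, \<xi>)"
      using dH[of "(\<tau>, \<xi>)"] \<xi> by (auto intro: has_derivative_bounded_linear)
    have "(m \<tau> \<xi>, Z \<tau> \<xi>) = m \<tau> \<xi> *\<^sub>R (1, 0) + (0, Z \<tau> \<xi>)" by simp
    then show ?thesis by (simp only: L.add L.scaleR)
  qed
  ultimately show ?thesis
    unfolding m_def[symmetric] Z_def[symmetric]
    by (simp add: cm_param_def vRe_add_vcnj \<theta>_def z_def X0 scaleR_add_right
        bounded_bilinear.scaleR_right[OF bounded_bilinear_rpair])
qed

section \<open>Homogeneous parts of the center manifold\<close>

lemma B2_add_left: "B2 F p (x + y) z = B2 F p x z + B2 F p y z"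
  and B2_add_right: "B2 F p z (x + y) = B2 F p z x + B2 F p z y"
  and B2_scaleR_left: "B2 F p (r *\<^sub>R x) z = r *\<^sub>R B2 F p x z"
  and B2_scaleR_right: "B2 F p z (r *\<^sub>R x) = r *\<^sub>R B2 F p z x"
  by (simp_all add: B2_def algebra_simps sum.distrib scaleR_sum_right)

lemma C3_add: "C3 F p (x + y) z t = C3 F p x z t + C3 F p y z t"
  "C3 F p z (x + y) t = C3 F p z x t + C3 F p z y t"
  "C3 F p z t (x + y) = C3 F p z t x + C3 F p z t y"
  and C3_scaleR: "C3 F p (r *\<^sub>R x) z t = r *\<^sub>R C3 F p x z t"
  "C3 F p z (r *\<^sub>R x) t = r *\<^sub>R C3 F p z x t"
  "C3 F p z t (r *\<^sub>R x) = r *\<^sub>R C3 F p z t x"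
  by (simp_all add: C3_def algebra_simps sum.distrib scaleR_sum_right)

lemma B2_commute:
  assumes "Ck_on 2 F UNIV"
  shows "B2 F p x y = B2 F p y x"
  by (simp add: B2_eq_dir_deriv[OF assms] dir_deriv_commute[OF assms])

lemma continuous_on_compact_norm_bound:
  fixes f :: "'a::metric_space \<Rightarrow> 'b::real_normed_vector"
  assumes "compact X" "continuous_on X f"
  shows "\<exists>M\<ge>0. \<forall>x\<in>X. norm (f x) \<le> M"
proof -
  from compact_imp_bounded[OF compact_continuous_image[OF assms(2,1)]]
  obtain M where "\<forall>x\<in>X. norm (f x) \<le> M" by (auto simp: bounded_iff)
  then show ?thesis by (intro exI[of _ "max 0 M"]) force
qed

lemma norm_B2_le:
  assumes F: "Ck_on 2 F UNIV" and X: "compact X"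
  shows "\<exists>M\<ge>0. \<forall>p\<in>X. \<forall>x y. norm (B2 F p x y) \<le> M * norm x * norm y"
proof -
  have "continuous_on X (dir_deriv (axis i 1) (dir_deriv (axis j 1) F))" for i j
    by (rule continuous_on_subset[of UNIV]) (use F in \<open>auto simp: numeral_2_eq_2\<close>)
  from continuous_on_compact_norm_bound[OF X this]
  obtain M where M: "\<And>i j p. M i j \<ge> 0" "\<And>i j p. p \<in> X \<Longrightarrow> norm (dir_deriv (axis i 1) (dir_deriv (axis j 1) F) p) \<le> M i j"
    by metis
  have "norm (B2 F p x y) \<le> (\<Sum>i\<in>UNIV. \<Sum>j\<in>UNIV. M i j) * norm x * norm y" if p: "p \<in> X" for p x y
  proof -
    have "norm (B2 F p x y) \<le> (\<Sum>i\<in>UNIV. \<Sum>j\<in>UNIV. norm x * norm y * M i j)"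
      unfolding B2_def
    proof (intro order_trans[OF norm_sum] sum_mono)
      fix i j
      show "norm ((x $ i * y $ j) *\<^sub>R dir_deriv (axis i 1) (dir_deriv (axis j 1) F) p) \<le> norm x * norm y * M i j"
        unfolding norm_scaleR abs_mult
        using M(2)[OF p] Finite_Cartesian_Product.norm_nth_le[of x] Finite_Cartesian_Product.norm_nth_le[of y]
        by (intro mult_mono) auto
    qed
    then show ?thesis by (simp add: sum_distrib_left[symmetric] mult_ac)
  qed
  then show ?thesis using M(1) by (intro exI[of _ "\<Sum>i\<in>UNIV. \<Sum>j\<in>UNIV. M i j"]) (auto intro!: sum_nonneg)
qed

lemma norm_C3_le:
  assumes F: "Ck_on 3 F UNIV" and X: "compact X"
  shows "\<exists>M\<ge>0. \<forall>p\<in>X. \<forall>x y z. norm (C3 F p x y z) \<le> M * norm x * norm y * norm z"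
proof -
  have "continuous_on X (dir_deriv (axis i 1) (dir_deriv (axis j 1) (dir_deriv (axis k 1) F)))" for i j k
    by (rule continuous_on_subset[of UNIV]) (use F in \<open>auto simp: numeral_3_eq_3\<close>)
  from continuous_on_compact_norm_bound[OF X this]
  obtain M where M: "\<And>i j k. M i j k \<ge> 0"
    "\<And>i j k p. p \<in> X \<Longrightarrow> norm (dir_deriv (axis i 1) (dir_deriv (axis j 1) (dir_deriv (axis k 1) F)) p) \<le> M i j k"
    by metis
  have "norm (C3 F p x y z) \<le> (\<Sum>i\<in>UNIV. \<Sum>j\<in>UNIV. \<Sum>k\<in>UNIV. M i j k) * norm x * norm y * norm z"
    if p: "p \<in> X" for p x y z
  proof -
    have "norm (C3 F p x y z) \<le> (\<Sum>i\<in>UNIV. \<Sum>j\<in>UNIV. \<Sum>k\<in>UNIV. norm x * norm y * norm z * M i j k)"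
      unfolding C3_def
    proof (intro order_trans[OF norm_sum] sum_mono)
      fix i j k
      show "norm ((x $ i * y $ j * z $ k) *\<^sub>R dir_deriv (axis i 1) (dir_deriv (axis j 1) (dir_deriv (axis k 1) F)) p)
          \<le> norm x * norm y * norm z * M i j k"
        unfolding norm_scaleR abs_mult
        using M(2)[OF p] Finite_Cartesian_Product.norm_nth_le[of x] Finite_Cartesian_Product.norm_nth_le[of y]
          Finite_Cartesian_Product.norm_nth_le[of z]
        by (intro mult_mono) auto
    qed
    then show ?thesis by (simp add: sum_distrib_left[symmetric] mult_ac)
  qed
  then show ?thesis using M(1)
    by (intro exI[of _ "\<Sum>i\<in>UNIV. \<Sum>j\<in>UNIV. \<Sum>k\<in>UNIV. M i j k"]) (auto intro!: sum_nonneg)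
qed

lemma Amat_mult_vec:
  assumes "F differentiable (at (u0 \<tau>))"
  shows "Amat F u0 \<tau> *v x = dir_deriv x F (u0 \<tau>)"
proof -
  have "linear (frechet_derivative F (at (u0 \<tau>)))"
    using assms by (simp add: linear_frechet_derivative)
  then show ?thesis by (simp add: Amat_def jacobian_def dir_deriv_def matrix_works)
qed

text \<open>The form in which most remainder terms are disposed of. The threshold uses
  \<open>\<bar>C\<bar> + 1\<close>, so that no sign of \<open>C\<close> has to be known.\<close>

lemma uniform_limit_0_linear_bound:
  fixes f :: "real \<Rightarrow> 'a \<Rightarrow> 'b::real_normed_vector"
  assumes "s0 > 0" "\<And>s \<tau>. 0 < s \<Longrightarrow> s < s0 \<Longrightarrow> \<tau> \<in> I \<Longrightarrow> norm (f s \<tau>) \<le> C * s"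
  shows "uniform_limit I f (\<lambda>_. 0) (at_right 0)"
proof (rule uniform_limitI)
  fix e :: real assume e: "e > 0"
  show "\<forall>\<^sub>F s in at_right 0. \<forall>\<tau>\<in>I. dist (f s \<tau>) 0 < e"
    unfolding eventually_at_right_field
  proof (intro exI[of _ "min s0 (e / (\<bar>C\<bar> + 1))"] conjI allI impI ballI)
    show "0 < min s0 (e / (\<bar>C\<bar> + 1))" using e assms(1) by simp
    fix s \<tau> assume s: "0 < s" "s < min s0 (e / (\<bar>C\<bar> + 1))" and \<tau>: "\<tau> \<in> I"
    have "norm (f s \<tau>) \<le> C * s" using assms(2) s \<tau> by simp
    also have "\<dots> \<le> \<bar>C\<bar> * s" using s by (intro mult_right_mono) auto
    also have "\<dots> < (\<bar>C\<bar> + 1) * s" using s by simp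
    also have "\<dots> < e" using s by (simp add: field_simps)
    finally show "dist (f s \<tau>) 0 < e" by simp
  qed
qed

text \<open>The data needed for the expansion. Four coefficient functions suffice, the others being
  their conjugates, and they come without any regularity in \<tau>. As \<open>v\<close> is
  differentiable only within \<open>{0..T}\<close>, \<open>invariance\<close> is restricted to
  interior times, where that derivative is two-sided.\<close>

locale center_manifold =
  fixes F :: "real^'n \<Rightarrow> real^'n" and u0 :: "real \<Rightarrow> real^'n" and T :: real
    and v :: "real \<Rightarrow> complex^'n" and H :: "real \<Rightarrow> complex \<Rightarrow> real^'n"
    and R1 :: "real \<Rightarrow> complex \<Rightarrow> real" and R2 :: "real \<Rightarrow> complex \<Rightarrow> complex"
    and \<delta> K \<alpha>1 :: real and \<alpha>2 c d :: complex and h20 h11 h30 h21 :: "real \<Rightarrow> complex^'n"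
  assumes F: "Ck_on 3 F UNIV" and T: "T > 0"
    and u0: "\<And>t. (u0 has_vector_derivative F (u0 t)) (at t)"
    and v: "\<And>\<tau>. \<tau> \<in> {0..T} \<Longrightarrow>
      (v has_vector_derivative cmat (Amat F u0 \<tau>) *v v \<tau>) (at \<tau> within {0..T})"
    and \<delta>: "\<delta> > 0" and K: "K \<ge> 0"
    and H: "Ck_on 1 (\<lambda>(\<tau>, \<xi>). H \<tau> \<xi>) (UNIV \<times> ball 0 \<delta>)"
    and H_expansion: "\<And>\<tau> \<xi>. \<xi> \<in> ball 0 \<delta> \<Longrightarrow>
      norm (H \<tau> \<xi> - (rpair (\<xi>\<^sup>2 / 2) (h20 \<tau>) + (cmod \<xi>)\<^sup>2 *\<^sub>R vRe (h11 \<tau>)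
        + (rpair (\<xi> ^ 3 / 6) (h30 \<tau>) + rpair (\<xi>\<^sup>2 * cnj \<xi> / 2) (h21 \<tau>)))) \<le> K * cmod \<xi> ^ 4"
    and R1: "\<And>\<tau> \<xi>. \<xi> \<in> ball 0 \<delta> \<Longrightarrow> \<bar>R1 \<tau> \<xi>\<bar> \<le> K * cmod \<xi> ^ 5"
    and R2: "\<And>\<tau> \<xi>. \<xi> \<in> ball 0 \<delta> \<Longrightarrow> cmod (R2 \<tau> \<xi>) \<le> K * cmod \<xi> ^ 5"
    and invariance: "\<And>\<tau> \<xi>. 0 < \<tau> \<Longrightarrow> \<tau> < T \<Longrightarrow> \<xi> \<in> ball 0 \<delta> \<Longrightarrow>
      (1 + \<alpha>1 * (cmod \<xi>)\<^sup>2 + 2 * Re (\<alpha>2 * \<xi> ^ 4) + R1 \<tau> \<xi>) *\<^sub>R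
        (F (u0 \<tau>) + rpair \<xi> (cmat (Amat F u0 \<tau>) *v v \<tau>) + dir_deriv (1, 0) (\<lambda>(\<tau>, \<xi>). H \<tau> \<xi>) (\<tau>, \<xi>))
      + rpair (c * \<xi> * of_real ((cmod \<xi>)\<^sup>2) + d * cnj \<xi> ^ 3 + R2 \<tau> \<xi>) (v \<tau>)
      + dir_deriv (0, c * \<xi> * of_real ((cmod \<xi>)\<^sup>2) + d * cnj \<xi> ^ 3 + R2 \<tau> \<xi>) (\<lambda>(\<tau>, \<xi>). H \<tau> \<xi>) (\<tau>, \<xi>)
      = F (u0 \<tau> + rpair \<xi> (v \<tau>) + H \<tau> \<xi>)"
begin

text \<open>\<open>Q2\<close> and \<open>Q3\<close> are the homogeneous parts of degree 2 and 3 of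
  \<open>H\<close>, and \<open>x1\<close> is the linear part of the displacement. At
  \<open>\<xi> = s w\<close> with \<open>cmod w = 1\<close> the parametrization is \<open>u0\<close>
  plus \<open>s x1 + s^2 Q2 + s^3 Q3\<close> up to order \<open>s^4\<close>.\<close>

definition Q2 :: "complex \<Rightarrow> real \<Rightarrow> real^'n" where
  "Q2 w \<tau> = rpair (w\<^sup>2 / 2) (h20 \<tau>) + (cmod w)\<^sup>2 *\<^sub>R vRe (h11 \<tau>)"

definition Q3 :: "complex \<Rightarrow> real \<Rightarrow> real^'n" where
  "Q3 w \<tau> = rpair (w ^ 3 / 6) (h30 \<tau>) + rpair (w\<^sup>2 * cnj w / 2) (h21 \<tau>)"

definition x1 :: "complex \<Rightarrow> real \<Rightarrow> real^'n" where
  "x1 w \<tau> = rpair w (v \<tau>)"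

abbreviation A :: "real \<Rightarrow> real^'n^'n" where "A \<equiv> Amat F u0"

abbreviation dH :: "real \<times> complex \<Rightarrow> real \<times> complex \<Rightarrow> real^'n" where
  "dH b \<equiv> dir_deriv b (\<lambda>(\<tau>, \<xi>). H \<tau> \<xi>)"

lemma F2: "Ck_on 2 F UNIV"
  using F by (rule Ck_on_mono) simp

lemma dF: "F differentiable (at p)"
  using F by (auto simp: numeral_3_eq_3)

lemma A_eq: "A \<tau> *v x = dir_deriv x F (u0 \<tau>)"
  by (rule Amat_mult_vec[OF dF])

lemma continuous_u0: "continuous_on X u0"
  using u0 by (meson continuous_at_imp_continuous_on has_vector_derivative_continuous)

lemma compact_orbit: "compact (u0 ` {0..T})"
  by (intro compact_continuous_image continuous_u0 compact_Icc)

lemma continuous_v: "continuous_on {0..T} v"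
  unfolding continuous_on_eq_continuous_within using has_vector_derivative_continuous[OF v] by blast

lemma continuous_rpair_v: "continuous_on {0..T} (\<lambda>\<tau>. rpair z (v \<tau>))"
  by (intro bounded_linear.continuous_on[OF bounded_bilinear.bounded_linear_right[OF bounded_bilinear_rpair]]
      continuous_v)

lemma continuous_x1: "continuous_on {0..T} (x1 w)"
  unfolding x1_def[abs_def] by (rule continuous_rpair_v)

lemma rpair_of_real: "rpair (of_real r * z) a = r *\<^sub>R rpair z a"
  by (simp add: vec_eq_iff rpair_def algebra_simps)

lemma Q2_scale: "Q2 (of_real s * w) \<tau> = s\<^sup>2 *\<^sub>R Q2 w \<tau>"
proof -
  have "(of_real s * w)\<^sup>2 / 2 = of_real (s\<^sup>2) * (w\<^sup>2 / 2)" by (simp add: power_mult_distrib)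
  then show ?thesis unfolding Q2_def
    by (simp only: rpair_of_real) (simp add: norm_mult power_mult_distrib scaleR_add_right)
qed

lemma Q3_scale: "Q3 (of_real s * w) \<tau> = s ^ 3 *\<^sub>R Q3 w \<tau>"
proof -
  have "(of_real s * w) ^ 3 / 6 = of_real (s ^ 3) * (w ^ 3 / 6)"
    "(of_real s * w)\<^sup>2 * cnj (of_real s * w) / 2 = of_real (s ^ 3) * (w\<^sup>2 * cnj w / 2)"
    by (simp_all add: power_mult_distrib power3_eq_cube power2_eq_square)
  then show ?thesis unfolding Q3_def
    by (simp only: rpair_of_real scaleR_add_right)
qed

text \<open>Negative \<open>s\<close> is included on purpose: comparing \<open>s\<close> with
  \<open>-s\<close> separates the even part from the odd one.\<close>

lemma H_radial:
  assumes "cmod w = 1" "\<bar>s\<bar> < \<delta>"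
  shows "norm (H \<tau> (of_real s * w) - (s\<^sup>2 *\<^sub>R Q2 w \<tau> + s ^ 3 *\<^sub>R Q3 w \<tau>)) \<le> K * s ^ 4"
proof -
  have "cmod (of_real s * w) = \<bar>s\<bar>" using assms by (simp add: norm_mult)
  then show ?thesis
    using H_expansion[of "of_real s * w" \<tau>] assms
    by (simp add: Q2_scale[symmetric] Q3_scale[symmetric]) (simp add: Q2_def Q3_def)
qed

lemma dH_derivative: "\<xi> \<in> ball 0 \<delta> \<Longrightarrow> ((\<lambda>(\<tau>, \<xi>). H \<tau> \<xi>) has_derivative (\<lambda>b. dH b (\<tau>, \<xi>))) (at (\<tau>, \<xi>))"
  by (intro has_derivative_dir_deriv Ck_on_1D(1)[OF H]) simp

lemma continuous_H: "\<xi> \<in> ball 0 \<delta> \<Longrightarrow> continuous_on X (\<lambda>\<tau>. H \<tau> \<xi>)"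
proof -
  assume \<xi>: "\<xi> \<in> ball 0 \<delta>"
  have "continuous_on (UNIV \<times> ball 0 \<delta>) (\<lambda>(\<tau>, \<xi>). H \<tau> \<xi>)"
    using Ck_on_SucD[of 0 "\<lambda>(\<tau>, \<xi>). H \<tau> \<xi>"] H by simp
  moreover have "continuous_on X (\<lambda>\<tau>. (\<tau>, \<xi>))" by (intro continuous_intros)
  ultimately show ?thesis using continuous_on_compose2[of _ _ X "\<lambda>\<tau>. (\<tau>, \<xi>)"] \<xi> by fastforce
qed

text \<open>In the symmetrized quotient \<open>?f\<close> the cubic parts at \<open>s\<close> and
  \<open>-s\<close> cancel, so it converges uniformly to \<open>Q2 w\<close>; each
  \<open>?f s\<close> is continuous because \<open>H\<close> is.\<close>

lemma continuous_Q2: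
  assumes w: "cmod w = 1"
  shows "continuous_on {0..T} (Q2 w)"
proof (rule uniform_limit_theorem)
  let ?f = "\<lambda>s \<tau>. (1 / (2 * s\<^sup>2)) *\<^sub>R (H \<tau> (of_real s * w) + H \<tau> (of_real (-s) * w))"
  have s: "\<forall>\<^sub>F s in at_right 0. s \<in> {0<..<min 1 \<delta>}"
    using \<delta> eventually_at_right_real[of 0 "min 1 \<delta>"] by simp
  then show "\<forall>\<^sub>F s in at_right 0. continuous_on {0..T} (?f s)"
  proof eventually_elim
    case (elim s)
    then show ?case using w by (intro continuous_intros continuous_H) (auto simp: norm_mult)
  qed
  have "uniform_limit {0..T} (\<lambda>s \<tau>. ?f s \<tau> - Q2 w \<tau>) (\<lambda>_. 0) (at_right 0)"
  proof (rule uniform_limit_0_linear_bound[of "min 1 \<delta>"])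
    show "0 < min 1 \<delta>" using \<delta> by simp
    fix s \<tau> assume s: "0 < s" "s < min 1 \<delta>"
    let ?a = "H \<tau> (of_real s * w) - (s\<^sup>2 *\<^sub>R Q2 w \<tau> + s ^ 3 *\<^sub>R Q3 w \<tau>)"
    let ?b = "H \<tau> (of_real (-s) * w) - ((-s)\<^sup>2 *\<^sub>R Q2 w \<tau> + (-s) ^ 3 *\<^sub>R Q3 w \<tau>)"
    have "?a + ?b = (2 * s\<^sup>2) *\<^sub>R (?f s \<tau> - Q2 w \<tau>)"
      using s by (simp add: scaleR_diff_right scaleR_add_left[symmetric] algebra_simps flip: scaleR_add_left)
    then have "?f s \<tau> - Q2 w \<tau> = (1 / (2 * s\<^sup>2)) *\<^sub>R (?a + ?b)" using s by simp
    then have "norm (?f s \<tau> - Q2 w \<tau>) = (1 / (2 * s\<^sup>2)) * norm (?a + ?b)" by (simp only: norm_scaleR) simp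
    moreover have le: "norm (?a + ?b) \<le> 2 * K * s ^ 4"
      using H_radial[OF w, of s \<tau>] H_radial[OF w, of "-s" \<tau>] s norm_triangle_ineq[of ?a ?b] by simp
    moreover have "(1 / (2 * s\<^sup>2)) * norm (?a + ?b) \<le> (1 / (2 * s\<^sup>2)) * (2 * K * s ^ 4)"
      using s by (intro mult_left_mono le) simp
    ultimately have "norm (?f s \<tau> - Q2 w \<tau>) \<le> (1 / (2 * s\<^sup>2)) * (2 * K * s ^ 4)"
      by linarith
    also have "\<dots> = K * s * s" using s by (simp add: field_simps power2_eq_square power4_eq_xxxx)
    also have "\<dots> \<le> K * s * 1" using s K by (intro mult_left_mono) auto
    finally show "norm (?f s \<tau> - Q2 w \<tau>) \<le> K * s" by simp
  qed
  from uniform_limit_add[OF this uniform_limit_const[where c="Q2 w"]]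
  show "uniform_limit {0..T} ?f (Q2 w) (at_right 0)" by simp
qed simp

text \<open>Once \<open>Q2\<close> is known to be continuous it can be subtracted, and the quotient
  by \<open>s ^ 3\<close> converges uniformly.\<close>

lemma continuous_Q3:
  assumes w: "cmod w = 1"
  shows "continuous_on {0..T} (Q3 w)"
proof (rule uniform_limit_theorem)
  let ?f = "\<lambda>s \<tau>. (1 / s ^ 3) *\<^sub>R (H \<tau> (of_real s * w) - s\<^sup>2 *\<^sub>R Q2 w \<tau>)"
  have s: "\<forall>\<^sub>F s in at_right 0. s \<in> {0<..<min 1 \<delta>}"
    using \<delta> eventually_at_right_real[of 0 "min 1 \<delta>"] by simp
  then show "\<forall>\<^sub>F s in at_right 0. continuous_on {0..T} (?f s)"
  proof eventually_elim
    case (elim s)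
    then show ?case using w by (intro continuous_intros continuous_H continuous_Q2) (auto simp: norm_mult)
  qed
  have "uniform_limit {0..T} (\<lambda>s \<tau>. ?f s \<tau> - Q3 w \<tau>) (\<lambda>_. 0) (at_right 0)"
  proof (rule uniform_limit_0_linear_bound[of \<delta>])
    show "0 < \<delta>" by (rule \<delta>)
    fix s \<tau> assume s: "0 < s" "s < \<delta>"
    let ?a = "H \<tau> (of_real s * w) - (s\<^sup>2 *\<^sub>R Q2 w \<tau> + s ^ 3 *\<^sub>R Q3 w \<tau>)"
    have "?f s \<tau> - Q3 w \<tau> = (1 / s ^ 3) *\<^sub>R ?a" using s by (simp add: algebra_simps)
    moreover have "norm ?a \<le> K * s ^ 4" using H_radial[OF w, of s \<tau>] s by simp
    ultimately have "norm (?f s \<tau> - Q3 w \<tau>) \<le> (1 / s ^ 3) * (K * s ^ 4)"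
      using s mult_left_mono[of "norm ?a" _ "1 / s ^ 3"] by (simp only: norm_scaleR) simp
    also have "\<dots> = K * s" using s by (simp add: field_simps power3_eq_cube power4_eq_xxxx)
    finally show "norm (?f s \<tau> - Q3 w \<tau>) \<le> K * s" .
  qed
  from uniform_limit_add[OF this uniform_limit_const[where c="Q3 w"]]
  show "uniform_limit {0..T} ?f (Q3 w) (at_right 0)" by simp
qed simp

lemma norm_H_radial_div:
  assumes w: "cmod w = 1" and s: "0 < s" "s < \<delta>"
  shows "norm ((1 / s) *\<^sub>R H \<tau> (of_real s * w)) \<le> s * (norm (Q2 w \<tau>) + s * norm (Q3 w \<tau>) + K * s\<^sup>2)"
proof -
  have "norm (H \<tau> (of_real s * w)) \<le> s\<^sup>2 * norm (Q2 w \<tau>) + s ^ 3 * norm (Q3 w \<tau>) + K * s ^ 4"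
    using H_radial[OF w, of s \<tau>] norm_triangle_sub[of "H \<tau> (of_real s * w)" "s\<^sup>2 *\<^sub>R Q2 w \<tau> + s ^ 3 *\<^sub>R Q3 w \<tau>"]
      norm_triangle_ineq[of "s\<^sup>2 *\<^sub>R Q2 w \<tau>" "s ^ 3 *\<^sub>R Q3 w \<tau>"] s by simp
  also have "\<dots> = s * (s * (norm (Q2 w \<tau>) + s * norm (Q3 w \<tau>) + K * s\<^sup>2))"
    by (simp add: algebra_simps power2_eq_square power3_eq_cube power4_eq_xxxx)
  finally show ?thesis using s by (simp add: divide_le_eq mult.commute)
qed

text \<open>\<open>H\<close> is of second order along the ray in direction \<open>w\<close>, so its
  one-sided difference quotient at 0 tends to 0; a derivative from the right is unique. This is what
  makes the \<xi>-derivative of \<open>H\<close> negligible later.\<close>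

lemma dH_zero:
  assumes w: "cmod w = 1"
  shows "dH (0, w) (\<tau>, 0) = 0"
proof -
  have "((\<lambda>s. (\<lambda>(\<tau>, \<xi>). H \<tau> \<xi>) ((\<tau>, 0) + s *\<^sub>R (0, w))) has_vector_derivative
      dH (0, w) ((\<tau>, 0) + 0 *\<^sub>R (0, w))) (at 0 within {0..})"
    by (intro has_vector_derivative_line Ck_on_1D(1)[OF H]) (use \<delta> in auto)
  then have 1: "((\<lambda>s. H \<tau> (of_real s * w)) has_vector_derivative dH (0, w) (\<tau>, 0)) (at 0 within {0..})"
    by (simp add: scaleR_conv_of_real)
  have H0: "H \<tau> 0 = 0" using H_radial[OF w, of 0 \<tau>] \<delta> by simp
  have "((\<lambda>s. H \<tau> (of_real s * w)) has_vector_derivative 0) (at 0 within {0..})"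
  proof -
    have "((\<lambda>s. (1 / s) *\<^sub>R H \<tau> (of_real s * w)) \<longlongrightarrow> 0) (at_right 0)"
    proof (rule Lim_null_comparison)
      show "((\<lambda>s. s * (norm (Q2 w \<tau>) + s * norm (Q3 w \<tau>) + K * s\<^sup>2)) \<longlongrightarrow> 0) (at_right 0)"
        by (auto intro!: tendsto_eq_intros)
      show "\<forall>\<^sub>F s in at_right 0. norm ((1 / s) *\<^sub>R H \<tau> (of_real s * w)) \<le> s * (norm (Q2 w \<tau>) + s * norm (Q3 w \<tau>) + K * s\<^sup>2)"
        using eventually_at_right_real[OF \<delta>]
        by eventually_elim (use norm_H_radial_div[OF w] in auto)
    qed
    moreover have "at 0 within {0..} = at_right (0::real)"
      by (metis at_within_Ici_at_right)
    ultimately show ?thesis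
      unfolding has_vector_derivative_def has_derivative_within
      by (auto simp: H0 bounded_linear_zero divide_inverse elim!: Lim_transform_eventually
          simp: eventually_at_filter)
  qed
  from vector_derivative_unique_within[OF _ 1 this] show ?thesis
    by (simp add: at_within_Ici_at_right)
qed

end

section \<open>Expansion of the invariance equation along rays\<close>

text \<open>The invariance equation with its vectors abstracted: \<open>p\<close> stands for
  \<open>\<alpha>1\<close>, \<open>m\<close> for the part of order \<open>s^4\<close> in the
  \<tau>-velocity, \<open>r1\<close> and \<open>r2\<close> for the two parts of the \<xi>-velocity
  applied to \<open>v\<close>, \<open>HZ\<close> for the \<xi>-derivative of \<open>H\<close>.
  \<open>AP3\<close> and \<open>Caaa\<close>, the limits of \<open>Ay3\<close> and
  \<open>Ca'\<close>, are inserted and subtracted again.\<close>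

lemma remainder_algebra:
  fixes f Aa AP2 AP3 Ay3 Baa BaP2 Bay3 Bbb Ca' Caaa H\<tau> rho r1 r2 HZ :: "'a::real_vector"
  assumes "(1 + p * s\<^sup>2 + m) *\<^sub>R (f + s *\<^sub>R Aa + H\<tau>) + (s ^ 3 *\<^sub>R r1 + r2) + HZ =
     f + (s *\<^sub>R Aa + s\<^sup>2 *\<^sub>R AP2 + s ^ 3 *\<^sub>R Ay3) + (1/2) *\<^sub>R (s\<^sup>2 *\<^sub>R Baa + (2 * s ^ 3) *\<^sub>R (BaP2 + s *\<^sub>R Bay3) + s ^ 4 *\<^sub>R Bbb)
       + (1/6) *\<^sub>R (s ^ 3 *\<^sub>R Ca') + rho"
  shows "(1 + p * s\<^sup>2) *\<^sub>R H\<tau> =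
     s\<^sup>2 *\<^sub>R (AP2 + (1/2) *\<^sub>R Baa - p *\<^sub>R f) + s ^ 3 *\<^sub>R (AP3 + BaP2 + (1/6) *\<^sub>R Caaa - p *\<^sub>R Aa - r1)
     + (s ^ 3 *\<^sub>R (Ay3 - AP3) + s ^ 4 *\<^sub>R (Bay3 + (1/2) *\<^sub>R Bbb) + (s ^ 3 / 6) *\<^sub>R (Ca' - Caaa)
        + rho - m *\<^sub>R (f + s *\<^sub>R Aa + H\<tau>) - r2 - HZ)"
proof -
  have *: "(1 + p * s\<^sup>2) *\<^sub>R H\<tau> = (1 + p * s\<^sup>2 + m) *\<^sub>R (f + s *\<^sub>R Aa + H\<tau>)
     - (1 + p * s\<^sup>2) *\<^sub>R (f + s *\<^sub>R Aa) - m *\<^sub>R (f + s *\<^sub>R Aa + H\<tau>)"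
    by (simp add: algebra_simps)
  have **: "(1 + p * s\<^sup>2 + m) *\<^sub>R (f + s *\<^sub>R Aa + H\<tau>) = f + (s *\<^sub>R Aa + s\<^sup>2 *\<^sub>R AP2 + s ^ 3 *\<^sub>R Ay3) + (1/2) *\<^sub>R (s\<^sup>2 *\<^sub>R Baa + (2 * s ^ 3) *\<^sub>R (BaP2 + s *\<^sub>R Bay3) + s ^ 4 *\<^sub>R Bbb)
       + (1/6) *\<^sub>R (s ^ 3 *\<^sub>R Ca') + rho - (s ^ 3 *\<^sub>R r1 + r2) - HZ"
    using assms by (metis add_diff_cancel_right' diff_diff_eq2 diff_diff_eq)
  have e: "s * s ^ 3 = s ^ 4" "s ^ 3 * s = s ^ 4" "s * s\<^sup>2 = s ^ 3" "s\<^sup>2 * s = s ^ 3"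
    by (simp_all add: power2_eq_square power3_eq_cube power4_eq_xxxx)
  show ?thesis
    unfolding * ** by (simp add: scaleR_add_right scaleR_add_left scaleR_diff_right scaleR_diff_left e distrib_right distrib_left mult_ac)
qed

context center_manifold
begin

text \<open>\<open>G2\<close> and \<open>G3\<close> are the terms of degree 2 and 3 in the expansion
  of \<open>F\<close>, minus what the reduced dynamics contributes: \<open>\<alpha>1\<close> times
  the orbit velocity, \<open>\<alpha>1\<close> times the velocity of \<open>x1\<close>, and the
  cubic \<xi>-velocity applied to \<open>v\<close>. The mixed term in \<open>G3\<close> has
  coefficient 1 because it occurs twice with factor 1/2.\<close>

definition G2 :: "complex \<Rightarrow> real \<Rightarrow> real^'n" where
  "G2 w \<tau> = A \<tau> *v Q2 w \<tau> + (1/2) *\<^sub>R B2 F (u0 \<tau>) (x1 w \<tau>) (x1 w \<tau>) - \<alpha>1 *\<^sub>R F (u0 \<tau>)"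

definition G3 :: "complex \<Rightarrow> real \<Rightarrow> real^'n" where
  "G3 w \<tau> = A \<tau> *v Q3 w \<tau> + B2 F (u0 \<tau>) (x1 w \<tau>) (Q2 w \<tau>)
     + (1/6) *\<^sub>R C3 F (u0 \<tau>) (x1 w \<tau>) (x1 w \<tau>) (x1 w \<tau>)
     - \<alpha>1 *\<^sub>R (A \<tau> *v x1 w \<tau>) - rpair (c * w + d * cnj w ^ 3) (v \<tau>)"

lemma continuous_dir_deriv_orbit:
  "continuous_on X (\<lambda>\<tau>. dir_deriv a F (u0 \<tau>))"
  "continuous_on X (\<lambda>\<tau>. dir_deriv a (dir_deriv b F) (u0 \<tau>))"
  "continuous_on X (\<lambda>\<tau>. dir_deriv a (dir_deriv b (dir_deriv e F)) (u0 \<tau>))"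
proof -
  have 1: "continuous_on UNIV (dir_deriv a F)"
    using Ck_on_mono[OF F, of 1] by simp
  have 2: "continuous_on UNIV (dir_deriv a (dir_deriv b F))"
    using F2 by (simp add: numeral_2_eq_2)
  have 3: "continuous_on UNIV (dir_deriv a (dir_deriv b (dir_deriv e F)))"
    using F by (simp add: numeral_3_eq_3)
  show "continuous_on X (\<lambda>\<tau>. dir_deriv a F (u0 \<tau>))"
    "continuous_on X (\<lambda>\<tau>. dir_deriv a (dir_deriv b F) (u0 \<tau>))"
    "continuous_on X (\<lambda>\<tau>. dir_deriv a (dir_deriv b (dir_deriv e F)) (u0 \<tau>))"
    by (rule continuous_on_compose2[OF 1 continuous_u0] continuous_on_compose2[OF 2 continuous_u0]
        continuous_on_compose2[OF 3 continuous_u0]; simp)+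
qed

lemma continuous_F_u0: "continuous_on X (\<lambda>\<tau>. F (u0 \<tau>))"
  by (rule continuous_on_compose2[of UNIV, OF _ continuous_u0])
    (use Ck_on_mono[OF F, of 0] in auto)

lemma continuous_A_mult: "continuous_on X x \<Longrightarrow> continuous_on X (\<lambda>\<tau>. A \<tau> *v x \<tau>)"
  unfolding A_eq by (subst dir_deriv_axis_expand[OF dF]) (intro continuous_intros continuous_dir_deriv_orbit)

lemma continuous_B2: "continuous_on X x \<Longrightarrow> continuous_on X y \<Longrightarrow> continuous_on X (\<lambda>\<tau>. B2 F (u0 \<tau>) (x \<tau>) (y \<tau>))"
  unfolding B2_def by (intro continuous_intros continuous_dir_deriv_orbit)

lemma continuous_C3: "continuous_on X x \<Longrightarrow> continuous_on X y \<Longrightarrow> continuous_on X z \<Longrightarrow>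
    continuous_on X (\<lambda>\<tau>. C3 F (u0 \<tau>) (x \<tau>) (y \<tau>) (z \<tau>))"
  unfolding C3_def by (intro continuous_intros continuous_dir_deriv_orbit)

lemma continuous_G2: "cmod w = 1 \<Longrightarrow> continuous_on {0..T} (G2 w)"
  unfolding G2_def[abs_def]
  by (intro continuous_intros continuous_A_mult continuous_B2 continuous_F_u0 continuous_x1 continuous_Q2)

lemma continuous_G3: "cmod w = 1 \<Longrightarrow> continuous_on {0..T} (G3 w)"
  unfolding G3_def[abs_def]
  by (intro continuous_intros continuous_A_mult continuous_B2 continuous_C3 continuous_x1 continuous_Q2
      continuous_Q3 continuous_rpair_v)

lemma norm_A_mult_le: "\<exists>M\<ge>0. \<forall>\<tau>\<in>{0..T}. \<forall>x. norm (A \<tau> *v x) \<le> M * norm x"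
proof -
  have "\<exists>M\<ge>0. \<forall>\<tau>\<in>{0..T}. norm (dir_deriv (axis i 1) F (u0 \<tau>)) \<le> M" for i
    by (intro continuous_on_compact_norm_bound continuous_dir_deriv_orbit compact_Icc)
  then obtain M where M: "\<And>i. M i \<ge> 0" "\<And>i \<tau>. \<tau> \<in> {0..T} \<Longrightarrow> norm (dir_deriv (axis i 1) F (u0 \<tau>)) \<le> M i"
    by metis
  have "norm (A \<tau> *v x) \<le> (\<Sum>i\<in>UNIV. M i) * norm x" if "\<tau> \<in> {0..T}" for \<tau> x
    unfolding A_eq dir_deriv_axis_expand[OF dF, of x] sum_distrib_right
  proof (intro order_trans[OF norm_sum] sum_mono)
    fix i
    have "\<bar>x $ i\<bar> * norm (dir_deriv (axis i 1) F (u0 \<tau>)) \<le> norm x * M i"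
      using M that Finite_Cartesian_Product.norm_nth_le[of x i] by (intro mult_mono) auto
    then show "norm ((x $ i) *\<^sub>R dir_deriv (axis i 1) F (u0 \<tau>)) \<le> M i * norm x" by (simp add: mult.commute)
  qed
  then show ?thesis using M(1) by (intro exI[of _ "\<Sum>i\<in>UNIV. M i"]) (auto intro: sum_nonneg)
qed

text \<open>The exact displacement is inserted into the invariance equation, and the defect splits
  into seven errors. Five are of order \<open>s\<close>; the Taylor remainder and the
  \<xi>-derivative of \<open>H\<close> tend to 0 without a rate.\<close>

lemma remainder_uniform:
  assumes w: "cmod w = 1"
  shows "uniform_limit {0<..<T} (\<lambda>s \<tau>. (1 / s ^ 3) *\<^sub>R ((1 + \<alpha>1 * s\<^sup>2) *\<^sub>R dH (1, 0) (\<tau>, of_real s * w)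
    - s\<^sup>2 *\<^sub>R G2 w \<tau> - s ^ 3 *\<^sub>R G3 w \<tau>)) (\<lambda>_. 0) (at_right 0)"
proof -
  \<comment> \<open>The bound 1 absorbs higher powers of \<open>s\<close>;
    \<open>\<delta> / 2\<close> keeps the ray in a closed ball inside the domain, so that
    derivatives of \<open>H\<close> are bounded and uniformly continuous there.\<close>
  define s0 where "s0 = min 1 (\<delta> / 2)"
  have s0: "s0 > 0" using \<delta> by (simp add: s0_def)
  have in_ball: "of_real s * w \<in> ball 0 \<delta>" "of_real s * w \<in> cball 0 (\<delta> / 2)" "s \<le> 1" "s < \<delta>"
    if "0 < s" "s < s0" for s
    using that w \<delta> by (auto simp: s0_def norm_mult)
  note compact_bound = continuous_on_compact_norm_bound[OF compact_Icc]
  obtain MA where MA: "MA \<ge> 0" "\<And>\<tau> x. \<tau> \<in> {0..T} \<Longrightarrow> norm (A \<tau> *v x) \<le> MA * norm x"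
    using norm_A_mult_le by blast
  obtain MB where MB: "MB \<ge> 0" "\<And>\<tau> x y. \<tau> \<in> {0..T} \<Longrightarrow> norm (B2 F (u0 \<tau>) x y) \<le> MB * norm x * norm y"
    using norm_B2_le[OF F2 compact_orbit] by blast
  obtain MC where MC: "MC \<ge> 0" "\<And>\<tau> x y z. \<tau> \<in> {0..T} \<Longrightarrow> norm (C3 F (u0 \<tau>) x y z) \<le> MC * norm x * norm y * norm z"
    using norm_C3_le[OF F compact_orbit] by blast
  obtain MX where MX: "MX \<ge> 0" "\<And>\<tau>. \<tau> \<in> {0..T} \<Longrightarrow> norm (x1 w \<tau>) \<le> MX"
    using compact_bound[OF continuous_x1] by blast
  obtain M2 where M2: "M2 \<ge> 0" "\<And>\<tau>. \<tau> \<in> {0..T} \<Longrightarrow> norm (Q2 w \<tau>) \<le> M2"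
    using compact_bound[OF continuous_Q2[OF w]] by blast
  obtain M3 where M3: "M3 \<ge> 0" "\<And>\<tau>. \<tau> \<in> {0..T} \<Longrightarrow> norm (Q3 w \<tau>) \<le> M3"
    using compact_bound[OF continuous_Q3[OF w]] by blast
  obtain MF where MF: "MF \<ge> 0" "\<And>\<tau>. \<tau> \<in> {0..T} \<Longrightarrow> norm (F (u0 \<tau>)) \<le> MF"
    using compact_bound[OF continuous_F_u0] by blast
  obtain MV where MV: "MV \<ge> 0" "\<And>\<tau>. \<tau> \<in> {0..T} \<Longrightarrow> norm (v \<tau>) \<le> MV"
    using compact_bound[OF continuous_v] by blast
  obtain MR where MR: "MR \<ge> 0" "\<And>z (a :: complex^'n). norm (rpair z a :: real^'n) \<le> norm z * norm a * MR"
    using bounded_bilinear.nonneg_bounded[OF bounded_bilinear_rpair] by blast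
  have comp: "compact ({0..T} \<times> cball (0::complex) (\<delta> / 2))" by (intro compact_Times) auto
  have cdH: "continuous_on ({0..T} \<times> cball 0 (\<delta> / 2)) (dH b)" for b
    by (rule continuous_on_subset[OF Ck_on_1D(2)[OF H]]) (use \<delta> in auto)
  obtain MH where MH: "MH \<ge> 0" "\<And>p. p \<in> {0..T} \<times> cball 0 (\<delta> / 2) \<Longrightarrow> norm (dH (1, 0) p) \<le> MH"
    using continuous_on_compact_norm_bound[OF comp cdH] by blast
  \<comment> \<open>The exact cubic quotient: with \<open>b\<close> and \<open>a'\<close> below,
    \<open>s *\<^sub>R a' s \<tau>\<close> is the whole displacement from the orbit. Only
    \<open>y3_diff\<close> compares it with \<open>Q3\<close>.\<close>
  define y3 where "y3 s \<tau> = (1 / s ^ 3) *\<^sub>R (H \<tau> (of_real s * w) - s\<^sup>2 *\<^sub>R Q2 w \<tau>)" for s \<tau>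
  define b where "b s \<tau> = Q2 w \<tau> + s *\<^sub>R y3 s \<tau>" for s \<tau>
  define a' where "a' s \<tau> = x1 w \<tau> + s *\<^sub>R b s \<tau>" for s \<tau>
  have y3_diff: "norm (y3 s \<tau> - Q3 w \<tau>) \<le> K * s" if s: "0 < s" "s < s0" for s \<tau>
  proof -
    have "y3 s \<tau> - Q3 w \<tau> = (1 / s ^ 3) *\<^sub>R (H \<tau> (of_real s * w) - (s\<^sup>2 *\<^sub>R Q2 w \<tau> + s ^ 3 *\<^sub>R Q3 w \<tau>))"
      using s by (simp add: y3_def algebra_simps)
    then have "norm (y3 s \<tau> - Q3 w \<tau>) = (1 / s ^ 3) * norm (H \<tau> (of_real s * w) - (s\<^sup>2 *\<^sub>R Q2 w \<tau> + s ^ 3 *\<^sub>R Q3 w \<tau>))"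
      using s by (simp only: norm_scaleR) simp
    also have "\<dots> \<le> (1 / s ^ 3) * (K * s ^ 4)"
      using s in_ball[OF s] by (intro mult_left_mono H_radial[OF w]) auto
    also have "\<dots> = K * s" using s by (simp add: field_simps power3_eq_cube power4_eq_xxxx)
    finally show ?thesis .
  qed
  define My where "My = M3 + K"
  have My: "My \<ge> 0" using M3 K by (simp add: My_def)
  have y3: "norm (y3 s \<tau>) \<le> My" if s: "0 < s" "s < s0" and \<tau>: "\<tau> \<in> {0..T}" for s \<tau>
  proof -
    have "K * s \<le> K" using in_ball(3)[OF s] K by (simp add: mult_left_le)
    then show ?thesis
      using norm_triangle_sub[of "y3 s \<tau>" "Q3 w \<tau>"] y3_diff[OF s, of \<tau>] M3(2)[OF \<tau>] by (simp add: My_def)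
  qed
  define Mb where "Mb = M2 + My"
  have Mb: "Mb \<ge> 0" using M2 My by (simp add: Mb_def)
  have b: "norm (b s \<tau>) \<le> Mb" if s: "0 < s" "s < s0" and \<tau>: "\<tau> \<in> {0..T}" for s \<tau>
  proof -
    have "norm (s *\<^sub>R y3 s \<tau>) \<le> 1 * My"
      unfolding norm_scaleR using in_ball(3)[OF s] s y3[OF s \<tau>] by (intro mult_mono) auto
    then show ?thesis
      using norm_triangle_ineq[of "Q2 w \<tau>" "s *\<^sub>R y3 s \<tau>"] M2(2)[OF \<tau>] by (simp add: b_def Mb_def)
  qed
  define Ma where "Ma = MX + Mb"
  have Ma: "Ma \<ge> 0" using MX Mb by (simp add: Ma_def)
  have a': "norm (a' s \<tau>) \<le> Ma" if s: "0 < s" "s < s0" and \<tau>: "\<tau> \<in> {0..T}" for s \<tau>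
  proof -
    have "norm (s *\<^sub>R b s \<tau>) \<le> 1 * Mb"
      unfolding norm_scaleR using in_ball(3)[OF s] s b[OF s \<tau>] by (intro mult_mono) auto
    then show ?thesis
      using norm_triangle_ineq[of "x1 w \<tau>" "s *\<^sub>R b s \<tau>"] MX(2)[OF \<tau>] by (simp add: a'_def Ma_def)
  qed
  have disp: "s *\<^sub>R a' s \<tau> = rpair (of_real s * w) (v \<tau>) + H \<tau> (of_real s * w)" if "0 < s" for s \<tau>
    using that by (simp add: a'_def b_def y3_def x1_def rpair_of_real scaleR_add_right power2_eq_square power3_eq_cube)
  define rho where "rho s \<tau> = F (u0 \<tau> + s *\<^sub>R a' s \<tau>) - F (u0 \<tau>) - A \<tau> *v (s *\<^sub>R a' s \<tau>)
     - (1/2) *\<^sub>R B2 F (u0 \<tau>) (s *\<^sub>R a' s \<tau>) (s *\<^sub>R a' s \<tau>)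
     - (1/6) *\<^sub>R C3 F (u0 \<tau>) (s *\<^sub>R a' s \<tau>) (s *\<^sub>R a' s \<tau>) (s *\<^sub>R a' s \<tau>)" for s \<tau>
  define m where "m s \<tau> = 2 * Re (\<alpha>2 * (of_real s * w) ^ 4) + R1 \<tau> (of_real s * w)" for s \<tau>
  define Z where "Z s \<tau> = c * (of_real s * w) * of_real ((cmod (of_real s * w))\<^sup>2) + d * cnj (of_real s * w) ^ 3
     + R2 \<tau> (of_real s * w)" for s \<tau>
  \<comment> \<open>In order: \<open>y3\<close> against \<open>Q3\<close>; second-order terms beyond
    degree 3; the cubic form at \<open>a'\<close> against \<open>x1\<close>; the Taylor remainder;
    the \<tau>-velocity of order \<open>s^4\<close>; \<open>R2\<close>; the \<xi>-derivative of
    \<open>H\<close>.\<close>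
  define e1 where "e1 s \<tau> = A \<tau> *v y3 s \<tau> - A \<tau> *v Q3 w \<tau>" for s \<tau>
  define e2 where "e2 s \<tau> = s *\<^sub>R (B2 F (u0 \<tau>) (x1 w \<tau>) (y3 s \<tau>) + (1/2) *\<^sub>R B2 F (u0 \<tau>) (b s \<tau>) (b s \<tau>))" for s \<tau>
  define e3 where "e3 s \<tau> = (1/6) *\<^sub>R (C3 F (u0 \<tau>) (a' s \<tau>) (a' s \<tau>) (a' s \<tau>)
     - C3 F (u0 \<tau>) (x1 w \<tau>) (x1 w \<tau>) (x1 w \<tau>))" for s \<tau>
  define e4 where "e4 s \<tau> = (1 / s ^ 3) *\<^sub>R rho s \<tau>" for s \<tau>
  define e5 where "e5 s \<tau> = (1 / s ^ 3) *\<^sub>R (m s \<tau> *\<^sub>R (F (u0 \<tau>) + s *\<^sub>R (A \<tau> *v x1 w \<tau>) + dH (1, 0) (\<tau>, of_real s * w)))" for s \<tau>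
  define e6 where "e6 s \<tau> = (1 / s ^ 3) *\<^sub>R (rpair (R2 \<tau> (of_real s * w)) (v \<tau>) :: real^'n)" for s \<tau>
  define e7 where "e7 s \<tau> = (1 / s ^ 3) *\<^sub>R dH (0, Z s \<tau>) (\<tau>, of_real s * w)" for s \<tau>

  have decomp: "(1 / s ^ 3) *\<^sub>R ((1 + \<alpha>1 * s\<^sup>2) *\<^sub>R dH (1, 0) (\<tau>, of_real s * w) - s\<^sup>2 *\<^sub>R G2 w \<tau> - s ^ 3 *\<^sub>R G3 w \<tau>)
     = e1 s \<tau> + e2 s \<tau> + e3 s \<tau> + e4 s \<tau> - e5 s \<tau> - e6 s \<tau> - e7 s \<tau>"
    if s: "0 < s" "s < s0" and \<tau>: "\<tau> \<in> {0<..<T}" for s \<tau>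
  proof -
    let ?\<xi> = "of_real s * w"
    have cm: "cmod ?\<xi> = s" using s w by (simp add: norm_mult)
    have Aa': "A \<tau> *v (s *\<^sub>R a' s \<tau>) = s *\<^sub>R (A \<tau> *v x1 w \<tau>) + s\<^sup>2 *\<^sub>R (A \<tau> *v Q2 w \<tau>) + s ^ 3 *\<^sub>R (A \<tau> *v y3 s \<tau>)"
      by (simp add: a'_def b_def matrix_vector_right_distrib matrix_vector_mult_scaleR scaleR_add_right power2_eq_square power3_eq_cube)
    have Ba': "B2 F (u0 \<tau>) (s *\<^sub>R a' s \<tau>) (s *\<^sub>R a' s \<tau>) = s\<^sup>2 *\<^sub>R B2 F (u0 \<tau>) (x1 w \<tau>) (x1 w \<tau>)
      + (2 * s ^ 3) *\<^sub>R (B2 F (u0 \<tau>) (x1 w \<tau>) (Q2 w \<tau>) + s *\<^sub>R B2 F (u0 \<tau>) (x1 w \<tau>) (y3 s \<tau>))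
      + s ^ 4 *\<^sub>R B2 F (u0 \<tau>) (b s \<tau>) (b s \<tau>)"
    proof -
      have 1: "B2 F (u0 \<tau>) (x1 w \<tau>) (b s \<tau>) = B2 F (u0 \<tau>) (x1 w \<tau>) (Q2 w \<tau>) + s *\<^sub>R B2 F (u0 \<tau>) (x1 w \<tau>) (y3 s \<tau>)"
        by (simp add: b_def B2_add_right B2_scaleR_right)
      have 2: "(2 * s) *\<^sub>R z = s *\<^sub>R z + s *\<^sub>R z" for z :: "real^'n"
        by (simp add: scaleR_add_left[symmetric])
      have 3: "B2 F (u0 \<tau>) (x1 w \<tau> + s *\<^sub>R b s \<tau>) (x1 w \<tau> + s *\<^sub>R b s \<tau>) = B2 F (u0 \<tau>) (x1 w \<tau>) (x1 w \<tau>)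
          + (2 * s) *\<^sub>R B2 F (u0 \<tau>) (x1 w \<tau>) (b s \<tau>) + s\<^sup>2 *\<^sub>R B2 F (u0 \<tau>) (b s \<tau>) (b s \<tau>)"
        unfolding B2_add_right B2_add_left B2_scaleR_left B2_scaleR_right 2
          B2_commute[OF F2, of _ "b s \<tau>" "x1 w \<tau>"] by (simp add: scaleR_add_right power2_eq_square)
      have 4: "B2 F (u0 \<tau>) (s *\<^sub>R z) (s *\<^sub>R z) = s\<^sup>2 *\<^sub>R B2 F (u0 \<tau>) z z" for z
        by (simp only: B2_scaleR_left B2_scaleR_right scaleR_scaleR power2_eq_square)
      have 5: "s\<^sup>2 * (2 * s) = 2 * s ^ 3" "s\<^sup>2 * s\<^sup>2 = s ^ 4"
        by (simp_all add: power2_eq_square power3_eq_cube power4_eq_xxxx)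
      show ?thesis unfolding 1[symmetric] a'_def 4 3
        by (simp only: scaleR_add_right scaleR_scaleR 5)
    qed
    have Ca': "C3 F (u0 \<tau>) (s *\<^sub>R a' s \<tau>) (s *\<^sub>R a' s \<tau>) (s *\<^sub>R a' s \<tau>) = s ^ 3 *\<^sub>R C3 F (u0 \<tau>) (a' s \<tau>) (a' s \<tau>) (a' s \<tau>)"
      by (simp add: C3_scaleR power3_eq_cube)
    have rz: "rpair (Z s \<tau>) (v \<tau>) = s ^ 3 *\<^sub>R rpair (c * w + d * cnj w ^ 3) (v \<tau>) + rpair (R2 \<tau> ?\<xi>) (v \<tau>)"
    proof -
      have "Z s \<tau> = of_real (s ^ 3) * (c * w + d * cnj w ^ 3) + R2 \<tau> ?\<xi>"
        unfolding Z_def cm by (simp add: algebra_simps power_mult_distrib power2_eq_square power3_eq_cube)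
      then show ?thesis
        by (simp only: bounded_bilinear.add_left[OF bounded_bilinear_rpair] rpair_of_real)
    qed
    have "(1 + \<alpha>1 * s\<^sup>2 + m s \<tau>) *\<^sub>R (F (u0 \<tau>) + s *\<^sub>R (A \<tau> *v x1 w \<tau>) + dH (1, 0) (\<tau>, ?\<xi>)) + rpair (Z s \<tau>) (v \<tau>)
        + dH (0, Z s \<tau>) (\<tau>, ?\<xi>) = F (u0 \<tau> + s *\<^sub>R a' s \<tau>)"
      using invariance[OF _ _ in_ball(1)[OF s], of \<tau>] \<tau>
      unfolding m_def x1_def matrix_mult_rpair Z_def cm disp[OF s(1)] rpair_of_real
      by (simp only: add.assoc greaterThanLessThan_iff simp_thms)
    also have "F (u0 \<tau> + s *\<^sub>R a' s \<tau>) = F (u0 \<tau>) + A \<tau> *v (s *\<^sub>R a' s \<tau>)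
      + (1/2) *\<^sub>R B2 F (u0 \<tau>) (s *\<^sub>R a' s \<tau>) (s *\<^sub>R a' s \<tau>)
      + (1/6) *\<^sub>R C3 F (u0 \<tau>) (s *\<^sub>R a' s \<tau>) (s *\<^sub>R a' s \<tau>) (s *\<^sub>R a' s \<tau>) + rho s \<tau>"
      unfolding rho_def by simp
    finally have main: "(1 + \<alpha>1 * s\<^sup>2) *\<^sub>R dH (1, 0) (\<tau>, ?\<xi>) = s\<^sup>2 *\<^sub>R G2 w \<tau> + s ^ 3 *\<^sub>R G3 w \<tau>
     + (s ^ 3 *\<^sub>R (A \<tau> *v y3 s \<tau> - A \<tau> *v Q3 w \<tau>)
        + s ^ 4 *\<^sub>R (B2 F (u0 \<tau>) (x1 w \<tau>) (y3 s \<tau>) + (1/2) *\<^sub>R B2 F (u0 \<tau>) (b s \<tau>) (b s \<tau>))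
        + (s ^ 3 / 6) *\<^sub>R (C3 F (u0 \<tau>) (a' s \<tau>) (a' s \<tau>) (a' s \<tau>) - C3 F (u0 \<tau>) (x1 w \<tau>) (x1 w \<tau>) (x1 w \<tau>))
        + rho s \<tau> - m s \<tau> *\<^sub>R (F (u0 \<tau>) + s *\<^sub>R (A \<tau> *v x1 w \<tau>) + dH (1, 0) (\<tau>, ?\<xi>))
        - rpair (R2 \<tau> ?\<xi>) (v \<tau>) - dH (0, Z s \<tau>) (\<tau>, ?\<xi>))"
      unfolding Aa' Ba' Ca' rz G2_def G3_def by (rule remainder_algebra)
    have "s \<noteq> 0" "s ^ 4 / s ^ 3 = s" using s by (auto simp: power3_eq_cube power4_eq_xxxx)
    then show ?thesis unfolding main e1_def e2_def e3_def e4_def e5_def e6_def e7_def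
      by (simp add: scaleR_add_right scaleR_diff_right)
  qed

  have l1: "uniform_limit {0<..<T} e1 (\<lambda>_. 0) (at_right 0)"
  proof (rule uniform_limit_0_linear_bound[OF s0])
    fix s \<tau> assume s: "0 < s" "s < s0" and \<tau>: "\<tau> \<in> {0<..<T}"
    have "norm (e1 s \<tau>) \<le> MA * norm (y3 s \<tau> - Q3 w \<tau>)"
      using MA(2)[of \<tau> "y3 s \<tau> - Q3 w \<tau>"] \<tau> by (simp add: e1_def matrix_vector_mult_diff_distrib)
    also have "\<dots> \<le> MA * (K * s)" using MA(1) y3_diff[OF s] by (intro mult_left_mono) auto
    finally show "norm (e1 s \<tau>) \<le> (MA * K) * s" by simp
  qed
  have l2: "uniform_limit {0<..<T} e2 (\<lambda>_. 0) (at_right 0)"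
  proof (rule uniform_limit_0_linear_bound[OF s0])
    fix s \<tau> assume s: "0 < s" "s < s0" and \<tau>: "\<tau> \<in> {0<..<T}"
    then have \<tau>': "\<tau> \<in> {0..T}" by auto
    have 1: "norm (B2 F (u0 \<tau>) (x1 w \<tau>) (y3 s \<tau>)) \<le> MB * MX * My"
      using MB MX(1) MX(2)[OF \<tau>'] y3[OF s \<tau>'] My by (intro order_trans[OF MB(2)[OF \<tau>']] mult_mono) auto
    have 2: "norm (B2 F (u0 \<tau>) (b s \<tau>) (b s \<tau>)) \<le> MB * Mb * Mb"
      using MB b[OF s \<tau>'] Mb by (intro order_trans[OF MB(2)[OF \<tau>']] mult_mono) auto
    have "norm (B2 F (u0 \<tau>) (x1 w \<tau>) (y3 s \<tau>) + (1/2) *\<^sub>R B2 F (u0 \<tau>) (b s \<tau>) (b s \<tau>)) \<le> MB * MX * My + MB * Mb * Mb / 2"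
      using 1 2 norm_triangle_ineq[of "B2 F (u0 \<tau>) (x1 w \<tau>) (y3 s \<tau>)" "(1/2) *\<^sub>R B2 F (u0 \<tau>) (b s \<tau>) (b s \<tau>)"] by simp
    then show "norm (e2 s \<tau>) \<le> (MB * MX * My + MB * Mb * Mb / 2) * s"
      using s by (simp add: e2_def mult.commute)
  qed
  have l3: "uniform_limit {0<..<T} e3 (\<lambda>_. 0) (at_right 0)"
  proof (rule uniform_limit_0_linear_bound[OF s0])
    fix s \<tau> assume s: "0 < s" "s < s0" and \<tau>: "\<tau> \<in> {0<..<T}"
    then have \<tau>': "\<tau> \<in> {0..T}" by auto
    let ?C = "C3 F (u0 \<tau>)" and ?a = "x1 w \<tau>" and ?b = "b s \<tau>" and ?c = "a' s \<tau>"
    have "MX \<le> Ma" using Mb by (simp add: Ma_def)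
    then have xa: "norm ?a \<le> Ma" using MX(2)[OF \<tau>'] by simp
    have 1: "norm (?C x y z) \<le> MC * X * Y * Z" if "norm x \<le> X" "norm y \<le> Y" "norm z \<le> Z" for x y z X Y Z
    proof -
      have "0 \<le> X" "0 \<le> Y" "0 \<le> Z" using that norm_ge_zero order_trans by blast+
      then show ?thesis using that MC(1) by (intro order_trans[OF MC(2)[OF \<tau>']] mult_mono) auto
    qed
    \<comment> \<open>Telescoping: the three arguments are exchanged one at a time, each exchange
      costing a factor \<open>s\<close>.\<close>
    have "?C ?c ?c ?c - ?C ?a ?a ?a = s *\<^sub>R (?C ?b ?c ?c + ?C ?a ?b ?c + ?C ?a ?a ?b)"
    proof -
      have lin: "?C ?c x y = ?C ?a x y + s *\<^sub>R ?C ?b x y" "?C x ?c y = ?C x ?a y + s *\<^sub>R ?C x ?b y"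
        "?C x y ?c = ?C x y ?a + s *\<^sub>R ?C x y ?b" for x y
        by (simp_all add: a'_def C3_add C3_scaleR)
      have "?C ?c ?c ?c = ?C ?a ?c ?c + s *\<^sub>R ?C ?b ?c ?c" "?C ?a ?c ?c = ?C ?a ?a ?c + s *\<^sub>R ?C ?a ?b ?c"
        "?C ?a ?a ?c = ?C ?a ?a ?a + s *\<^sub>R ?C ?a ?a ?b"
        by (rule lin)+
      then show ?thesis by (simp add: scaleR_add_right)
    qed
    moreover have "norm (?C ?b ?c ?c + ?C ?a ?b ?c + ?C ?a ?a ?b) \<le> 3 * (MC * Mb * Ma * Ma)"
      using 1[OF b[OF s \<tau>'] a'[OF s \<tau>'] a'[OF s \<tau>']] 1[OF xa b[OF s \<tau>'] a'[OF s \<tau>']] 1[OF xa xa b[OF s \<tau>']]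
        norm_triangle_ineq[of "?C ?b ?c ?c + ?C ?a ?b ?c" "?C ?a ?a ?b"] norm_triangle_ineq[of "?C ?b ?c ?c" "?C ?a ?b ?c"]
      by (simp add: mult_ac)
    ultimately show "norm (e3 s \<tau>) \<le> (1/2 * (MC * Mb * Ma * Ma)) * s"
      using s by (simp add: e3_def mult.commute)
  qed
  \<comment> \<open>The displacement is at most \<open>s * Ma\<close>, so a Taylor error
    \<open>e' * norm x ^ 3\<close> divided by \<open>s ^ 3\<close> is at most
    \<open>e' * Ma ^ 3\<close>. The summand 1 in \<open>Ma ^ 3 + 1\<close> covers
    \<open>Ma = 0\<close>.\<close>
  have l4: "uniform_limit {0<..<T} e4 (\<lambda>_. 0) (at_right 0)"
  proof (rule uniform_limitI)
    fix e :: real assume e: "e > 0"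
    define e' where "e' = e / (Ma ^ 3 + 1)"
    have pos: "Ma ^ 3 + 1 > 0" using Ma by (simp add: add_nonneg_pos)
    have e': "e' > 0" "e' * Ma ^ 3 < e"
    proof -
      show "e' > 0" using e pos by (simp add: e'_def)
      then have "e' * Ma ^ 3 < e' * (Ma ^ 3 + 1)" by simp
      also have "\<dots> = e" using pos by (simp add: e'_def)
      finally show "e' * Ma ^ 3 < e" .
    qed
    obtain \<eta> where \<eta>: "\<eta> > 0" "\<And>p x. p \<in> u0 ` {0..T} \<Longrightarrow> norm x < \<eta> \<Longrightarrow>
      norm (F (p + x) - F p - dir_deriv x F p - (1/2) *\<^sub>R B2 F p x x - (1/6) *\<^sub>R C3 F p x x x) \<le> e' * norm x ^ 3"
      using taylor_order_3_uniform[OF F compact_orbit e'(1)] by blast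
    show "\<forall>\<^sub>F s in at_right 0. \<forall>\<tau>\<in>{0<..<T}. dist (e4 s \<tau>) 0 < e"
      unfolding eventually_at_right_field
    proof (intro exI[of _ "min s0 (\<eta> / (Ma + 1))"] conjI allI impI ballI)
      show "0 < min s0 (\<eta> / (Ma + 1))" using s0 \<eta> Ma by simp
      fix s \<tau> assume s: "0 < s" "s < min s0 (\<eta> / (Ma + 1))" and \<tau>: "\<tau> \<in> {0<..<T}"
      then have \<tau>': "\<tau> \<in> {0..T}" by auto
      have s': "s < s0" using s by simp
      have n: "norm (s *\<^sub>R a' s \<tau>) \<le> s * Ma" using a'[OF s(1) s' \<tau>'] s by (simp add: mult_left_mono)
      also have "\<dots> < s * (Ma + 1)" using s by simp
      also have "\<dots> < \<eta>" using s Ma by (simp add: field_simps)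
      finally have "norm (rho s \<tau>) \<le> e' * norm (s *\<^sub>R a' s \<tau>) ^ 3"
        unfolding rho_def A_eq using \<tau>' by (intro \<eta>(2)) auto
      also have "\<dots> \<le> e' * (s * Ma) ^ 3" using n e' by (intro mult_left_mono power_mono) auto
      finally have le: "norm (rho s \<tau>) \<le> s ^ 3 * (e' * Ma ^ 3)" by (simp add: power_mult_distrib mult_ac)
      have "norm (e4 s \<tau>) = norm (rho s \<tau>) / s ^ 3" using s by (simp add: e4_def)
      also have "\<dots> \<le> e' * Ma ^ 3" using le s by (simp add: divide_le_eq mult.commute)
      also have "\<dots> < e" by (rule e')
      finally show "dist (e4 s \<tau>) 0 < e" by simp
    qed
  qed
  have l5: "uniform_limit {0<..<T} e5 (\<lambda>_. 0) (at_right 0)"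
  proof (rule uniform_limit_0_linear_bound[OF s0])
    fix s \<tau> assume s: "0 < s" "s < s0" and \<tau>: "\<tau> \<in> {0<..<T}"
    then have \<tau>': "\<tau> \<in> {0..T}" by auto
    let ?f = "F (u0 \<tau>) + s *\<^sub>R (A \<tau> *v x1 w \<tau>) + dH (1, 0) (\<tau>, of_real s * w)"
    have "norm (A \<tau> *v x1 w \<tau>) \<le> MA * MX"
      using MA MX(2)[OF \<tau>'] by (intro order_trans[OF MA(2)[OF \<tau>']] mult_left_mono) auto
    then have "s * norm (A \<tau> *v x1 w \<tau>) \<le> 1 * (MA * MX)"
      using s in_ball(3)[OF s] by (intro mult_mono) auto
    then have nf: "norm ?f \<le> MF + MA * MX + MH"
      using norm_triangle_ineq[of "F (u0 \<tau>) + s *\<^sub>R (A \<tau> *v x1 w \<tau>)" "dH (1, 0) (\<tau>, of_real s * w)"]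
        norm_triangle_ineq[of "F (u0 \<tau>)" "s *\<^sub>R (A \<tau> *v x1 w \<tau>)"] MF(2)[OF \<tau>'] MH(2)[of "(\<tau>, of_real s * w)"]
        \<tau>' in_ball[OF s] s by simp
    have cm: "cmod (of_real s * w) = s" using s w by (simp add: norm_mult)
    have "\<bar>Re (\<alpha>2 * (of_real s * w) ^ 4)\<bar> \<le> cmod \<alpha>2 * s ^ 4"
      using abs_Re_le_cmod[of "\<alpha>2 * (of_real s * w) ^ 4"] cm by (simp add: norm_mult norm_power)
    moreover have "\<bar>R1 \<tau> (of_real s * w)\<bar> \<le> K * s ^ 5" using R1[OF in_ball(1)[OF s], of \<tau>] cm by simp
    moreover have "K * s ^ 5 \<le> K * s ^ 4" using K s in_ball(3)[OF s] by (intro mult_left_mono power_decreasing) auto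
    ultimately have nm: "\<bar>m s \<tau>\<bar> \<le> (2 * cmod \<alpha>2 + K) * s ^ 4" by (simp add: m_def algebra_simps)
    have "norm (m s \<tau> *\<^sub>R ?f) \<le> (2 * cmod \<alpha>2 + K) * s ^ 4 * (MF + MA * MX + MH)"
      unfolding norm_scaleR using nm nf K s by (intro mult_mono) auto
    then have "norm (m s \<tau> *\<^sub>R ?f) / s ^ 3 \<le> (2 * cmod \<alpha>2 + K) * s ^ 4 * (MF + MA * MX + MH) / s ^ 3"
      using s by (intro divide_right_mono) auto
    also have "\<dots> = ((2 * cmod \<alpha>2 + K) * (MF + MA * MX + MH)) * s"
      using s by (simp add: power3_eq_cube power4_eq_xxxx)
    finally show "norm (e5 s \<tau>) \<le> ((2 * cmod \<alpha>2 + K) * (MF + MA * MX + MH)) * s"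
      using s by (simp add: e5_def)
  qed
  have l6: "uniform_limit {0<..<T} e6 (\<lambda>_. 0) (at_right 0)"
  proof (rule uniform_limit_0_linear_bound[OF s0])
    fix s \<tau> assume s: "0 < s" "s < s0" and \<tau>: "\<tau> \<in> {0<..<T}"
    then have \<tau>': "\<tau> \<in> {0..T}" by auto
    have cm: "cmod (of_real s * w) = s" using s w by (simp add: norm_mult)
    have "norm (rpair (R2 \<tau> (of_real s * w)) (v \<tau>) :: real^'n) \<le> (K * s ^ 5) * MV * MR"
      using R2[OF in_ball(1)[OF s], of \<tau>] cm MV(2)[OF \<tau>'] MV(1) MR(1) K s
      by (intro order_trans[OF MR(2)] mult_mono) auto
    also have "\<dots> \<le> (K * s ^ 4) * MV * MR"
      using K s in_ball(3)[OF s] MV(1) MR(1) by (intro mult_right_mono mult_left_mono power_decreasing) auto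
    finally have "norm (rpair (R2 \<tau> (of_real s * w)) (v \<tau>) :: real^'n) / s ^ 3 \<le> (K * s ^ 4) * MV * MR / s ^ 3"
      using s by (intro divide_right_mono) auto
    also have "\<dots> = (K * MV * MR) * s"
      using s by (simp add: power3_eq_cube power4_eq_xxxx)
    finally show "norm (e6 s \<tau>) \<le> (K * MV * MR) * s" using s by (simp add: e6_def)
  qed
  \<comment> \<open>A product of a bounded factor, \<open>Z s \<tau> / s ^ 3\<close>, and one that
    tends to 0: the derivative of \<open>H\<close> in a \<xi>-direction is uniformly continuous on a
    compact set and vanishes at \<xi> = 0.\<close>
  have l7: "uniform_limit {0<..<T} e7 (\<lambda>_. 0) (at_right 0)"
  proof -
    have ub: "uniform_limit {0<..<T} (\<lambda>s \<tau>. dH (0, b) (\<tau>, of_real s * w)) (\<lambda>_. 0) (at_right 0)" if b: "cmod b = 1" for b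
    proof (rule uniform_limitI)
      fix e :: real assume e: "e > 0"
      have "uniformly_continuous_on ({0..T} \<times> cball 0 (\<delta> / 2)) (dH (0, b))"
        by (rule compact_uniformly_continuous[OF cdH comp])
      then obtain \<eta> where \<eta>: "\<eta> > 0" "\<And>p q. p \<in> {0..T} \<times> cball 0 (\<delta> / 2) \<Longrightarrow> q \<in> {0..T} \<times> cball 0 (\<delta> / 2) \<Longrightarrow>
         dist q p < \<eta> \<Longrightarrow> dist (dH (0, b) q) (dH (0, b) p) < e"
        unfolding uniformly_continuous_on_def using e by metis
      show "\<forall>\<^sub>F s in at_right 0. \<forall>\<tau>\<in>{0<..<T}. dist (dH (0, b) (\<tau>, of_real s * w)) 0 < e"
        unfolding eventually_at_right_field
      proof (intro exI[of _ "min s0 \<eta>"] conjI allI impI ballI)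
        show "0 < min s0 \<eta>" using s0 \<eta> by simp
        fix s \<tau> assume s: "0 < s" "s < min s0 \<eta>" and \<tau>: "\<tau> \<in> {0<..<T}"
        have "dist (dH (0, b) (\<tau>, of_real s * w)) (dH (0, b) (\<tau>, 0)) < e"
          using in_ball[of s] s \<tau> w \<delta> by (intro \<eta>(2)) (auto simp: dist_Pair_Pair norm_mult)
        then show "dist (dH (0, b) (\<tau>, of_real s * w)) 0 < e" by (simp add: dH_zero[OF b])
      qed
    qed
    have qb: "\<bar>Re (Z s \<tau>) / s ^ 3\<bar> \<le> cmod c + cmod d + K" "\<bar>Im (Z s \<tau>) / s ^ 3\<bar> \<le> cmod c + cmod d + K"
      if s: "0 < s" "s < s0" for s \<tau>
    proof -
      have cm: "cmod (of_real s * w) = s" using s w by (simp add: norm_mult)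
      have "K * s ^ 5 \<le> K * s ^ 3" using K s in_ball(3)[OF s] by (intro mult_left_mono power_decreasing) auto
      then have "cmod (Z s \<tau>) \<le> cmod (c * (of_real s * w) * of_real ((cmod (of_real s * w))\<^sup>2)) + cmod (d * cnj (of_real s * w) ^ 3) + K * s ^ 3"
        unfolding Z_def using R2[OF in_ball(1)[OF s], of \<tau>] cm
        by (intro order_trans[OF norm_triangle_ineq] add_mono norm_triangle_ineq) auto
      also have "\<dots> = (cmod c + cmod d + K) * s ^ 3"
        unfolding norm_mult norm_power using s w by (simp add: norm_mult algebra_simps power2_eq_square power3_eq_cube)
      finally have "cmod (Z s \<tau>) / s ^ 3 \<le> cmod c + cmod d + K" using s by (simp add: divide_le_eq)
      moreover have "\<bar>Re (Z s \<tau>) / s ^ 3\<bar> \<le> cmod (Z s \<tau>) / s ^ 3" "\<bar>Im (Z s \<tau>) / s ^ 3\<bar> \<le> cmod (Z s \<tau>) / s ^ 3"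
        using s abs_Re_le_cmod[of "Z s \<tau>"] abs_Im_le_cmod[of "Z s \<tau>"] by (simp_all add: abs_divide divide_right_mono)
      ultimately show "\<bar>Re (Z s \<tau>) / s ^ 3\<bar> \<le> cmod c + cmod d + K" "\<bar>Im (Z s \<tau>) / s ^ 3\<bar> \<le> cmod c + cmod d + K" by linarith+
    qed
    define Q where "Q = cmod c + cmod d + K"
    have Q: "Q \<ge> 0" using K by (simp add: Q_def)
    \<comment> \<open>The direction \<open>Z s \<tau>\<close> moves with \<open>s\<close> and
      \<tau>, whereas \<open>ub\<close> treats fixed directions; real linearity splits it along 1
      and the imaginary unit.\<close>
    have bound: "norm (e7 s \<tau>) \<le> Q * norm (dH (0, 1) (\<tau>, of_real s * w)) + Q * norm (dH (0, \<i>) (\<tau>, of_real s * w))"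
      if s: "0 < s" "s < s0" for s \<tau>
    proof -
      interpret L: bounded_linear "\<lambda>b. dH b (\<tau>, of_real s * w)"
        using dH_derivative[OF in_ball(1)[OF s], of \<tau>] by (rule has_derivative_bounded_linear)
      have "(0, Z s \<tau>) = Re (Z s \<tau>) *\<^sub>R (0, 1) + Im (Z s \<tau>) *\<^sub>R (0 :: real, \<i>)"
        by (simp add: complex_eq_iff)
      then have "e7 s \<tau> = (Re (Z s \<tau>) / s ^ 3) *\<^sub>R dH (0, 1) (\<tau>, of_real s * w) + (Im (Z s \<tau>) / s ^ 3) *\<^sub>R dH (0, \<i>) (\<tau>, of_real s * w)"
        unfolding e7_def by (simp only: L.add L.scaleR) (simp add: scaleR_add_right)
      also have "norm \<dots> \<le> \<bar>Re (Z s \<tau>) / s ^ 3\<bar> * norm (dH (0, 1) (\<tau>, of_real s * w)) + \<bar>Im (Z s \<tau>) / s ^ 3\<bar> * norm (dH (0, \<i>) (\<tau>, of_real s * w))"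
        by (intro order_trans[OF norm_triangle_ineq]) simp
      also have "\<dots> \<le> Q * norm (dH (0, 1) (\<tau>, of_real s * w)) + Q * norm (dH (0, \<i>) (\<tau>, of_real s * w))"
        unfolding Q_def by (intro add_mono mult_right_mono qb s norm_ge_zero)
      finally show ?thesis .
    qed
    show ?thesis
    proof (rule uniform_limitI)
      fix e :: real assume e: "e > 0"
      then have e': "e / (2 * Q + 1) > 0" using Q by simp
      have ev: "\<forall>\<^sub>F s in at_right 0. s \<in> {0<..<s0}" by (rule eventually_at_right_real[OF s0])
      show "\<forall>\<^sub>F s in at_right 0. \<forall>\<tau>\<in>{0<..<T}. dist (e7 s \<tau>) 0 < e"
        using uniform_limitD[OF ub[OF norm_one] e'] uniform_limitD[OF ub[OF norm_ii] e'] ev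
      proof eventually_elim
        case (elim s)
        show ?case
        proof
          fix \<tau> assume \<tau>: "\<tau> \<in> {0<..<T}"
          have "norm (e7 s \<tau>) \<le> Q * norm (dH (0, 1) (\<tau>, of_real s * w)) + Q * norm (dH (0, \<i>) (\<tau>, of_real s * w))"
            using elim by (intro bound) auto
          also have "\<dots> \<le> Q * (e / (2 * Q + 1)) + Q * (e / (2 * Q + 1))"
            using elim \<tau> Q by (intro add_mono mult_left_mono) (auto intro: less_imp_le)
          also have "\<dots> = (2 * Q) * e / (2 * Q + 1)" by simp
          also have "\<dots> < e" using Q e by (simp add: pos_divide_less_eq)
          finally show "dist (e7 s \<tau>) 0 < e" by simp
        qed
      qed
    qed
  qed
  let ?e = "\<lambda>s \<tau>. e1 s \<tau> + e2 s \<tau> + e3 s \<tau> + e4 s \<tau> - e5 s \<tau> - e6 s \<tau> - e7 s \<tau>"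
  have "uniform_limit {0<..<T} ?e
      (\<lambda>\<tau>. 0 + 0 + 0 + 0 - 0 - 0 - 0) (at_right 0)"
    by (intro uniform_limit_add uniform_limit_minus l1 l2 l3 l4 l5 l6 l7)
  then have "uniform_limit {0<..<T} ?e
      (\<lambda>_. 0) (at_right 0)" by simp
  moreover have cong: "\<forall>\<^sub>F s in at_right 0. \<forall>\<tau>\<in>{0<..<T}.
     ?e s \<tau> =
     (1 / s ^ 3) *\<^sub>R ((1 + \<alpha>1 * s\<^sup>2) *\<^sub>R dH (1, 0) (\<tau>, of_real s * w) - s\<^sup>2 *\<^sub>R G2 w \<tau> - s ^ 3 *\<^sub>R G3 w \<tau>)"
    using eventually_at_right_real[OF s0]
  proof eventually_elim
    case (elim s)
    then show ?case using decomp[of s] by auto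
  qed
  moreover note uniform_limit_cong[OF cong, of "\<lambda>_. 0" "\<lambda>_. 0"]
  ultimately show ?thesis by blast
qed

end

section \<open>Linear equations for the homogeneous parts\<close>

context center_manifold
begin

text \<open>A single limit yields both equations: divided by \<open>s ^ 3\<close>, the increment of
  \<open>\<Psi> s\<close> over \<open>{0..t}\<close> is \<open>D2 / s + D3\<close> up to terms that
  vanish, and the two summands are of different order.\<close>

lemma homogeneous_parts_eq_integral:
  assumes w: "cmod w = 1" and t: "0 < t" "t \<le> T"
  shows "Q2 w t - Q2 w 0 = integral {0..t} (G2 w)" "Q3 w t - Q3 w 0 = integral {0..t} (G3 w)"
proof -
  define J2 where "J2 \<tau> = integral {0..\<tau>} (G2 w)" for \<tau>
  define J3 where "J3 \<tau> = integral {0..\<tau>} (G3 w)" for \<tau>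
  define D2 where "D2 = Q2 w t - Q2 w 0 - J2 t"
  define D3 where "D3 = Q3 w t - Q3 w 0 - J3 t"
  define \<Psi> where "\<Psi> s \<tau> = (1 + \<alpha>1 * s\<^sup>2) *\<^sub>R H \<tau> (of_real s * w) - s\<^sup>2 *\<^sub>R J2 \<tau> - s ^ 3 *\<^sub>R J3 \<tau>" for s \<tau>
  define \<rho> where "\<rho> s \<tau> = H \<tau> (of_real s * w) - (s\<^sup>2 *\<^sub>R Q2 w \<tau> + s ^ 3 *\<^sub>R Q3 w \<tau>)" for s \<tau>
  let ?rem = "\<lambda>s \<tau>. (1 / s ^ 3) *\<^sub>R ((1 + \<alpha>1 * s\<^sup>2) *\<^sub>R dH (1, 0) (\<tau>, of_real s * w)
    - s\<^sup>2 *\<^sub>R G2 w \<tau> - s ^ 3 *\<^sub>R G3 w \<tau>)"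
  have J0: "J2 0 = 0" "J3 0 = 0" by (simp_all add: J2_def J3_def)
  have dJ: "(J2 has_vector_derivative G2 w \<tau>) (at \<tau> within {0..T})"
    "(J3 has_vector_derivative G3 w \<tau>) (at \<tau> within {0..T})" if "\<tau> \<in> {0..T}" for \<tau>
    unfolding J2_def[abs_def] J3_def[abs_def]
    using that by (auto intro!: integral_has_vector_derivative continuous_G2 continuous_G3 w)
  have cJ: "continuous_on {0..t} J2" "continuous_on {0..t} J3"
    using t has_vector_derivative_continuous[OF dJ(1)] has_vector_derivative_continuous[OF dJ(2)]
    by (auto simp: continuous_on_eq_continuous_within intro!: continuous_within_subset[of _ "{0..T}" _ "{0..t}"])
  have d\<Psi>: "(\<Psi> s has_derivative (\<lambda>h. h *\<^sub>R (s ^ 3 *\<^sub>R ?rem s \<tau>))) (at \<tau>)"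
    if s: "0 < s" "s < \<delta>" and \<tau>: "0 < \<tau>" "\<tau> < t" for s \<tau>
  proof -
    have ball: "of_real s * w \<in> ball 0 \<delta>" using s w by (simp add: norm_mult)
    have "((\<lambda>r. (\<lambda>(\<tau>, \<xi>). H \<tau> \<xi>) ((0, of_real s * w) + r *\<^sub>R (1, 0))) has_vector_derivative
      dH (1, 0) ((0, of_real s * w) + \<tau> *\<^sub>R (1, 0))) (at \<tau>)"
      by (intro has_vector_derivative_line Ck_on_1D(1)[OF H]) (use ball in simp)
    then have 1: "((\<lambda>r. H r (of_real s * w)) has_vector_derivative dH (1, 0) (\<tau>, of_real s * w)) (at \<tau>)"
      by simp
    have "at \<tau> within {0..T} = at \<tau>" using \<tau> t by (intro at_within_Icc_at) auto
    then have 2: "(J2 has_vector_derivative G2 w \<tau>) (at \<tau>)" "(J3 has_vector_derivative G3 w \<tau>) (at \<tau>)"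
      using dJ[of \<tau>] \<tau> t by auto
    have "(\<Psi> s has_vector_derivative ((1 + \<alpha>1 * s\<^sup>2) *\<^sub>R dH (1, 0) (\<tau>, of_real s * w)
       - s\<^sup>2 *\<^sub>R G2 w \<tau> - s ^ 3 *\<^sub>R G3 w \<tau>)) (at \<tau>)"
      unfolding \<Psi>_def[abs_def]
      by (intro has_vector_derivative_diff bounded_linear.has_vector_derivative[OF bounded_linear_scaleR_right] 1 2)
    then show ?thesis unfolding has_vector_derivative_def using s by simp
  qed
  have lim1: "((\<lambda>s. (1 / s ^ 3) *\<^sub>R (\<Psi> s t - \<Psi> s 0)) \<longlongrightarrow> 0) (at_right 0)"
  proof (rule tendstoI)
    fix e :: real assume e: "e > 0"
    then have e': "e / t > 0" using t by simp
    show "\<forall>\<^sub>F s in at_right 0. dist ((1 / s ^ 3) *\<^sub>R (\<Psi> s t - \<Psi> s 0)) 0 < e"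
      using uniform_limitD[OF remainder_uniform[OF w] e'] eventually_at_right_real[OF \<delta>]
    proof eventually_elim
      case (elim s)
      have c: "continuous_on {0..t} (\<Psi> s)" unfolding \<Psi>_def[abs_def]
        using elim w by (intro continuous_intros cJ continuous_H) (auto simp: norm_mult)
      \<comment> \<open>This mean value theorem asks for derivatives in the open interval only,
        which is where the remainder estimate is available; at the ends continuity of
        \<open>\<Psi> s\<close> is enough.\<close>
      obtain x where x: "0 < x" "x < t" "norm (\<Psi> s t - \<Psi> s 0) \<le> norm ((t - 0) *\<^sub>R (s ^ 3 *\<^sub>R ?rem s x))"
        using mvt_general[OF t(1) c d\<Psi>[of s]] elim by auto
      then have "norm (\<Psi> s t - \<Psi> s 0) \<le> t * (s ^ 3 * norm (?rem s x))"
        using t elim by (simp only: norm_scaleR) simp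
      also have "\<dots> < t * (s ^ 3 * (e / t))"
        using elim x t by (intro mult_strict_left_mono) (auto simp: dist_norm)
      also have "\<dots> = s ^ 3 * e" using t by simp
      finally show ?case using elim by (simp add: divide_less_eq mult.commute)
    qed
  qed
  have lim2: "((\<lambda>s. (1 / s ^ 3) *\<^sub>R (\<rho> s \<tau>)) \<longlongrightarrow> 0) (at_right 0)" for \<tau>
  proof (rule Lim_null_comparison)
    show "((\<lambda>s. K * s) \<longlongrightarrow> 0) (at_right 0)" by (auto intro!: tendsto_eq_intros)
    show "\<forall>\<^sub>F s in at_right 0. norm ((1 / s ^ 3) *\<^sub>R (\<rho> s \<tau>)) \<le> K * s"
      using eventually_at_right_real[OF \<delta>]
    proof eventually_elim
      case (elim s)
      then have "norm (\<rho> s \<tau>) \<le> K * s ^ 4" unfolding \<rho>_def by (intro H_radial[OF w]) auto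
      then show ?case using elim by (simp add: divide_le_eq power4_eq_xxxx power3_eq_cube mult_ac)
    qed
  qed
  have lim3: "((\<lambda>s. (1 / s) *\<^sub>R H \<tau> (of_real s * w)) \<longlongrightarrow> 0) (at_right 0)" for \<tau>
  proof (rule Lim_null_comparison)
    show "((\<lambda>s. s * (norm (Q2 w \<tau>) + s * norm (Q3 w \<tau>) + K * s\<^sup>2)) \<longlongrightarrow> 0) (at_right 0)"
      by (auto intro!: tendsto_eq_intros)
    show "\<forall>\<^sub>F s in at_right 0. norm ((1 / s) *\<^sub>R H \<tau> (of_real s * w)) \<le> s * (norm (Q2 w \<tau>) + s * norm (Q3 w \<tau>) + K * s\<^sup>2)"
      using eventually_at_right_real[OF \<delta>]
      by eventually_elim (use norm_H_radial_div[OF w] in auto)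
  qed
  have lim: "((\<lambda>s. (1 / s) *\<^sub>R D2 + D3) \<longlongrightarrow> 0) (at_right 0)"
  proof -
    let ?f = "\<lambda>s. (1 / s ^ 3) *\<^sub>R (\<Psi> s t - \<Psi> s 0) - ((1 / s ^ 3) *\<^sub>R \<rho> s t - (1 / s ^ 3) *\<^sub>R \<rho> s 0)
       - \<alpha>1 *\<^sub>R ((1 / s) *\<^sub>R H t (of_real s * w) - (1 / s) *\<^sub>R H 0 (of_real s * w))"
    have "(?f \<longlongrightarrow> 0 - (0 - 0) - \<alpha>1 *\<^sub>R (0 - 0)) (at_right 0)"
      by (intro tendsto_diff tendsto_scaleR tendsto_const lim1 lim2 lim3)
    then have "(?f \<longlongrightarrow> 0) (at_right 0)"
      by simp
    then show ?thesis
    proof (rule Lim_transform_eventually)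
      show "\<forall>\<^sub>F s in at_right 0. ?f s = (1 / s) *\<^sub>R D2 + D3"
        using eventually_at_right_less[of 0]
      proof eventually_elim
        case (elim s)
        have s: "s\<^sup>2 / s ^ 3 = 1 / s" "s ^ 3 / s ^ 3 = 1" using elim by (auto simp: power2_eq_square power3_eq_cube)
        \<comment> \<open>The term with \<open>\<alpha>1 * s\<^sup>2\<close> becomes
          \<open>\<alpha>1 / s\<close> times an increment of \<open>H\<close> after the division,
          and \<open>lim3\<close> removes it.\<close>
        have "\<Psi> s t - \<Psi> s 0 = (\<rho> s t - \<rho> s 0) + (\<alpha>1 * s\<^sup>2) *\<^sub>R (H t (of_real s * w) - H 0 (of_real s * w)) + s\<^sup>2 *\<^sub>R D2 + s ^ 3 *\<^sub>R D3"
          by (simp add: \<Psi>_def \<rho>_def D2_def D3_def J0 algebra_simps)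
        then have "(1 / s ^ 3) *\<^sub>R (\<Psi> s t - \<Psi> s 0) = (1 / s ^ 3) *\<^sub>R (\<rho> s t - \<rho> s 0) + (\<alpha>1 * (s\<^sup>2 / s ^ 3)) *\<^sub>R (H t (of_real s * w) - H 0 (of_real s * w))
            + (s\<^sup>2 / s ^ 3) *\<^sub>R D2 + (s ^ 3 / s ^ 3) *\<^sub>R D3"
          by (simp only: scaleR_add_right scaleR_scaleR) simp
        then show ?case unfolding s by (simp add: algebra_simps)
      qed
    qed
  qed
  \<comment> \<open>Multiplication by \<open>s\<close> isolates \<open>D2\<close>; once
    \<open>D2 = 0\<close>, the original limit reads \<open>D3 = 0\<close>.\<close>
  have "((\<lambda>s. s *\<^sub>R ((1 / s) *\<^sub>R D2 + D3)) \<longlongrightarrow> 0 *\<^sub>R 0) (at_right 0)"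
    by (intro tendsto_scaleR lim tendsto_ident_at)
  moreover have "\<forall>\<^sub>F s in at_right 0. s *\<^sub>R ((1 / s) *\<^sub>R D2 + D3) = D2 + s *\<^sub>R D3"
    by (auto simp: eventually_at_filter scaleR_add_right)
  ultimately have "((\<lambda>s. D2 + s *\<^sub>R D3) \<longlongrightarrow> 0) (at_right 0)"
    using Lim_transform_eventually by fastforce
  moreover have "((\<lambda>s. D2 + s *\<^sub>R D3) \<longlongrightarrow> D2 + 0 *\<^sub>R D3) (at_right 0)"
    by (intro tendsto_intros)
  ultimately have "D2 = 0"
    using tendsto_unique[OF trivial_limit_at_right_real] by fastforce
  with lim have "((\<lambda>s::real. D3) \<longlongrightarrow> 0) (at_right 0)" by simp
  then have "D3 = 0" by (simp add: tendsto_const_iff)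
  show "Q2 w t - Q2 w 0 = integral {0..t} (G2 w)" "Q3 w t - Q3 w 0 = integral {0..t} (G3 w)"
    using \<open>D2 = 0\<close> \<open>D3 = 0\<close> by (simp_all add: D2_def D3_def J2_def J3_def)
qed

text \<open>Differentiability is gained here: \<open>Q2 w\<close> and \<open>Q3 w\<close> are
  integrals of continuous functions up to a constant, and the fundamental theorem of calculus
  applies.\<close>

lemma homogeneous_parts_ode:
  assumes w: "cmod w = 1" and t: "t \<in> {0..T}"
  shows "(Q2 w has_vector_derivative G2 w t) (at t within {0..T})"
    and "(Q3 w has_vector_derivative G3 w t) (at t within {0..T})"
proof -
  have eq: "Q2 w 0 + integral {0..\<tau>} (G2 w) = Q2 w \<tau>" "Q3 w 0 + integral {0..\<tau>} (G3 w) = Q3 w \<tau>"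
    if "\<tau> \<in> {0..T}" for \<tau>
    using homogeneous_parts_eq_integral[OF w, of \<tau>, symmetric] that by (cases "\<tau> = 0", auto)+
  have "((\<lambda>\<tau>. Q2 w 0 + integral {0..\<tau>} (G2 w)) has_vector_derivative 0 + G2 w t) (at t within {0..T})"
    by (intro has_vector_derivative_add has_vector_derivative_const integral_has_vector_derivative continuous_G2 w t)
  then show "(Q2 w has_vector_derivative G2 w t) (at t within {0..T})"
    using t by (auto intro: has_vector_derivative_transform[OF _ eq(1)[symmetric]])
  have "((\<lambda>\<tau>. Q3 w 0 + integral {0..\<tau>} (G3 w)) has_vector_derivative 0 + G3 w t) (at t within {0..T})"
    by (intro has_vector_derivative_add has_vector_derivative_const integral_has_vector_derivative continuous_G3 w t)
  then show "(Q3 w has_vector_derivative G3 w t) (at t within {0..T})"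
    using t by (auto intro: has_vector_derivative_transform[OF _ eq(2)[symmetric]])
qed

end

section \<open>Linear periodic systems\<close>

text \<open>A Gronwall argument: the squared norm of \<open>y\<close> times
  \<open>exp (- (2 * L) * t)\<close> does not increase, starts at 0 and is nonnegative.\<close>

lemma linear_growth_ode_zero:
  fixes y :: "real \<Rightarrow> 'a::real_inner"
  assumes y: "\<And>\<tau>. \<tau> \<in> {0..T} \<Longrightarrow> (y has_vector_derivative y' \<tau>) (at \<tau> within {0..T})"
    and le: "\<And>\<tau>. \<tau> \<in> {0..T} \<Longrightarrow> norm (y' \<tau>) \<le> L * norm (y \<tau>)"
    and y0: "y 0 = 0" and \<tau>: "\<tau> \<in> {0..T}"
  shows "y \<tau> = 0"
proof -
  define g where "g t = (y t \<bullet> y t) * exp (- (2 * L) * t)" for t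
  have cy: "continuous_on {0..\<tau>} y"
    using has_vector_derivative_continuous[OF y] \<tau>
    by (auto simp: continuous_on_eq_continuous_within intro!: continuous_within_subset[of _ "{0..T}" _ "{0..\<tau>}"])
  have "g \<tau> \<le> g 0"
  proof (rule DERIV_nonpos_imp_decreasing_open[of 0 \<tau> g])
    show "0 \<le> \<tau>" using \<tau> by simp
    show "continuous_on {0..\<tau>} g" unfolding g_def[abs_def] by (intro continuous_intros cy)
    fix t assume t: "0 < t" "t < \<tau>"
    have "at t within {0..T} = at t" using t \<tau> by (intro at_within_Icc_at) auto
    then have "(y has_vector_derivative y' t) (at t)" using y[of t] t \<tau> by auto
    from bounded_bilinear.has_vector_derivative[OF bounded_bilinear_inner this this]
    have "((\<lambda>t. y t \<bullet> y t) has_real_derivative 2 * (y t \<bullet> y' t)) (at t)"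
      by (simp add: has_real_derivative_iff_has_vector_derivative inner_commute)
    then have "(g has_real_derivative (2 * (y t \<bullet> y' t)) * exp (- (2 * L) * t) + (y t \<bullet> y t) * (exp (- (2 * L) * t) * (- (2 * L)))) (at t)"
      unfolding g_def[abs_def] by (auto intro!: derivative_eq_intros)
    moreover have "y t \<bullet> y' t \<le> L * (y t \<bullet> y t)"
    proof -
      have "y t \<bullet> y' t \<le> norm (y t) * norm (y' t)" by (rule norm_cauchy_schwarz)
      also have "\<dots> \<le> norm (y t) * (L * norm (y t))" using le[of t] t \<tau> by (intro mult_left_mono) auto
      finally show ?thesis by (simp add: dot_square_norm power2_eq_square mult_ac)
    qed
    then have "(y t \<bullet> y' t) * exp (- (2 * L) * t) \<le> L * (y t \<bullet> y t) * exp (- (2 * L) * t)"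
      by (rule mult_right_mono) simp
    ultimately show "\<exists>z. (g has_real_derivative z) (at t) \<and> z \<le> 0"
      by (intro exI[of _ "(2 * (y t \<bullet> y' t)) * exp (- (2 * L) * t) + (y t \<bullet> y t) * (exp (- (2 * L) * t) * (- (2 * L)))"])
        (auto simp: algebra_simps)
  qed
  then have "y \<tau> \<bullet> y \<tau> \<le> 0"
    by (simp add: g_def y0 mult_le_0_iff)
  then show ?thesis by (metis inner_ge_zero inner_eq_zero_iff order_antisym)
qed

lemma cmat_mult: "cmat (M ** N) = cmat M ** cmat N"
  by (simp add: vec_eq_iff matrix_matrix_mult_def map_matrix_def)

lemma cmat_mult_cvec: "cmat M *v cvec x = cvec (M *v x)"
  by (simp add: vec_eq_iff matrix_vector_mult_def cvec_def map_matrix_def)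

lemma bounded_linear_cmat_mult: "bounded_linear (\<lambda>M. cmat M *v x)"
  unfolding linear_conv_bounded_linear[symmetric]
  by (rule linearI) (simp_all add: vec_eq_iff matrix_vector_mult_def map_matrix_def algebra_simps sum.distrib scaleR_sum_right
      scaleR_conv_of_real[where 'a=complex] sum_distrib_left)

lemma norm_cmat_mult_le:
  fixes M :: "real^'n^'m"
  assumes "\<And>i j. \<bar>M $ i $ j\<bar> \<le> B"
  shows "norm (cmat M *v x) \<le> (real (CARD('m)) * (real (CARD('n)) * B)) * norm x"
proof -
  have "norm (cmat M *v x) \<le> (\<Sum>i\<in>UNIV. norm ((cmat M *v x) $ i))"
    unfolding norm_vec_def by (rule L2_set_le_sum) simp
  also have "\<dots> \<le> (\<Sum>i\<in>(UNIV::'m set). \<Sum>j\<in>(UNIV::'n set). B * norm x)"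
  proof (rule sum_mono)
    fix i
    have "norm ((cmat M *v x) $ i) \<le> (\<Sum>j\<in>UNIV. norm (complex_of_real (M $ i $ j) * x $ j))"
      by (simp add: matrix_vector_mult_def map_matrix_def norm_sum)
    also have "\<dots> \<le> (\<Sum>j\<in>(UNIV::'n set). B * norm x)"
      unfolding norm_mult norm_of_real
      using assms order_trans[OF abs_ge_zero assms] Finite_Cartesian_Product.norm_nth_le[of x]
      by (intro sum_mono mult_mono) auto
    finally show "norm ((cmat M *v x) $ i) \<le> (\<Sum>j\<in>(UNIV::'n set). B * norm x)" .
  qed
  finally show ?thesis by (simp add: mult_ac)
qed

text \<open>The difference of both sides solves the same linear equation with initial value 0.
  Boundary conditions at \<open>T\<close> thereby turn into eigenvector equations for
  \<open>cmat (Y T)\<close>.\<close>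

lemma linear_ode_eq_fundamental:
  fixes Y :: "real \<Rightarrow> real^'n^'n"
  assumes Y: "fundamental_solution F u0 Y"
    and B: "\<And>\<tau> i j. \<tau> \<in> {0..T} \<Longrightarrow> \<bar>Amat F u0 \<tau> $ i $ j\<bar> \<le> B"
    and y: "\<And>\<tau>. \<tau> \<in> {0..T} \<Longrightarrow> (y has_vector_derivative cmat (Amat F u0 \<tau>) *v y \<tau>) (at \<tau> within {0..T})"
    and \<tau>: "\<tau> \<in> {0..T}"
  shows "y \<tau> = cmat (Y \<tau>) *v y 0"
proof -
  have dY: "(Y has_vector_derivative Amat F u0 t ** Y t) (at t within {0..T})" and Y0: "Y 0 = mat 1" for t
    using Y by (auto simp: fundamental_solution_def intro: has_vector_derivative_at_within)
  have "y \<tau> - cmat (Y \<tau>) *v y 0 = 0"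
  proof (rule linear_growth_ode_zero[where y = "\<lambda>t. y t - cmat (Y t) *v y 0" and T = T
        and y' = "\<lambda>t. cmat (Amat F u0 t) *v (y t - cmat (Y t) *v y 0)"])
    fix t assume t: "t \<in> {0..T}"
    have "((\<lambda>t. cmat (Y t) *v y 0) has_vector_derivative cmat (Amat F u0 t ** Y t) *v y 0) (at t within {0..T})"
      by (rule bounded_linear.has_vector_derivative[OF bounded_linear_cmat_mult dY])
    from has_vector_derivative_diff[OF y[OF t] this]
    show "((\<lambda>t. y t - cmat (Y t) *v y 0) has_vector_derivative
        cmat (Amat F u0 t) *v (y t - cmat (Y t) *v y 0)) (at t within {0..T})"
      by (simp add: cmat_mult matrix_vector_mul_assoc matrix_vector_mult_diff_distrib)
    show "norm (cmat (Amat F u0 t) *v (y t - cmat (Y t) *v y 0)) \<le>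
      (real (CARD('n)) * (real (CARD('n)) * B)) * norm (y t - cmat (Y t) *v y 0)"
      by (rule norm_cmat_mult_le[OF B[OF t]])
  next
    have "cmat (mat 1 :: real^'n^'n) = mat 1" by (simp add: vec_eq_iff map_matrix_def mat_def)
    then show "y 0 - cmat (Y 0) *v y 0 = 0" by (simp add: Y0)
  qed (rule \<tau>)
  then show ?thesis by simp
qed

section \<open>Characteristic polynomial and simple eigenvalues\<close>

lemma sum_const_poly: "(\<Sum>i\<in>X. [:f i:]) = [:\<Sum>i\<in>X. f i:]"
  by (induction X rule: infinite_finite_induct) auto


text \<open>The polynomial evaluated at \<open>\<nu>\<close> is the determinant of
  \<open>\<nu>\<close> times the identity minus \<open>M\<close>. The root order speaks about
  divisibility only for nonzero polynomials; the later choice of \<open>\<nu>\<close> is -1.\<close>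

lemma charpoly_nonzero:
  assumes "\<not> eigenvalue_of M \<nu>"
  shows "charpoly M \<noteq> 0"
proof
  let ?N = "\<chi> i j. (if i = j then \<nu> else 0) - M $ i $ j"
  assume 0: "charpoly M = 0"
  have "poly (charpoly M) \<nu> = det ?N"
    unfolding charpoly_def det_def
    by (simp add: poly_sum poly_prod if_distrib[of "\<lambda>p. poly p \<nu>"] cong: if_cong)
  with 0 have "det ?N = 0" by simp
  then have "\<not> invertible ?N" by (simp add: invertible_det_nz)
  then obtain x where x: "x \<noteq> 0" "?N *v x = 0"
    using matrix_left_invertible_ker[of ?N] by (auto simp: invertible_left_inverse)
  have "(?N *v x) $ i = \<nu> * x $ i - (M *v x) $ i" for i
    by (simp add: matrix_vector_mult_def left_diff_distrib sum_subtractf if_distrib[of "\<lambda>a. a * _"] cong: if_cong)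
  then have "M *v x = \<nu> *s x" using x(2) by (auto simp: vec_eq_iff)
  with x(1) assms show False by (auto simp: eigenvalue_of_def)
qed

text \<open>Each of the two columns releases one factor \<open>q\<close>. The passage to the
  transpose is due to \<open>det_row_mul\<close>, which speaks about rows.\<close>

lemma det_column_factor:
  fixes N :: "'a::comm_ring_1^'n^'n"
  assumes "i \<noteq> j" "\<And>r. N $ r $ i = q * a r" "\<And>r. N $ r $ j = q * b r"
  shows "q ^ 2 dvd det N"
proof -
  let ?R = "\<lambda>k. if k = i then (\<chi> r. a r) else if k = j then (\<chi> r. b r) else transpose N $ k"
  have "transpose N = (\<chi> k. if k = i then q *s (\<chi> r. a r) else transpose N $ k)"
    using assms by (simp add: vec_eq_iff transpose_def)
  then have "det (transpose N) = q * det (\<chi> k. if k = i then (\<chi> r. a r) else transpose N $ k)"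
    using det_row_mul[of i q "\<lambda>_. \<chi> r. a r" "\<lambda>k. transpose N $ k"] by simp
  also have "(\<chi> k. if k = i then (\<chi> r. a r) else transpose N $ k) = (\<chi> k. if k = j then q *s (\<chi> r. b r) else ?R k)"
    using assms by (simp add: vec_eq_iff transpose_def)
  also have "det \<dots> = q * det (\<chi> k. if k = j then (\<chi> r. b r) else ?R k)"
    by (rule det_row_mul)
  finally have "det N = q ^ 2 * det (\<chi> k. if k = j then (\<chi> r. b r) else ?R k)"
    by (simp add: det_transpose power2_eq_square mult.assoc)
  then show ?thesis by (rule dvdI)
qed

text \<open>Geometric multiplicity is at most the algebraic one. Two independent eigenvectors,
  placed in two columns of an invertible constant matrix, give the product of the characteristic
  matrix with it two columns divisible by \<open>[:-\<mu>, 1:]\<close>, hence a double root.\<close>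

lemma simple_eigenvalue_eigenvectors_parallel:
  fixes M :: "complex^'n^'n"
  assumes s: "simple_eigenvalue M \<mu>" and nz: "charpoly M \<noteq> 0"
    and x: "M *v x = \<mu> *s x" "x \<noteq> 0" and z: "M *v z = \<mu> *s z"
  shows "\<exists>k. z = k *s x"
proof (rule ccontr)
  assume not: "\<nexists>k. z = k *s x"
  obtain i where i: "x $ i \<noteq> 0" using x(2) by (auto simp: vec_eq_iff)
  \<comment> \<open>Elimination of coordinate \<open>i\<close> from \<open>z\<close>. With
    \<open>x\<close> and \<open>y\<close> in columns \<open>i\<close> and \<open>j\<close> of the
    identity matrix, \<open>x $ i\<close> and \<open>y $ j\<close> act as pivots.\<close>
  define y where "y = z - (z $ i / x $ i) *s x"
  have yi: "y $ i = 0" using i by (simp add: y_def)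
  have "y \<noteq> 0" using not by (auto simp: y_def)
  then obtain j where j: "y $ j \<noteq> 0" by (auto simp: vec_eq_iff)
  have ij: "i \<noteq> j" using yi j by auto
  have My: "M *v y = \<mu> *s y"
    by (simp add: y_def matrix_vector_mult_diff_distrib vector_scalar_commute x z vector_ssub_ldistrib vector_smult_assoc mult.commute)
  define P :: "complex^'n^'n" where
    "P = (\<chi> r k. if k = i then x $ r else if k = j then y $ r else if r = k then 1 else 0)"
  have Pv: "(P *v t) $ r = x $ r * t $ i + y $ r * t $ j + (if r = i \<or> r = j then 0 else t $ r)" for t r
  proof -
    have "(P *v t) $ r = (\<Sum>k\<in>UNIV. (if k = i then x $ r * t $ i else 0) + (if k = j then y $ r * t $ j else 0)
        + (if k = r then (if r = i \<or> r = j then 0 else t $ r) else 0))"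
      unfolding matrix_vector_mult_def P_def vec_lambda_beta by (rule sum.cong) (use ij in auto)
    then show ?thesis by (simp add: sum.distrib)
  qed
  \<comment> \<open>Row \<open>i\<close> contains only \<open>x $ i * t $ i\<close>; then row
    \<open>j\<close> determines \<open>t $ j\<close>, and the other rows give the rest.\<close>
  have "t = 0" if "P *v t = 0" for t
  proof -
    have P0: "x $ r * t $ i + y $ r * t $ j + (if r = i \<or> r = j then 0 else t $ r) = 0" for r
      using Pv[of t r] that by simp
    have ti: "t $ i = 0" using P0[of i] yi i by simp
    have tj: "t $ j = 0" using P0[of j] ti j by simp
    have "t $ r = 0" for r using P0[of r] ti tj by (auto split: if_splits)
    then show ?thesis by (simp add: vec_eq_iff)
  qed
  then obtain B where B: "P ** B = mat 1"
    using matrix_left_invertible_ker[of P] matrix_left_right_inverse by blast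
  define X where "X = (\<chi> i j. (if i = j then [:0, 1:] else 0) - [:M $ i $ j:])"
  define PP where "PP = (\<chi> r k. [:P $ r $ k:])"
  \<comment> \<open>The inverse of \<open>P\<close> lifts to constant polynomials, so
    \<open>det PP\<close> is a unit and does not affect divisibility.\<close>
  have det1: "det PP * det (\<chi> r k. [:B $ r $ k:]) = 1"
  proof -
    have "PP ** (\<chi> r k. [:B $ r $ k:]) = (\<chi> r k. [:(P ** B) $ r $ k:])"
      by (simp add: vec_eq_iff PP_def matrix_matrix_mult_def sum_const_poly mult.commute)
    also have "\<dots> = mat 1" by (simp add: B vec_eq_iff mat_def one_pCons)
    finally show ?thesis by (metis det_I det_mul)
  qed
  have col: "(X ** PP) $ r $ k = [:-\<mu>, 1:] * [:t $ r:]"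
    if t: "M *v t = \<mu> *s t" and k: "\<And>l. P $ l $ k = t $ l" for t r k
  proof -
    have "(X ** PP) $ r $ k = (\<Sum>l\<in>UNIV. (if l = r then [:0, 1:] * [:t $ r:] else 0) - [:M $ r $ l * t $ l:])"
      unfolding matrix_matrix_mult_def X_def PP_def by (simp add: k, intro sum.cong) (auto simp: left_diff_distrib)
    also have "\<dots> = [:0, 1:] * [:t $ r:] - [:(M *v t) $ r:]"
      by (simp add: sum_subtractf sum_const_poly matrix_vector_mult_def)
    also have "\<dots> = [:-\<mu>, 1:] * [:t $ r:]" by (simp add: t)
    finally show ?thesis .
  qed
  have "[:-\<mu>, 1:] ^ 2 dvd det (X ** PP)"
    by (rule det_column_factor[OF ij col[OF x(1)] col[OF My]]) (use ij in \<open>simp_all add: P_def\<close>)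
  then have "[:-\<mu>, 1:] ^ 2 dvd det X * det PP * det (\<chi> r k. [:B $ r $ k:])"
    by (simp add: det_mul)
  then have "[:-\<mu>, 1:] ^ 2 dvd charpoly M"
    using det1 by (simp add: mult.assoc charpoly_def X_def)
  then have "2 \<le> order \<mu> (charpoly M)" using nz order_divides by blast
  with s show False by (simp add: simple_eigenvalue_def)
qed

section \<open>Pairing with adjoint solutions\<close>

lemma bounded_bilinear_hinner: "bounded_bilinear (hinner :: complex^'n \<Rightarrow> complex^'n \<Rightarrow> complex)"
  unfolding bilinear_conv_bounded_bilinear[symmetric] bilinear_def
  by (intro conjI allI linearI) (simp_all add: hinner_def algebra_simps sum.distrib scaleR_sum_right)

lemma hinner_cmat_transpose: "hinner (cmat (transpose M) *v x) y = hinner x (cmat M *v y)"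
proof -
  have "hinner (cmat (transpose M) *v x) y = (\<Sum>i\<in>UNIV. \<Sum>j\<in>UNIV. complex_of_real (M $ j $ i) * cnj (x $ j) * y $ i)"
    by (simp add: hinner_def matrix_vector_mult_def map_matrix_def transpose_def sum_distrib_right)
  also have "\<dots> = (\<Sum>j\<in>UNIV. \<Sum>i\<in>UNIV. complex_of_real (M $ j $ i) * cnj (x $ j) * y $ i)"
    by (rule sum.swap)
  also have "\<dots> = hinner x (cmat M *v y)"
    by (simp add: hinner_def matrix_vector_mult_def map_matrix_def sum_distrib_left mult_ac)
  finally show ?thesis .
qed

text \<open>In the product rule for \<open>hinner (x \<tau>) (y \<tau>)\<close> the terms with
  \<open>A\<close> cancel between the equation and its adjoint. When \<open>x\<close> and
  \<open>y\<close> pick up the same unimodular factor over the period, the boundary term vanishes: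
  the solvability condition.\<close>

lemma has_integral_adjoint_pairing:
  assumes T: "T \<ge> 0"
    and x: "\<And>\<tau>. \<tau> \<in> {0..T} \<Longrightarrow> (x has_vector_derivative - (cmat (transpose (A \<tau>)) *v x \<tau>)) (at \<tau> within {0..T})"
    and y: "\<And>\<tau>. \<tau> \<in> {0..T} \<Longrightarrow> (y has_vector_derivative cmat (A \<tau>) *v y \<tau> + g \<tau>) (at \<tau> within {0..T})"
  shows "((\<lambda>\<tau>. hinner (x \<tau>) (g \<tau>)) has_integral hinner (x T) (y T) - hinner (x 0) (y 0)) {0..T}"
proof (rule fundamental_theorem_of_calculus[OF T])
  interpret bounded_bilinear "hinner :: complex^'n \<Rightarrow> complex^'n \<Rightarrow> complex"
    by (rule bounded_bilinear_hinner)
  fix \<tau> assume \<tau>: "\<tau> \<in> {0..T}"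
  have "hinner (x \<tau>) (cmat (A \<tau>) *v y \<tau> + g \<tau>) + hinner (- (cmat (transpose (A \<tau>)) *v x \<tau>)) (y \<tau>) = hinner (x \<tau>) (g \<tau>)"
    by (simp add: add_right minus_left hinner_cmat_transpose)
  then show "((\<lambda>\<tau>. hinner (x \<tau>) (y \<tau>)) has_vector_derivative hinner (x \<tau>) (g \<tau>)) (at \<tau> within {0..T})"
    using has_vector_derivative[OF x[OF \<tau>] y[OF \<tau>]] by simp
qed

section \<open>Separation of the coefficients\<close>

lemma cvec_rpair: "cvec (rpair z a) = z *s a + cnj z *s vcnj a"
  by (simp add: vec_eq_iff cvec_def rpair_def vcnj_def complex_eq_iff)

lemma cvec_add: "cvec (a + b) = cvec a + cvec b"
  and cvec_diff: "cvec (a - b) = cvec a - cvec b"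
  and cvec_scaleR: "cvec (r *\<^sub>R a) = of_real r *s cvec a"
  by (simp_all add: vec_eq_iff cvec_def)

lemma cvec_sum: "cvec (sum f X) = (\<Sum>i\<in>X. cvec (f i))"
  by (simp add: vec_eq_iff cvec_def)

lemma bounded_linear_cvec: "bounded_linear (cvec :: real^'n \<Rightarrow> complex^'n)"
  unfolding linear_conv_bounded_linear[symmetric]
  by (rule linearI) (simp_all add: vec_eq_iff cvec_def scaleR_conv_of_real[where 'a=complex])

lemma bounded_linear_vector_scalar_mult: "bounded_linear (\<lambda>a :: complex^'n. k *s a)"
  unfolding linear_conv_bounded_linear[symmetric]
  by (rule linearI) (simp_all add: vec_eq_iff distrib_left)

lemma Bform_add_left: "Bform F u0 \<tau> (a + b) e = Bform F u0 \<tau> a e + Bform F u0 \<tau> b e"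
  and Bform_add_right: "Bform F u0 \<tau> e (a + b) = Bform F u0 \<tau> e a + Bform F u0 \<tau> e b"
  and Bform_scale_left: "Bform F u0 \<tau> (k *s a) e = k *s Bform F u0 \<tau> a e"
  and Bform_scale_right: "Bform F u0 \<tau> e (k *s a) = k *s Bform F u0 \<tau> e a"
  by (simp_all add: Bform_def vec_eq_iff distrib_left distrib_right sum.distrib sum_distrib_left mult_ac)

lemma Cform_add: "Cform F u0 \<tau> (a + b) e f = Cform F u0 \<tau> a e f + Cform F u0 \<tau> b e f"
  "Cform F u0 \<tau> e (a + b) f = Cform F u0 \<tau> e a f + Cform F u0 \<tau> e b f"
  "Cform F u0 \<tau> e f (a + b) = Cform F u0 \<tau> e f a + Cform F u0 \<tau> e f b"
  and Cform_scale: "Cform F u0 \<tau> (k *s a) e f = k *s Cform F u0 \<tau> a e f"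
  "Cform F u0 \<tau> e (k *s a) f = k *s Cform F u0 \<tau> e a f"
  "Cform F u0 \<tau> e f (k *s a) = k *s Cform F u0 \<tau> e f a"
  by (simp_all add: Cform_def vec_eq_iff distrib_left distrib_right sum.distrib sum_distrib_left mult_ac)

lemma Bform_commute:
  assumes "Ck_on 2 F UNIV"
  shows "Bform F u0 \<tau> a b = Bform F u0 \<tau> b a"
  unfolding Bform_def
  by (subst sum.swap) (intro sum.cong refl, subst dir_deriv_commute[OF assms], simp add: mult.commute)

text \<open>Two adjacent transpositions, which generate all permutations: the first uses symmetry of
  second derivatives of \<open>dir_deriv z F\<close>, the second that of \<open>F\<close> under a
  further derivative.\<close>

lemma Cform_commute:
  assumes F: "Ck_on 3 F UNIV"
  shows "Cform F u0 \<tau> a b e = Cform F u0 \<tau> b a e" "Cform F u0 \<tau> a b e = Cform F u0 \<tau> a e b"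
proof -
  have 1: "dir_deriv x (dir_deriv y (dir_deriv z F)) = dir_deriv y (dir_deriv x (dir_deriv z F))" for x y z
  proof -
    have "Ck_on 2 (dir_deriv z F) UNIV" using F by (simp add: numeral_3_eq_3 numeral_2_eq_2)
    from dir_deriv_commute[OF this] show ?thesis by (intro ext)
  qed
  have 2: "dir_deriv x (dir_deriv y (dir_deriv z F)) = dir_deriv x (dir_deriv z (dir_deriv y F))" for x y z
  proof -
    have "Ck_on 2 F UNIV" using F by (rule Ck_on_mono) simp
    from dir_deriv_commute[OF this] have "dir_deriv y (dir_deriv z F) = dir_deriv z (dir_deriv y F)" by (intro ext)
    then show ?thesis by simp
  qed
  show "Cform F u0 \<tau> a b e = Cform F u0 \<tau> b a e"
    unfolding Cform_def by (subst sum.swap) (intro sum.cong refl, subst 1, simp add: mult_ac)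
  have "Cform F u0 \<tau> a b e = (\<Sum>i\<in>UNIV. \<Sum>k\<in>UNIV. \<Sum>j\<in>UNIV. (a $ i * b $ j * e $ k) *s
     cvec (dir_deriv (axis i 1) (dir_deriv (axis j 1) (dir_deriv (axis k 1) F)) (u0 \<tau>)))"
    unfolding Cform_def by (rule sum.cong[OF refl], rule sum.swap)
  then show "Cform F u0 \<tau> a b e = Cform F u0 \<tau> a e b"
    unfolding Cform_def by (simp only:) (intro sum.cong refl, subst 2, simp add: mult_ac)
qed

lemma cvec_B2: "cvec (B2 F (u0 \<tau>) x y) = Bform F u0 \<tau> (cvec x) (cvec y)"
  unfolding B2_def Bform_def cvec_sum cvec_scaleR by (simp add: cvec_def)

lemma cvec_C3: "cvec (C3 F (u0 \<tau>) x y z) = Cform F u0 \<tau> (cvec x) (cvec y) (cvec z)"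
  unfolding C3_def Cform_def cvec_sum cvec_scaleR by (simp add: cvec_def)

text \<open>The mean over the four points \<open>cis (j\<pi>/4)\<close>, \<open>j < 4\<close>, whose squares are the fourth roots of
  unity, separates the monomials of a homogeneous polynomial of degree 2 or 3 in \<open>w\<close> and \<open>cnj w\<close>.\<close>

definition \<omega> :: complex where "\<omega> = Complex (sqrt 2 / 2) (sqrt 2 / 2)"

definition circle_mean :: "(complex \<Rightarrow> complex) \<Rightarrow> (complex \<Rightarrow> complex^'n) \<Rightarrow> complex^'n" where
  "circle_mean \<mu> f = (1/4) *s (\<mu> 1 *s f 1 + \<mu> \<omega> *s f \<omega> + \<mu> \<i> *s f \<i> + \<mu> (\<i> * \<omega>) *s f (\<i> * \<omega>))"

lemma \<omega>_square: "\<omega> * \<omega> = \<i>" and cnj_\<omega>: "cnj \<omega> = - \<i> * \<omega>"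
  by (simp_all add: \<omega>_def complex_eq_iff)

lemma cmod_\<omega>: "cmod \<omega> = 1"
  by (simp add: \<omega>_def cmod_def power_divide)

lemma circle_mean_cong:
  "(\<And>w. cmod w = 1 \<Longrightarrow> f w = g w) \<Longrightarrow> circle_mean \<mu> f = circle_mean \<mu> g"
  by (simp add: circle_mean_def cmod_\<omega> norm_mult)

lemma circle_mean_add: "circle_mean \<mu> (\<lambda>w. f w + g w) = circle_mean \<mu> f + circle_mean \<mu> g"
  by (simp add: circle_mean_def vec_eq_iff algebra_simps)

lemma circle_mean_matrix: "circle_mean \<mu> (\<lambda>w. M *v f w) = M *v circle_mean \<mu> f"
  by (simp add: circle_mean_def matrix_vector_right_distrib vector_scalar_commute)

lemma cnj_\<i>_\<omega>: "cnj (\<i> * \<omega>) = - \<omega>"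
  by (simp add: cnj_\<omega>)

text \<open>With \<open>p\<close> the eighth root \<open>\<omega>\<close> and \<open>j\<close> the
  imaginary unit, these rules bring every power in the four-point means to a multiple of 1,
  \<open>p\<close>, \<open>j\<close> or \<open>j * p\<close>.\<close>

lemma octant_power_identities:
  fixes p j :: complex assumes o: "p * p = j" "j * j = -1"
  shows "p ^ 2 = j" "j ^ 2 = -1" "(- j * p) ^ 2 = -j" "(- p) ^ 2 = j" "(j * p) ^ 2 = - j" "p ^ 3 = j * p" "j ^ 3 = - j"
    "(- j * p) ^ 3 = - p" "(- p) ^ 3 = - j * p" "(j * p) ^ 3 = p" "(-j)^2 = -1" "(-j)^3 = j"
   "p * (p * x) = j * x" "j * (j * x) = - x"
proof -
  have 1: "p * (p * x) = j * x" "j * (j * x) = - x" for x using o by (simp_all add: mult.assoc[symmetric])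
  show "p * (p * x) = j * x" "j * (j * x) = - x" by (rule 1)+
  show "p ^ 2 = j" "j ^ 2 = -1" "(- j * p) ^ 2 = -j" "(- p) ^ 2 = j" "(j * p) ^ 2 = - j" "p ^ 3 = j * p" "j ^ 3 = - j"
    "(- j * p) ^ 3 = - p" "(- p) ^ 3 = - j * p" "(j * p) ^ 3 = p" "(-j)^2 = -1" "(-j)^3 = j"
    using o by (simp_all add: power2_eq_square power3_eq_cube mult_ac 1)
qed

lemmas octant_simps = octant_power_identities[OF \<omega>_square i_squared]

lemma circle_mean_nth_eqI:
  assumes "\<mu> 1 * f 1 $ k + \<mu> \<omega> * f \<omega> $ k + \<mu> \<i> * f \<i> $ k + \<mu> (\<i> * \<omega>) * f (\<i> * \<omega>) $ k = 4 * a $ k"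
  shows "circle_mean \<mu> f $ k = a $ k"
  unfolding circle_mean_def vector_smult_component vector_add_component assms by simp

text \<open>The weight \<open>cnj w ^ 2\<close> makes the wanted monomial constant and leaves the
  exponents -2 and -4, whose sums over the four points vanish. The factor 2 undoes the 1/2! in front
  of h20.\<close>

lemma circle_mean_quadratic_leading:
  "circle_mean (\<lambda>w. 2 * cnj w ^ 2) (\<lambda>w. w ^ 2 *s a + b + cnj w ^ 2 *s e) = 2 *s a"
  unfolding vec_eq_iff
  by (intro allI circle_mean_nth_eqI)
    (simp only: vector_add_component vector_smult_component cnj_\<omega> cnj_\<i>_\<omega> complex_cnj_one complex_cnj_i
      octant_simps, simp add: algebra_simps octant_simps \<omega>_square)

lemma circle_mean_quadratic_middle:
  "circle_mean (\<lambda>w. 1) (\<lambda>w. w ^ 2 *s a + b + cnj w ^ 2 *s e) = b"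
  unfolding vec_eq_iff
  by (intro allI circle_mean_nth_eqI)
    (simp only: vector_add_component vector_smult_component cnj_\<omega> cnj_\<i>_\<omega> complex_cnj_one complex_cnj_i
      octant_simps, simp add: algebra_simps octant_simps \<omega>_square)

text \<open>The conjugate monomials are selected here and in the next lemma since they carry h12 and
  h03, whose equations contain \<open>cnj c\<close> and \<open>d\<close>; the factors 2 and 6 undo
  the factorials.\<close>

lemma circle_mean_cubic_cnj:
  "circle_mean (\<lambda>w. 2 * w) (\<lambda>w. w ^ 3 *s a + w *s b + cnj w *s e + cnj w ^ 3 *s f) = 2 *s e"
  unfolding vec_eq_iff
  by (intro allI circle_mean_nth_eqI)
    (simp only: vector_add_component vector_smult_component cnj_\<omega> cnj_\<i>_\<omega> complex_cnj_one complex_cnj_i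
      octant_simps, simp add: algebra_simps octant_simps \<omega>_square)

lemma circle_mean_cubic_cnj_cube:
  "circle_mean (\<lambda>w. 6 * w ^ 3) (\<lambda>w. w ^ 3 *s a + w *s b + cnj w *s e + cnj w ^ 3 *s f) = 6 *s f"
  unfolding vec_eq_iff
  by (intro allI circle_mean_nth_eqI)
    (simp only: vector_add_component vector_smult_component cnj_\<omega> cnj_\<i>_\<omega> complex_cnj_one complex_cnj_i
      octant_simps, simp add: algebra_simps octant_simps \<omega>_square)

lemma has_vector_derivative_circle_mean:
  assumes "\<And>w. cmod w = 1 \<Longrightarrow> ((\<lambda>\<tau>. f w \<tau>) has_vector_derivative f' w) (at t within X)"
  shows "((\<lambda>\<tau>. circle_mean \<mu> (\<lambda>w. f w \<tau>)) has_vector_derivative circle_mean \<mu> f') (at t within X)"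
  unfolding circle_mean_def
  by (intro bounded_linear.has_vector_derivative[OF bounded_linear_vector_scalar_mult]
      has_vector_derivative_add assms) (simp_all add: cmod_\<omega> norm_mult)

section \<open>Equations of the individual coefficients\<close>

context center_manifold
begin

lemma cvec_Q2:
  assumes h11: "h11 \<tau> = vcnj (h11 \<tau>)" and w: "cmod w = 1"
  shows "cvec (Q2 w \<tau>) = w ^ 2 *s ((1/2) *s h20 \<tau>) + h11 \<tau> + cnj w ^ 2 *s ((1/2) *s vcnj (h20 \<tau>))"
proof -
  have "cvec (vRe (h11 \<tau>)) = h11 \<tau>"
    using h11 by (simp add: vec_eq_iff cvec_def vRe_def vcnj_def complex_eq_iff)
  then show ?thesis
    by (simp add: Q2_def w cvec_add cvec_rpair vector_smult_assoc add_ac)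
qed

lemma cnj_w: "cmod w = 1 \<Longrightarrow> w * cnj w = 1"
  by (simp add: complex_norm_square[symmetric])

text \<open>On the unit circle \<open>w\<^sup>2 * cnj w\<close> collapses to \<open>w\<close>, so a
  cubic form has only the exponents 3, 1, -1 and -3, which the four-point means can tell
  apart.\<close>

lemma cvec_Q3:
  assumes w: "cmod w = 1"
  shows "cvec (Q3 w \<tau>) = w ^ 3 *s ((1/6) *s h30 \<tau>) + w *s ((1/2) *s h21 \<tau>)
     + cnj w *s ((1/2) *s vcnj (h21 \<tau>)) + cnj w ^ 3 *s ((1/6) *s vcnj (h30 \<tau>))"
proof -
  have "w\<^sup>2 * cnj w = w" using cnj_w[OF w] by (simp add: power2_eq_square mult.assoc)
  then show ?thesis
    by (simp add: Q3_def cvec_add cvec_rpair vector_smult_assoc add_ac)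
qed

lemma cvec_x1: "cvec (x1 w \<tau>) = w *s v \<tau> + cnj w *s vcnj (v \<tau>)"
  by (simp add: x1_def cvec_rpair)

text \<open>On the circle the inhomogeneity \<open>g\<close> has the same dependence on
  \<open>w\<close> as \<open>Q2\<close>. The means are linear and commute with \<open>A t\<close>
  and with differentiation, so each weight yields the equation of one coefficient.\<close>

lemma quadratic_ode:
  assumes h11: "\<And>\<tau>. h11 \<tau> = vcnj (h11 \<tau>)" and t: "t \<in> {0..T}"
  shows "(h20 has_vector_derivative cmat (A t) *v h20 t + Bform F u0 t (v t) (v t)) (at t within {0..T})" (is ?quadratic)
    and "(h11 has_vector_derivative cmat (A t) *v h11 t
      + (Bform F u0 t (v t) (vcnj (v t)) - of_real \<alpha>1 *s cvec (F (u0 t)))) (at t within {0..T})" (is ?mixed)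
proof -
  define g where "g w = w ^ 2 *s ((1/2) *s Bform F u0 t (v t) (v t))
     + (Bform F u0 t (v t) (vcnj (v t)) - of_real \<alpha>1 *s cvec (F (u0 t)))
     + cnj w ^ 2 *s ((1/2) *s Bform F u0 t (vcnj (v t)) (vcnj (v t)))" for w
  have G: "cvec (G2 w t) = cmat (A t) *v cvec (Q2 w t) + g w" if w: "cmod w = 1" for w
  proof -
    have "Bform F u0 t (w *s v t + cnj w *s vcnj (v t)) (w *s v t + cnj w *s vcnj (v t)) =
      w ^ 2 *s Bform F u0 t (v t) (v t) + 2 *s ((w * cnj w) *s Bform F u0 t (v t) (vcnj (v t)))
      + cnj w ^ 2 *s Bform F u0 t (vcnj (v t)) (vcnj (v t))"
      by (simp add: Bform_add_left Bform_add_right Bform_scale_left Bform_scale_right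
          Bform_commute[OF F2, of u0 t "vcnj (v t)" "v t"] vec_eq_iff power2_eq_square algebra_simps)
    then show ?thesis unfolding cnj_w[OF w]
      by (simp add: G2_def g_def cvec_add cvec_diff cvec_scaleR cmat_mult_cvec[symmetric] cvec_B2 cvec_x1 vec_eq_iff field_simps)
  qed
  have d: "((\<lambda>\<tau>. circle_mean \<mu> (\<lambda>w. cvec (Q2 w \<tau>))) has_vector_derivative
      cmat (A t) *v circle_mean \<mu> (\<lambda>w. cvec (Q2 w t)) + circle_mean \<mu> g) (at t within {0..T})" for \<mu>
  proof -
    have "((\<lambda>\<tau>. circle_mean \<mu> (\<lambda>w. cvec (Q2 w \<tau>))) has_vector_derivative
      circle_mean \<mu> (\<lambda>w. cvec (G2 w t))) (at t within {0..T})"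
      by (intro has_vector_derivative_circle_mean bounded_linear.has_vector_derivative[OF bounded_linear_cvec]
          homogeneous_parts_ode(1) t)
    moreover have "circle_mean \<mu> (\<lambda>w. cvec (G2 w t)) = circle_mean \<mu> (\<lambda>w. cmat (A t) *v cvec (Q2 w t) + g w)"
      by (rule circle_mean_cong) (rule G)
    ultimately show ?thesis by (simp add: circle_mean_add circle_mean_matrix)
  qed
  have q: "circle_mean \<mu> (\<lambda>w. cvec (Q2 w \<tau>)) = circle_mean \<mu> (\<lambda>w. w ^ 2 *s ((1/2) *s h20 \<tau>) + h11 \<tau> + cnj w ^ 2 *s ((1/2) *s vcnj (h20 \<tau>)))" for \<mu> \<tau>
    by (rule circle_mean_cong) (rule cvec_Q2[OF h11])
  show ?quadratic
    using d[of "\<lambda>w. 2 * cnj w ^ 2"] unfolding q circle_mean_quadratic_leading circle_mean_quadratic_middle g_def[abs_def] by (simp add: vector_smult_assoc)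
  show ?mixed
    using d[of "\<lambda>w. 1"] unfolding q circle_mean_quadratic_leading circle_mean_quadratic_middle g_def[abs_def] by simp
qed

text \<open>The scheme of \<open>quadratic_ode\<close> in degree 3. The unknowns are h12 and h03,
  written as conjugates of h21 and h30.\<close>

lemma cubic_ode:
  assumes h11: "\<And>\<tau>. h11 \<tau> = vcnj (h11 \<tau>)" and t: "t \<in> {0..T}"
  shows "((\<lambda>\<tau>. vcnj (h21 \<tau>)) has_vector_derivative cmat (A t) *v vcnj (h21 t)
      + ((Cform F u0 t (v t) (vcnj (v t)) (vcnj (v t)) + Bform F u0 t (v t) (vcnj (h20 t))
        + 2 *s Bform F u0 t (vcnj (v t)) (h11 t) - (2 * of_real \<alpha>1) *s (cmat (A t) *v vcnj (v t)))
        - (2 * cnj c) *s vcnj (v t))) (at t within {0..T})" (is ?h12)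
    and "((\<lambda>\<tau>. vcnj (h30 \<tau>)) has_vector_derivative cmat (A t) *v vcnj (h30 t)
      + ((Cform F u0 t (vcnj (v t)) (vcnj (v t)) (vcnj (v t)) + 3 *s Bform F u0 t (vcnj (v t)) (vcnj (h20 t)))
        - (6 * d) *s v t)) (at t within {0..T})" (is ?h03)
proof -
  let ?B = "Bform F u0 t" and ?C = "Cform F u0 t" and ?v = "v t" and ?u = "vcnj (v t)" and ?A = "cmat (A t)"
    and ?h = "h20 t" and ?k = "vcnj (h20 t)"
  \<comment> \<open>Coefficients of \<open>w ^ 3\<close>, \<open>w\<close>, \<open>cnj w\<close> and
    \<open>cnj w ^ 3\<close> in \<open>G3\<close> apart from the term with \<open>Q3\<close>;
    \<open>2 *s e\<close> and \<open>6 *s f\<close> are the two inhomogeneities of the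
    statement.\<close>
  define a where "a = (1/2) *s ?B ?v ?h + (1/6) *s ?C ?v ?v ?v - cnj d *s ?u"
  define b where "b = ?B ?v (h11 t) + (1/2) *s ?B ?u ?h + (1/2) *s ?C ?v ?v ?u - of_real \<alpha>1 *s (?A *v ?v) - c *s ?v"
  define e where "e = ?B ?u (h11 t) + (1/2) *s ?B ?v ?k + (1/2) *s ?C ?v ?u ?u - of_real \<alpha>1 *s (?A *v ?u) - cnj c *s ?u"
  define f where "f = (1/2) *s ?B ?u ?k + (1/6) *s ?C ?u ?u ?u - d *s ?v"
  have G: "cvec (G3 w t) = ?A *v cvec (Q3 w t) + (w ^ 3 *s a + w *s b + cnj w *s e + cnj w ^ 3 *s f)"
    if w: "cmod w = 1" for w
  proof -
    \<comment> \<open>With \<open>z\<close> as a separate letter the rest is polynomial algebra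
      subject to the one relation \<open>w * z = 1\<close>.\<close>
    define z where "z = cnj w"
    have 1: "w * z = 1" using cnj_w[OF w] by (simp add: z_def)
    have s: "w * z\<^sup>2 = z" "z * w\<^sup>2 = w" "w\<^sup>2 * z = w" "z\<^sup>2 * w = z" "w * w\<^sup>2 = w ^ 3" "z * z\<^sup>2 = z ^ 3"
      using 1 by (simp_all add: power2_eq_square power3_eq_cube mult.assoc[symmetric]) (simp_all add: mult.assoc mult.commute)
    have B: "?B (w *s ?v + z *s ?u) (w ^ 2 *s ((1/2) *s ?h) + h11 t + z ^ 2 *s ((1/2) *s ?k))
       = w ^ 3 *s ((1/2) *s ?B ?v ?h) + w *s (?B ?v (h11 t) + (1/2) *s ?B ?u ?h)
         + z *s (?B ?u (h11 t) + (1/2) *s ?B ?v ?k) + z ^ 3 *s ((1/2) *s ?B ?u ?k)"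
    proof -
      have "?B (w *s ?v + z *s ?u) (w ^ 2 *s ((1/2) *s ?h) + h11 t + z ^ 2 *s ((1/2) *s ?k))
       = (w * w\<^sup>2) *s ((1/2) *s ?B ?v ?h) + w *s ?B ?v (h11 t) + (w * z\<^sup>2) *s ((1/2) *s ?B ?v ?k)
         + ((z * w\<^sup>2) *s ((1/2) *s ?B ?u ?h) + z *s ?B ?u (h11 t) + (z * z\<^sup>2) *s ((1/2) *s ?B ?u ?k))"
        by (simp only: Bform_add_left Bform_add_right Bform_scale_left Bform_scale_right vector_smult_assoc vector_add_ldistrib mult_ac add_ac)
      then show ?thesis unfolding s by (simp add: vector_add_ldistrib add_ac)
    qed
    have C: "?C (w *s ?v + z *s ?u) (w *s ?v + z *s ?u) (w *s ?v + z *s ?u) =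
       w ^ 3 *s ?C ?v ?v ?v + w *s (3 *s ?C ?v ?v ?u) + z *s (3 *s ?C ?v ?u ?u) + z ^ 3 *s ?C ?u ?u ?u"
    proof -
      have sym: "?C ?u ?v ?v = ?C ?v ?v ?u" "?C ?v ?u ?v = ?C ?v ?v ?u" "?C ?u ?u ?v = ?C ?v ?u ?u" "?C ?u ?v ?u = ?C ?v ?u ?u"
        using Cform_commute[OF F, of u0 t] by metis+
      have "?C (w *s ?v + z *s ?u) (w *s ?v + z *s ?u) (w *s ?v + z *s ?u) =
        (w * w\<^sup>2) *s ?C ?v ?v ?v + (w\<^sup>2 * z) *s (3 *s ?C ?v ?v ?u) + (z\<^sup>2 * w) *s (3 *s ?C ?v ?u ?u) + (z * z\<^sup>2) *s ?C ?u ?u ?u"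
        by (simp add: Cform_add Cform_scale sym vec_eq_iff power2_eq_square algebra_simps)
      then show ?thesis unfolding s .
    qed
    have Z: "cvec (rpair (c * w + d * cnj w ^ 3) ?v) = (c * w + d * z ^ 3) *s ?v + (cnj c * z + cnj d * w ^ 3) *s ?u"
      by (simp add: cvec_rpair z_def)
    show ?thesis
      unfolding G3_def cvec_add cvec_diff cvec_scaleR cmat_mult_cvec[symmetric] cvec_B2 cvec_C3 cvec_x1
        cvec_Q2[OF h11 w] Z
      unfolding z_def[symmetric] B C a_def b_def e_def f_def
      by (simp add: matrix_vector_right_distrib vector_scalar_commute) (simp add: vec_eq_iff field_simps)
  qed
  have d: "((\<lambda>\<tau>. circle_mean \<mu> (\<lambda>w. cvec (Q3 w \<tau>))) has_vector_derivative
      ?A *v circle_mean \<mu> (\<lambda>w. cvec (Q3 w t)) + circle_mean \<mu> (\<lambda>w. w ^ 3 *s a + w *s b + cnj w *s e + cnj w ^ 3 *s f))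
      (at t within {0..T})" for \<mu>
  proof -
    have "((\<lambda>\<tau>. circle_mean \<mu> (\<lambda>w. cvec (Q3 w \<tau>))) has_vector_derivative
      circle_mean \<mu> (\<lambda>w. cvec (G3 w t))) (at t within {0..T})"
      by (intro has_vector_derivative_circle_mean bounded_linear.has_vector_derivative[OF bounded_linear_cvec]
          homogeneous_parts_ode(2) t)
    moreover have "circle_mean \<mu> (\<lambda>w. cvec (G3 w t)) = circle_mean \<mu> (\<lambda>w. ?A *v cvec (Q3 w t) +
        (w ^ 3 *s a + w *s b + cnj w *s e + cnj w ^ 3 *s f))"
      by (rule circle_mean_cong) (rule G)
    ultimately show ?thesis by (simp only: circle_mean_add[of _ "\<lambda>w. ?A *v cvec (Q3 w t)"] circle_mean_matrix)
  qed
  have q: "circle_mean \<mu> (\<lambda>w. cvec (Q3 w \<tau>)) = circle_mean \<mu> (\<lambda>w. w ^ 3 *s ((1/6) *s h30 \<tau>) + w *s ((1/2) *s h21 \<tau>)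
     + cnj w *s ((1/2) *s vcnj (h21 \<tau>)) + cnj w ^ 3 *s ((1/6) *s vcnj (h30 \<tau>)))" for \<mu> \<tau>
    by (rule circle_mean_cong) (rule cvec_Q3)
  have e2: "2 *s e = (?C ?v ?u ?u + ?B ?v ?k + 2 *s ?B ?u (h11 t) - (2 * of_real \<alpha>1) *s (?A *v ?u)) - (2 * cnj c) *s ?u"
    by (simp add: e_def vec_eq_iff field_simps)
  have f6: "6 *s f = (?C ?u ?u ?u + 3 *s ?B ?u ?k) - (6 * d) *s ?v"
    by (simp add: f_def vec_eq_iff field_simps)
  have 1: "2 *s ((1/2) *s x) = x" "6 *s ((1/6) *s x) = x" for x :: "complex^'n"
    by (simp_all add: vec_eq_iff)
  show ?h12
    using d[of "\<lambda>w. 2 * w"] unfolding q circle_mean_cubic_cnj e2 1 .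
  show ?h03
    using d[of "\<lambda>w. 6 * w ^ 3"] unfolding q circle_mean_cubic_cnj_cube f6 1 .
qed

end

section \<open>Coefficient formulas\<close>

lemma norm_cvec: "norm (cvec x) = norm x"
  by (simp add: norm_vec_def cvec_def L2_set_def)

lemma cvec_minus: "cvec (- a) = - cvec a"
  by (simp add: vec_eq_iff cvec_def)

lemma vcnj_minus: "vcnj (- a) = - vcnj a"
  and vcnj_scale: "vcnj (k *s a) = cnj k *s vcnj a"
  by (simp_all add: vec_eq_iff vcnj_def)

lemma bounded_linear_vcnj: "bounded_linear (vcnj :: complex^'n \<Rightarrow> complex^'n)"
  unfolding linear_conv_bounded_linear[symmetric]
  by (rule linearI) (simp_all add: vec_eq_iff vcnj_def)

lemma vcnj_cmat_mult: "vcnj (cmat M *v x) = cmat M *v vcnj x"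
  by (simp add: vec_eq_iff vcnj_def matrix_vector_mult_def map_matrix_def)

lemma exp_half_pi: "exp (\<i> * complex_of_real (pi/2)) = \<i>" "exp (- (\<i> * complex_of_real (pi/2))) = - \<i>"
proof -
  show 1: "exp (\<i> * complex_of_real (pi/2)) = \<i>"
    unfolding cis_conv_exp[symmetric] by simp
  show "exp (- (\<i> * complex_of_real (pi/2))) = - \<i>"
    unfolding exp_minus 1 by simp
qed

lemma hinner_cvec: "hinner (cvec a) (cvec b) = of_real (a \<bullet> b)"
  by (simp add: hinner_def cvec_def inner_vec_def)

lemma hinner_vcnj: "hinner (vcnj a) (vcnj b) = cnj (hinner a b)"
  by (simp add: hinner_def vcnj_def)

lemma hinner_scale: "hinner (k *s a) b = cnj k * hinner a b" "hinner a (k *s b) = k * hinner a b"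
  by (simp_all add: hinner_def sum_distrib_left mult_ac)

lemma hinner_diff_right: "hinner a (b - e) = hinner a b - hinner a e"
  by (simp add: hinner_def sum_subtractf right_diff_distrib)

lemma hinner_add_right: "hinner a (b + e) = hinner a b + hinner a e"
  by (simp add: hinner_def sum.distrib distrib_left)

text \<open>A function that is not integrable has integral 0 by convention, so a value of 1
  certifies integrability.\<close>

lemma integral_eq_1_imp_has_integral:
  fixes f :: "real \<Rightarrow> 'a::{real_normed_field,banach}"
  assumes "integral S f = 1"
  shows "(f has_integral 1) S"
  using assms by (metis integrable_integral not_integrable_integral zero_neq_one)

text \<open>The normalization of \<open>y\<close> turns the solvability condition into a formula for
  \<open>k\<close>; integrability of the pairing with \<open>E\<close> comes out as that of a
  sum.\<close>

lemma integral_hinner_eqI: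
  assumes "((\<lambda>\<tau>. hinner (x \<tau>) (E \<tau> - k *s y \<tau>)) has_integral 0) S"
    and "((\<lambda>\<tau>. hinner (x \<tau>) (y \<tau>)) has_integral 1) S"
  shows "integral S (\<lambda>\<tau>. hinner (x \<tau>) (E \<tau>)) = k"
proof -
  have "((\<lambda>\<tau>. hinner (x \<tau>) (E \<tau> - k *s y \<tau>) + k * hinner (x \<tau>) (y \<tau>)) has_integral 0 + k * 1) S"
    by (intro has_integral_add has_integral_mult_right assms)
  then show ?thesis by (simp add: hinner_diff_right hinner_scale integral_unique)
qed

text \<open>The seven terms of the double sum over \<open>k\<close> and \<open>l\<close> are grouped
  into real vectors: h11 stands alone, and each of the other index pairs joins its transposed pair
  in an \<open>rpair\<close>.\<close>

lemma center_manifoldI: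
  fixes F :: "real^'n \<Rightarrow> real^'n"
  assumes smooth: "Ck_on 3 F UNIV"
    and periodic: "periodic_orbit F u0 T"
    and v: "\<And>\<tau>. \<tau> \<in> {0..T} \<Longrightarrow> (v has_vector_derivative cmat (Amat F u0 \<tau>) *v v \<tau>) (at \<tau> within {0..T})"
    and nf: "R4_normal_form F u0 T v \<phi> H h \<alpha>1 \<alpha>2 \<alpha>3 c d"
  shows "\<exists>\<delta> K R1 R2. center_manifold F u0 T v H R1 R2 \<delta> K \<alpha>1 \<alpha>2 c d (h 2 0) (h 1 1) (h 3 0) (h 2 1)"
proof -
  have u0: "(u0 has_vector_derivative F (u0 t)) (at t)" and T: "T > 0" for t
    using periodic by (auto simp: periodic_orbit_def)
  have hc: "h k l \<tau> = vcnj (h l k \<tau>)" if "2 \<le> k + l" "k + l \<le> 3" for k l \<tau>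
    using nf that unfolding R4_normal_form_def by blast
  have \<alpha>3: "\<alpha>3 = cnj \<alpha>2" using nf unfolding R4_normal_form_def by blast
  obtain \<delta> K R1 R2 where \<delta>: "\<delta> > 0"
    and H: "Ck_on 4 (\<lambda>(\<tau>, \<xi>). H \<tau> \<xi>) (UNIV \<times> ball 0 \<delta>)"
    and R1: "Ck_on 1 (\<lambda>(\<tau>, \<xi>). R1 \<tau> \<xi>) (UNIV \<times> ball 0 \<delta>)"
    and R2: "Ck_on 1 (\<lambda>(\<tau>, \<xi>). R2 \<tau> \<xi>) (UNIV \<times> ball 0 \<delta>)"
    and bounds: "higher_order_bounds T H h \<delta> K R1 R2"
    and inv: "invariant_for_reduced_system F u0 v H \<delta> R1 R2 \<alpha>1 \<alpha>2 \<alpha>3 c d"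
    using nf unfolding R4_normal_form_iff by blast
  have H1: "Ck_on 1 (\<lambda>(\<tau>, \<xi>). H \<tau> \<xi>) (UNIV \<times> ball 0 \<delta>)" using H by (rule Ck_on_mono) simp
  \<comment> \<open>The normal form leaves the sign of \<open>K\<close> open, the locale asks for a
    nonnegative constant.\<close>
  have "center_manifold F u0 T v H R1 R2 \<delta> \<bar>K\<bar> \<alpha>1 \<alpha>2 c d (h 2 0) (h 1 1) (h 3 0) (h 2 1)"
  proof
    show "Ck_on 3 F UNIV" "T > 0" "\<delta> > 0" "\<bar>K\<bar> \<ge> 0" by (simp_all add: smooth T \<delta>)
    show "Ck_on 1 (\<lambda>(\<tau>, \<xi>). H \<tau> \<xi>) (UNIV \<times> ball 0 \<delta>)" by (rule H1)
    show "(u0 has_vector_derivative F (u0 t)) (at t)" for t by (rule u0)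
    show "\<tau> \<in> {0..T} \<Longrightarrow> (v has_vector_derivative cmat (Amat F u0 \<tau>) *v v \<tau>) (at \<tau> within {0..T})" for \<tau>
      by (rule v)
    fix \<tau> \<xi> assume \<xi>: "\<xi> \<in> ball (0::complex) \<delta>"
    have Kle: "K * x \<le> \<bar>K\<bar> * x" if "x \<ge> 0" for x using that by (simp add: mult_right_mono)
    show "\<bar>R1 \<tau> \<xi>\<bar> \<le> \<bar>K\<bar> * cmod \<xi> ^ 5" "cmod (R2 \<tau> \<xi>) \<le> \<bar>K\<bar> * cmod \<xi> ^ 5"
      using bounds[unfolded higher_order_bounds_def] \<xi> Kle[of "cmod \<xi> ^ 5"] by (meson order_trans zero_le_power norm_ge_zero)+
    let ?Q = "rpair (\<xi>\<^sup>2 / 2) (h 2 0 \<tau>) + (cmod \<xi>)\<^sup>2 *\<^sub>R vRe (h 1 1 \<tau>)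
        + (rpair (\<xi> ^ 3 / 6) (h 3 0 \<tau>) + rpair (\<xi>\<^sup>2 * cnj \<xi> / 2) (h 2 1 \<tau>))"
    have sets: "{l. 2 \<le> (0::nat) + l \<and> 0 + l \<le> 3} = {2, 3}" "{l. 2 \<le> (1::nat) + l \<and> 1 + l \<le> 3} = {1, 2}"
      "{l. 2 \<le> (2::nat) + l \<and> 2 + l \<le> 3} = {0, 1}" "{l. 2 \<le> (3::nat) + l \<and> 3 + l \<le> 3} = {0}"
      by auto
    have nums: "{..3::nat} = {0, 1, 2, 3}" by auto
    have facts: "(fact 2 :: complex) = 2" "(fact 3 :: complex) = 6" by (simp_all add: fact_numeral)
    have h11: "cvec (vRe (h 1 1 \<tau>)) = h 1 1 \<tau>"
      using hc[of 1 1 \<tau>] by (simp add: vec_eq_iff cvec_def vRe_def vcnj_def complex_eq_iff)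
    have conj_coeffs: "h 0 2 \<tau> = vcnj (h 2 0 \<tau>)" "h 0 3 \<tau> = vcnj (h 3 0 \<tau>)" "h (Suc 0) 2 \<tau> = vcnj (h 2 (Suc 0) \<tau>)"
      by (rule hc; simp)+
    have norm_sq: "(complex_of_real (cmod \<xi>))\<^sup>2 = \<xi> * cnj \<xi>"
      using complex_norm_square[of \<xi>] by simp
    have eq: "cvec ?Q =
      (\<Sum>k\<le>3. \<Sum>l | 2 \<le> k + l \<and> k + l \<le> 3. (1 / (fact k * fact l) * \<xi> ^ k * cnj \<xi> ^ l) *s h k l \<tau>)"
      unfolding cvec_add cvec_scaleR cvec_rpair h11 nums
      by (simp add: sets[simplified] sets facts conj_coeffs norm_sq)
    have "norm (cvec (H \<tau> \<xi> - ?Q)) \<le> K * cmod \<xi> ^ 4"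
      unfolding cvec_diff eq using bounds[unfolded higher_order_bounds_def, rule_format, OF \<xi>, of \<tau>] by blast
    then show "norm (H \<tau> \<xi> - ?Q) \<le> \<bar>K\<bar> * cmod \<xi> ^ 4"
      unfolding norm_cvec using Kle[of "cmod \<xi> ^ 4"] by simp
    assume \<tau>: "0 < \<tau>" "\<tau> < T"
    have "at \<tau> within {0..T} = at \<tau>" using \<tau> by (intro at_within_Icc_at) auto
    then have dv: "(v has_vector_derivative cmat (Amat F u0 \<tau>) *v v \<tau>) (at \<tau>)" using v[of \<tau>] \<tau> by simp
    show "(1 + \<alpha>1 * (cmod \<xi>)\<^sup>2 + 2 * Re (\<alpha>2 * \<xi> ^ 4) + R1 \<tau> \<xi>) *\<^sub>R
        (F (u0 \<tau>) + rpair \<xi> (cmat (Amat F u0 \<tau>) *v v \<tau>) + dir_deriv (1, 0) (\<lambda>(\<tau>, \<xi>). H \<tau> \<xi>) (\<tau>, \<xi>))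
      + rpair (c * \<xi> * of_real ((cmod \<xi>)\<^sup>2) + d * cnj \<xi> ^ 3 + R2 \<tau> \<xi>) (v \<tau>)
      + dir_deriv (0, c * \<xi> * of_real ((cmod \<xi>)\<^sup>2) + d * cnj \<xi> ^ 3 + R2 \<tau> \<xi>) (\<lambda>(\<tau>, \<xi>). H \<tau> \<xi>) (\<tau>, \<xi>)
      = F (u0 \<tau> + rpair \<xi> (v \<tau>) + H \<tau> \<xi>)"
      by (rule invariance_equation[OF H1 R1 R2 \<alpha>3 inv u0 dv \<xi>])
  qed
  then show ?thesis by blast
qed

text \<open>Two solutions of a boundary value problem differ by a homogeneous solution, whose
  boundary condition is an eigenvector equation for the monodromy matrix. The scalars follow by
  pairing each resonant equation with the adjoint solution of the same multiplier.\<close>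

lemma R4_formulas:
  fixes F :: "real^'n \<Rightarrow> real^'n"
  assumes smooth: "Ck_on 3 F UNIV"
    and periodic: "periodic_orbit F u0 T"
    and fundamental: "fundamental_solution F u0 Y"
    and R4: "R4_multipliers (cmat (Y T))"
    and eigenfunctions: "R4_eigenfunctions F u0 T v \<phi> vs"
    and nf: "R4_normal_form F u0 T v \<phi> H h \<alpha>1 \<alpha>2 \<alpha>3 c d"
  shows "unique_solution_on {0..T} (h20_problem F u0 T v) (h 2 0)"
    and "complex_of_real \<alpha>1
           = integral {0..T} (\<lambda>\<tau>. hinner (cvec (\<phi> \<tau>)) (Bform F u0 \<tau> (v \<tau>) (vcnj (v \<tau>))))" (is ?\<alpha>1_formula)
    and "unique_solution_on {0..T} (h11_problem F u0 T v \<phi> \<alpha>1) (h 1 1)"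
    and "cnj c = 1/2 * integral {0..T} (\<lambda>\<tau>. hinner (vcnj (vs \<tau>))
           (Cform F u0 \<tau> (v \<tau>) (vcnj (v \<tau>)) (vcnj (v \<tau>))
            + Bform F u0 \<tau> (v \<tau>) (vcnj (h 2 0 \<tau>))
            + 2 *s Bform F u0 \<tau> (vcnj (v \<tau>)) (h 1 1 \<tau>)
            - (2 * of_real \<alpha>1) *s (cmat (Amat F u0 \<tau>) *v vcnj (v \<tau>))))" (is ?c_formula)
    and "d = 1/6 * integral {0..T} (\<lambda>\<tau>. hinner (vs \<tau>)
           (Cform F u0 \<tau> (vcnj (v \<tau>)) (vcnj (v \<tau>)) (vcnj (v \<tau>))
            + 3 *s Bform F u0 \<tau> (vcnj (v \<tau>)) (vcnj (h 2 0 \<tau>))))" (is ?d_formula)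
proof -
  have dv: "(v has_vector_derivative cmat (Amat F u0 \<tau>) *v v \<tau>) (at \<tau> within {0..T})"
    and d\<phi>: "(\<phi> has_vector_derivative - (transpose (Amat F u0 \<tau>) *v \<phi> \<tau>)) (at \<tau> within {0..T})"
    and dvs: "(vs has_vector_derivative - (cmat (transpose (Amat F u0 \<tau>)) *v vs \<tau>)) (at \<tau> within {0..T})"
    if "\<tau> \<in> {0..T}" for \<tau>
    using eigenfunctions that unfolding R4_eigenfunctions_def by blast+
  have \<phi>T: "\<phi> T = \<phi> 0" and vsT: "vs T = \<i> *s vs 0"
    and int\<phi>: "integral {0..T} (\<lambda>\<tau>. \<phi> \<tau> \<bullet> F (u0 \<tau>)) = 1"
    and intvs: "integral {0..T} (\<lambda>\<tau>. hinner (vs \<tau>) (v \<tau>)) = 1"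
    using eigenfunctions unfolding R4_eigenfunctions_def exp_half_pi by blast+
  have hc: "h k l \<tau> = vcnj (h l k \<tau>)"
    and hT: "h k l \<tau> = ((- \<i>) ^ k * \<i> ^ l) *s h k l (\<tau> + T)" if "2 \<le> k + l" "k + l \<le> 3" for k l \<tau>
    using nf that unfolding R4_normal_form_def exp_half_pi by blast+
  have int11: "integral {0..T} (\<lambda>\<tau>. hinner (cvec (\<phi> \<tau>)) (h 1 1 \<tau>)) = 0"
    using nf unfolding R4_normal_form_def by blast
  obtain \<delta> K R1 R2 where cm: "center_manifold F u0 T v H R1 R2 \<delta> K \<alpha>1 \<alpha>2 c d (h 2 0) (h 1 1) (h 3 0) (h 2 1)"
    using center_manifoldI[OF smooth periodic dv nf] by blast
  interpret center_manifold F u0 T v H R1 R2 \<delta> K \<alpha>1 \<alpha>2 c d "h 2 0" "h 1 1" "h 3 0" "h 2 1" by (rule cm)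
  have h11c: "h 1 1 \<tau> = vcnj (h 1 1 \<tau>)" for \<tau> by (rule hc) auto
  have u0T: "u0 T = u0 0" using periodic unfolding periodic_orbit_def by (metis add_0)
  have T0: "0 \<in> {0..T}" "T \<in> {0..T}" using T by auto
  obtain M where M: "\<And>\<tau> x. \<tau> \<in> {0..T} \<Longrightarrow> norm (A \<tau> *v x) \<le> M * norm x"
    using norm_A_mult_le by blast
  have Abound: "\<bar>A \<tau> $ i $ j\<bar> \<le> M" if "\<tau> \<in> {0..T}" for \<tau> i j
  proof -
    have "\<bar>A \<tau> $ i $ j\<bar> = norm ((A \<tau> *v axis j 1) $ i)"
      by (simp add: matrix_vector_mult_basis column_def)
    also have "\<dots> \<le> M"
      using order_trans[OF Finite_Cartesian_Product.norm_nth_le M[OF that, of "axis j 1"]] by simp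
    finally show ?thesis .
  qed
  have flow: "y \<tau> = cmat (Y \<tau>) *v y 0"
    if "\<And>\<tau>. \<tau> \<in> {0..T} \<Longrightarrow> (y has_vector_derivative cmat (A \<tau>) *v y \<tau>) (at \<tau> within {0..T})" "\<tau> \<in> {0..T}" for y \<tau>
    by (rule linear_ode_eq_fundamental[OF fundamental Abound that])
  \<comment> \<open>-1 lies on the unit circle, but the only multipliers there are 1, i and
    -i.\<close>
  have no_minus1: "\<not> eigenvalue_of (cmat (Y T)) (-1)"
  proof
    assume "eigenvalue_of (cmat (Y T)) (-1)"
    then have "-1 \<in> {\<mu>. eigenvalue_of (cmat (Y T)) \<mu> \<and> cmod \<mu> = 1}" by simp
    then show False
      using R4 unfolding R4_multipliers_def exp_half_pi by (auto simp: complex_eq_iff)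
  qed
  have h20T: "h 2 0 T + h 2 0 0 = 0"
    using hT[of 2 0 0] by simp
  have h11T: "h 1 1 T - h 1 1 0 = 0"
    using hT[of 1 1 0] by simp

  show "unique_solution_on {0..T} (h20_problem F u0 T v) (h 2 0)"
    unfolding unique_solution_on_def
  proof (intro conjI allI impI ballI)
    show "h20_problem F u0 T v (h 2 0)"
      unfolding h20_problem_def
    proof (intro conjI ballI h20T)
      fix t assume "t \<in> {0..T}"
      from quadratic_ode(1)[OF h11c this] show "\<exists>x'. (h 2 0 has_vector_derivative x') (at t within {0..T}) \<and>
        x' - cmat (A t) *v h 2 0 t - Bform F u0 t (v t) (v t) = 0"
        by (intro exI conjI) auto
    qed
    fix y \<tau> assume y: "h20_problem F u0 T v y" and \<tau>: "\<tau> \<in> {0..T}"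
    have dy: "(y has_vector_derivative cmat (A t) *v y t + Bform F u0 t (v t) (v t)) (at t within {0..T})"
      if t: "t \<in> {0..T}" for t
    proof -
      obtain y' where y': "(y has_vector_derivative y') (at t within {0..T})"
        "y' - cmat (A t) *v y t - Bform F u0 t (v t) (v t) = 0"
        using bspec[OF conjunct1[OF y[unfolded h20_problem_def]] t] by (elim exE conjE)
      then have "y' = cmat (A t) *v y t + Bform F u0 t (v t) (v t)" by (simp only: diff_diff_eq right_minus_eq)
      with y'(1) show ?thesis by simp
    qed
    \<comment> \<open>The inhomogeneities cancel in \<open>e\<close>, and the antiperiodic condition
      makes \<open>e 0\<close> an eigenvector for -1 unless it is 0.\<close>
    define e where "e t = y t - h 2 0 t" for t
    have de: "(e has_vector_derivative cmat (A t) *v e t) (at t within {0..T})" if "t \<in> {0..T}" for t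
      using has_vector_derivative_diff[OF dy[OF that] quadratic_ode(1)[OF h11c that]]
      unfolding e_def by (simp add: matrix_vector_mult_diff_distrib)
    have "y T = - y 0" "h 2 0 T = - h 2 0 0"
      using conjunct2[OF y[unfolded h20_problem_def]] h20T by (simp_all only: eq_neg_iff_add_eq_0)
    then have "e T = - e 0" by (simp add: e_def)
    then have "cmat (Y T) *v e 0 = (-1) *s e 0" using flow[OF de T0(2)] by simp
    then have "e 0 = 0" using no_minus1 unfolding eigenvalue_of_def by blast
    then show "y \<tau> = h 2 0 \<tau>" using flow[OF de \<tau>] by (simp add: e_def)
  qed

  have dc\<phi>: "((\<lambda>\<tau>. cvec (\<phi> \<tau>)) has_vector_derivative - (cmat (transpose (A \<tau>)) *v cvec (\<phi> \<tau>))) (at \<tau> within {0..T})"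
    if "\<tau> \<in> {0..T}" for \<tau>
    using bounded_linear.has_vector_derivative[OF bounded_linear_cvec d\<phi>[OF that]]
    by (simp add: cmat_mult_cvec cvec_minus)
  have int\<phi>': "((\<lambda>\<tau>. hinner (cvec (\<phi> \<tau>)) (cvec (F (u0 \<tau>)))) has_integral 1) {0..T}"
    using has_integral_linear[OF integral_eq_1_imp_has_integral[OF int\<phi>] bounded_linear_of_real[where 'a=complex]]
    by (simp add: o_def hinner_cvec)
  have "((\<lambda>\<tau>. hinner (cvec (\<phi> \<tau>)) (Bform F u0 \<tau> (v \<tau>) (vcnj (v \<tau>)) - of_real \<alpha>1 *s cvec (F (u0 \<tau>)))) has_integral
     hinner (cvec (\<phi> T)) (h 1 1 T) - hinner (cvec (\<phi> 0)) (h 1 1 0)) {0..T}"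
    using T by (intro has_integral_adjoint_pairing[OF _ dc\<phi> quadratic_ode(2)[OF h11c]]) auto
  \<comment> \<open>\<open>\<phi>\<close> and \<open>h 1 1\<close> are both periodic, so the
    boundary terms cancel.\<close>
  then have "((\<lambda>\<tau>. hinner (cvec (\<phi> \<tau>)) (Bform F u0 \<tau> (v \<tau>) (vcnj (v \<tau>)) - of_real \<alpha>1 *s cvec (F (u0 \<tau>)))) has_integral 0) {0..T}"
    using h11T by (simp add: \<phi>T)
  from integral_hinner_eqI[OF this int\<phi>']
  show ?\<alpha>1_formula
    by simp

  have vdu0: "vector_derivative u0 (at \<tau>) = F (u0 \<tau>)" for \<tau>
    by (rule vector_derivative_at[OF u0])
  show "unique_solution_on {0..T} (h11_problem F u0 T v \<phi> \<alpha>1) (h 1 1)"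
    unfolding unique_solution_on_def
  proof (intro conjI allI impI ballI)
    show "h11_problem F u0 T v \<phi> \<alpha>1 (h 1 1)"
      unfolding h11_problem_def vdu0
    proof (intro conjI ballI h11T int11)
      fix t assume "t \<in> {0..T}"
      from quadratic_ode(2)[OF h11c this] show "\<exists>x'. (h 1 1 has_vector_derivative x') (at t within {0..T}) \<and>
        x' - cmat (A t) *v h 1 1 t - Bform F u0 t (v t) (vcnj (v t)) + of_real \<alpha>1 *s cvec (F (u0 t)) = 0"
        by (intro exI conjI) auto
    qed
    fix y \<tau> assume y: "h11_problem F u0 T v \<phi> \<alpha>1 y" and \<tau>: "\<tau> \<in> {0..T}"
    have dy: "(y has_vector_derivative cmat (A t) *v y t + (Bform F u0 t (v t) (vcnj (v t)) - of_real \<alpha>1 *s cvec (F (u0 t)))) (at t within {0..T})"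
      if t: "t \<in> {0..T}" for t
    proof -
      obtain y' where y': "(y has_vector_derivative y') (at t within {0..T})"
        "y' - cmat (A t) *v y t - Bform F u0 t (v t) (vcnj (v t)) + of_real \<alpha>1 *s cvec (F (u0 t)) = 0"
        using bspec[OF conjunct1[OF y[unfolded h11_problem_def vdu0]] t] by (elim exE conjE)
      have "y' = (y' - cmat (A t) *v y t - Bform F u0 t (v t) (vcnj (v t)) + of_real \<alpha>1 *s cvec (F (u0 t)))
          + (cmat (A t) *v y t + (Bform F u0 t (v t) (vcnj (v t)) - of_real \<alpha>1 *s cvec (F (u0 t))))"
        by simp
      then have "y' = cmat (A t) *v y t + (Bform F u0 t (v t) (vcnj (v t)) - of_real \<alpha>1 *s cvec (F (u0 t)))"
        unfolding y'(2) by (simp only: add_0)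
      with y'(1) show ?thesis by simp
    qed
    define e where "e t = y t - h 1 1 t" for t
    have de: "(e has_vector_derivative cmat (A t) *v e t) (at t within {0..T})" if "t \<in> {0..T}" for t
      using has_vector_derivative_diff[OF dy[OF that] quadratic_ode(2)[OF h11c that]]
      unfolding e_def by (simp add: matrix_vector_mult_diff_distrib)
    \<comment> \<open>The velocity of the orbit solves the variational equation and has equal values
      at 0 and \<open>T\<close>, which provides the eigenvector for the multiplier 1.\<close>
    have dF: "((\<lambda>t. cvec (F (u0 t))) has_vector_derivative cmat (A t) *v cvec (F (u0 t))) (at t within {0..T})" for t
    proof -
      have "((F \<circ> u0) has_vector_derivative dir_deriv (F (u0 t)) F (u0 t)) (at t)"
        using vector_derivative_diff_chain_within[OF u0 has_derivative_at_withinI[OF has_derivative_dir_deriv[OF dF]]] by simp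
      then have "((\<lambda>t. F (u0 t)) has_vector_derivative A t *v F (u0 t)) (at t within {0..T})"
        by (simp add: A_eq o_def has_vector_derivative_at_within)
      from bounded_linear.has_vector_derivative[OF bounded_linear_cvec this]
      show ?thesis by (simp add: cmat_mult_cvec)
    qed
    have "y T = y 0" "integral {0..T} (\<lambda>\<tau>. hinner (cvec (\<phi> \<tau>)) (y \<tau>)) = 0"
      using conjunct2[OF y[unfolded h11_problem_def]] by simp_all
    have eT: "cmat (Y T) *v e 0 = 1 *s e 0"
      using flow[OF de T0(2)] \<open>y T = y 0\<close> h11T by (simp add: e_def)
    have FT: "cmat (Y T) *v cvec (F (u0 0)) = 1 *s cvec (F (u0 0))"
      using flow[OF dF T0(2)] by (simp add: u0T)
    \<comment> \<open>If the velocity vanished at 0, the linear flow would make it vanish on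
      \<open>{0..T}\<close>, against its unit pairing with \<open>\<phi>\<close>.\<close>
    have F0: "cvec (F (u0 0)) \<noteq> 0"
    proof
      assume 0: "cvec (F (u0 0)) = 0"
      have "cvec (F (u0 t)) = 0" if "t \<in> {0..T}" for t using flow[OF dF that] by (simp add: 0)
      then have "((\<lambda>\<tau>. hinner (cvec (\<phi> \<tau>)) (cvec (F (u0 \<tau>)))) has_integral 0) {0..T}"
        by (intro has_integral_is_0) (simp add: hinner_def)
      with int\<phi>' show False using has_integral_unique zero_neq_one by blast
    qed
    \<comment> \<open>Simplicity of the multiplier 1 leaves only multiples of the velocity as
      periodic solutions; \<open>no_minus1\<close> certifies that the characteristic polynomial is
      nonzero.\<close>
    obtain k where k: "e 0 = k *s cvec (F (u0 0))"
      using simple_eigenvalue_eigenvectors_parallel[OF _ charpoly_nonzero[OF no_minus1] FT F0 eT] R4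
      unfolding R4_multipliers_def by blast
    have ek: "e t = k *s cvec (F (u0 t))" if "t \<in> {0..T}" for t
      using flow[OF de that] flow[OF dF that] by (simp add: k vector_scalar_commute)
    \<comment> \<open>An integral equal to 0 does not imply integrability, as 0 is also the default
      value; continuity supplies it.\<close>
    have cont: "continuous_on {0..T} (\<lambda>\<tau>. hinner (cvec (\<phi> \<tau>)) (h 1 1 \<tau>))"
      unfolding continuous_on_eq_continuous_within
      using has_vector_derivative_continuous[OF bounded_bilinear.has_vector_derivative[OF bounded_bilinear_hinner dc\<phi> quadratic_ode(2)[OF h11c]]]
      by blast
    have "((\<lambda>\<tau>. hinner (cvec (\<phi> \<tau>)) (h 1 1 \<tau>)) has_integral 0) {0..T}"
      using integrable_integral[OF integrable_continuous_real[OF cont]] by (simp only: int11)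
    \<comment> \<open>Since the velocity pairs with \<open>\<phi>\<close> to 1 and
      \<open>h 1 1\<close> to 0, the integral for \<open>y\<close> is exactly \<open>k\<close>, and
      the condition on \<open>y\<close> forces \<open>k = 0\<close>.\<close>
    from has_integral_add[OF this has_integral_mult_right[OF int\<phi>', of k]]
    have "((\<lambda>\<tau>. hinner (cvec (\<phi> \<tau>)) (h 1 1 \<tau>) + k * hinner (cvec (\<phi> \<tau>)) (cvec (F (u0 \<tau>)))) has_integral k) {0..T}"
      by simp
    moreover have "hinner (cvec (\<phi> t)) (h 1 1 t) + k * hinner (cvec (\<phi> t)) (cvec (F (u0 t))) = hinner (cvec (\<phi> t)) (y t)"
      if "t \<in> {0..T}" for t
      using ek[OF that] by (simp add: e_def hinner_scale[symmetric] hinner_add_right[symmetric] algebra_simps)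
    ultimately have "((\<lambda>\<tau>. hinner (cvec (\<phi> \<tau>)) (y \<tau>)) has_integral k) {0..T}"
      by (rule has_integral_eq[rotated])
    then have "k = 0"
      using \<open>integral {0..T} (\<lambda>\<tau>. hinner (cvec (\<phi> \<tau>)) (y \<tau>)) = 0\<close> by (simp add: integral_unique)
    then show "y \<tau> = h 1 1 \<tau>" using ek[OF \<tau>] by (simp add: e_def)
  qed

  have intvs': "((\<lambda>\<tau>. hinner (vs \<tau>) (v \<tau>)) has_integral 1) {0..T}"
    by (rule integral_eq_1_imp_has_integral[OF intvs])
  have intvsc: "((\<lambda>\<tau>. hinner (vcnj (vs \<tau>)) (vcnj (v \<tau>))) has_integral 1) {0..T}"
    using has_integral_linear[OF intvs' bounded_linear_cnj] by (simp add: o_def hinner_vcnj)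
  have dvsc: "((\<lambda>\<tau>. vcnj (vs \<tau>)) has_vector_derivative - (cmat (transpose (A \<tau>)) *v vcnj (vs \<tau>))) (at \<tau> within {0..T})"
    if "\<tau> \<in> {0..T}" for \<tau>
    using bounded_linear.has_vector_derivative[OF bounded_linear_vcnj dvs[OF that]]
    by (simp add: vcnj_cmat_mult vcnj_minus)
  \<comment> \<open>After conjugation h12 has the factor -i of \<open>vcnj vs\<close>, and h03 the
    factor i of \<open>vs\<close>. As \<open>hinner\<close> is conjugate-linear on the left, equal
    factors of modulus 1 cancel in the boundary terms.\<close>
  have h21T: "h 2 1 T = \<i> *s h 2 1 0" and h30T: "h 3 0 T = (- \<i>) *s h 3 0 0"
    using hT[of 2 1 0] hT[of 3 0 0] by (simp_all add: power3_eq_cube vector_smult_assoc)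

  have boundary21: "hinner (vcnj (vs T)) (vcnj (h 2 1 T)) - hinner (vcnj (vs 0)) (vcnj (h 2 1 0)) = 0"
    and boundary30: "hinner (vs T) (vcnj (h 3 0 T)) - hinner (vs 0) (vcnj (h 3 0 0)) = 0"
    unfolding vsT h21T h30T vcnj_scale hinner_scale by simp_all

  let ?E21 = "\<lambda>\<tau>. Cform F u0 \<tau> (v \<tau>) (vcnj (v \<tau>)) (vcnj (v \<tau>)) + Bform F u0 \<tau> (v \<tau>) (vcnj (h 2 0 \<tau>))
        + 2 *s Bform F u0 \<tau> (vcnj (v \<tau>)) (h 1 1 \<tau>) - (2 * of_real \<alpha>1) *s (cmat (A \<tau>) *v vcnj (v \<tau>))"
  let ?E30 = "\<lambda>\<tau>. Cform F u0 \<tau> (vcnj (v \<tau>)) (vcnj (v \<tau>)) (vcnj (v \<tau>))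
        + 3 *s Bform F u0 \<tau> (vcnj (v \<tau>)) (vcnj (h 2 0 \<tau>))"
  have "((\<lambda>\<tau>. hinner (vcnj (vs \<tau>)) (?E21 \<tau>
        - (2 * cnj c) *s vcnj (v \<tau>))) has_integral
      hinner (vcnj (vs T)) (vcnj (h 2 1 T)) - hinner (vcnj (vs 0)) (vcnj (h 2 1 0))) {0..T}"
    using T by (intro has_integral_adjoint_pairing[OF _ dvsc cubic_ode(1)[OF h11c]]) auto
  then have "((\<lambda>\<tau>. hinner (vcnj (vs \<tau>)) (?E21 \<tau>
        - (2 * cnj c) *s vcnj (v \<tau>))) has_integral 0) {0..T}"
    unfolding boundary21 .
  from integral_hinner_eqI[OF this intvsc]
  show ?c_formula
    by simp

  have "((\<lambda>\<tau>. hinner (vs \<tau>) (?E30 \<tau> - (6 * d) *s v \<tau>)) has_integral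
      hinner (vs T) (vcnj (h 3 0 T)) - hinner (vs 0) (vcnj (h 3 0 0))) {0..T}"
    using T by (intro has_integral_adjoint_pairing[OF _ dvs cubic_ode(2)[OF h11c]]) auto
  then have "((\<lambda>\<tau>. hinner (vs \<tau>) (?E30 \<tau> - (6 * d) *s v \<tau>)) has_integral 0) {0..T}"
    unfolding boundary30 .
  from integral_hinner_eqI[OF this intvs']
  show ?d_formula
    by simp
qed

section \<open>Rotation of the eigenfunction\<close>

text \<open>The adjoint \<open>vs\<close> has to rotate along with \<open>v\<close>: the factors
  \<open>cnj \<gamma>\<close> and \<open>\<gamma>\<close> then cancel in every
  normalization.\<close>

lemma R4_eigenfunctions_rotate:
  assumes e: "R4_eigenfunctions F u0 T v \<phi> vs" and \<gamma>: "cmod \<gamma> = 1"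
  shows "R4_eigenfunctions F u0 T (\<lambda>\<tau>. \<gamma> *s v \<tau>) \<phi> (\<lambda>\<tau>. \<gamma> *s vs \<tau>)"
proof -
  have \<gamma>1: "cnj \<gamma> * \<gamma> = 1" using complex_norm_square[of \<gamma>] \<gamma> by (simp add: mult.commute)
  have 1: "hinner (\<gamma> *s a) (\<gamma> *s b) = hinner a b" for a b :: "complex^'b"
    unfolding hinner_scale mult.assoc[symmetric] using \<gamma>1 by (simp add: mult.commute)
  have 2: "((\<lambda>\<tau>. \<gamma> *s x \<tau>) has_vector_derivative M *v (\<gamma> *s x t)) (at t within X)"
    if "(x has_vector_derivative M *v x t) (at t within X)" for x t M X
    using bounded_linear.has_vector_derivative[OF bounded_linear_vector_scalar_mult that, of \<gamma>]
    by (simp add: vector_scalar_commute)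
  have 3: "((\<lambda>\<tau>. \<gamma> *s x \<tau>) has_vector_derivative - (M *v (\<gamma> *s x t))) (at t within X)"
    if "(x has_vector_derivative - (M *v x t)) (at t within X)" for x t M X
    using bounded_linear.has_vector_derivative[OF bounded_linear_vector_scalar_mult that, of \<gamma>]
    by (simp add: vector_scalar_commute vector_smult_rneg)
  show ?thesis
    using e unfolding R4_eigenfunctions_def 1
    by (auto intro!: 2 3 simp: vector_smult_assoc mult.commute)
qed

text \<open>The same manifold in the coordinate \<open>\<xi>\<close> with
  \<open>\<gamma> * \<xi>\<close> in the old place. If \<open>z\<close> solves the rotated system,
  \<open>\<gamma> * z\<close> solves the old one. In the \<xi>-equation the phase drops out of the
  term with \<open>c\<close>, while the term with \<open>d\<close> receives
  \<open>cnj \<gamma>\<close> once from the change of coordinate and three times from the conjugate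
  cube.\<close>

lemma R4_normal_form_rotate:
  assumes nf: "R4_normal_form F u0 T v \<phi> H h \<alpha>1 \<alpha>2 \<alpha>3 c d" and \<gamma>: "cmod \<gamma> = 1"
  shows "R4_normal_form F u0 T (\<lambda>\<tau>. \<gamma> *s v \<tau>) \<phi> (\<lambda>\<tau> \<xi>. H \<tau> (\<gamma> * \<xi>))
    (\<lambda>k l \<tau>. (\<gamma> ^ k * cnj \<gamma> ^ l) *s h k l \<tau>) \<alpha>1 (\<gamma> ^ 4 * \<alpha>2) (cnj \<gamma> ^ 4 * \<alpha>3) c (cnj \<gamma> ^ 4 * d)"
proof -
  have \<gamma>1: "\<gamma> * cnj \<gamma> = 1" using complex_norm_square[of \<gamma>] \<gamma> by simp
  have int11: "integral {0..T} (\<lambda>\<tau>. hinner (cvec (\<phi> \<tau>)) (h 1 1 \<tau>)) = 0" and \<alpha>3: "\<alpha>3 = cnj \<alpha>2"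
    using nf unfolding R4_normal_form_def by blast+
  have n\<gamma>: "cmod (\<gamma> * z) = cmod z" for z using \<gamma> by (simp add: norm_mult)
  obtain \<delta> K R1 R2 where \<delta>: "\<delta> > 0"
    and H: "Ck_on 4 (\<lambda>(\<tau>, \<xi>). H \<tau> \<xi>) (UNIV \<times> ball 0 \<delta>)"
    and R1: "Ck_on 1 (\<lambda>(\<tau>, \<xi>). R1 \<tau> \<xi>) (UNIV \<times> ball 0 \<delta>)"
    and R2: "Ck_on 1 (\<lambda>(\<tau>, \<xi>). R2 \<tau> \<xi>) (UNIV \<times> ball 0 \<delta>)"
    and bounds: "higher_order_bounds T H h \<delta> K R1 R2"
    and inv: "invariant_for_reduced_system F u0 v H \<delta> R1 R2 \<alpha>1 \<alpha>2 \<alpha>3 c d"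
    using nf unfolding R4_normal_form_iff by blast
  have L: "bounded_linear (\<lambda>p :: real \<times> complex. (fst p, \<gamma> * snd p))"
    by (intro bounded_linear_Pair bounded_linear_fst bounded_linear_compose[OF bounded_linear_mult_right bounded_linear_snd])
  have open_dom: "open ((UNIV :: real set) \<times> ball (0::complex) \<delta>)" by (intro open_Times) auto
  have comp: "Ck_on k (\<lambda>(\<tau>, \<xi>). M (f \<tau> (\<gamma> * \<xi>))) (UNIV \<times> ball 0 \<delta>)"
    if "Ck_on k (\<lambda>(\<tau>, \<xi>). f \<tau> \<xi>) (UNIV \<times> ball 0 \<delta>)" "bounded_linear M"
    for k and f :: "real \<Rightarrow> complex \<Rightarrow> 'x::real_normed_vector" and M :: "'x \<Rightarrow> 'x"
    using Ck_on_linear_compose[OF open_dom open_dom L that(2) _ that(1)] by (simp add: case_prod_unfold n\<gamma> mem_Times_iff)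
  have cm: "cm_param u0 (\<lambda>\<tau>. \<gamma> *s v \<tau>) (\<lambda>\<tau> \<xi>. H \<tau> (\<gamma> * \<xi>)) \<tau> \<xi> = cm_param u0 v H \<tau> (\<gamma> * \<xi>)" for \<tau> \<xi>
    by (simp add: cm_param_def vcnj_scale vector_smult_assoc mult.commute)
  show ?thesis
    unfolding R4_normal_form_iff
  proof (intro conjI allI impI)
    fix k l :: nat and \<tau> assume kl: "2 \<le> k + l \<and> k + l \<le> 3"
    have "h k l \<tau> = vcnj (h l k \<tau>)" using nf kl unfolding R4_normal_form_iff by blast
    then show "(\<gamma> ^ k * cnj \<gamma> ^ l) *s h k l \<tau> = vcnj ((\<gamma> ^ l * cnj \<gamma> ^ k) *s h l k \<tau>)"
      by (simp add: vcnj_scale mult.commute)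
    have shift: "h k l \<tau> = (exp (- (\<i> * of_real (pi/2))) ^ k * exp (\<i> * of_real (pi/2)) ^ l) *s h k l (\<tau> + T)"
      using nf kl unfolding R4_normal_form_iff by blast
    show "(\<gamma> ^ k * cnj \<gamma> ^ l) *s h k l \<tau> = (exp (- (\<i> * of_real (pi/2))) ^ k * exp (\<i> * of_real (pi/2)) ^ l)
       *s ((\<gamma> ^ k * cnj \<gamma> ^ l) *s h k l (\<tau> + T))"
      by (subst shift) (simp only: vector_smult_assoc mult_ac)
  next
    show "integral {0..T} (\<lambda>\<tau>. hinner (cvec (\<phi> \<tau>)) ((\<gamma> ^ 1 * cnj \<gamma> ^ 1) *s h 1 1 \<tau>)) = 0"
      using int11 by (simp add: \<gamma>1)
    show "cnj \<gamma> ^ 4 * \<alpha>3 = cnj (\<gamma> ^ 4 * \<alpha>2)"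
      by (simp add: \<alpha>3)
  next
    \<comment> \<open>Witnesses: \<open>\<delta>\<close> and \<open>K\<close> stay, because the
      rotation preserves moduli; \<open>R2\<close> is multiplied by \<open>cnj \<gamma>\<close>, as
      it belongs to the equation of the rotated coordinate.\<close>
    show "\<exists>\<delta>>0. \<exists>K R1 R2.
        Ck_on 4 (\<lambda>(\<tau>, \<xi>). H \<tau> (\<gamma> * \<xi>)) (UNIV \<times> ball 0 \<delta>) \<and>
        Ck_on 1 (\<lambda>(\<tau>, \<xi>). R1 \<tau> \<xi>) (UNIV \<times> ball 0 \<delta>) \<and>
        Ck_on 1 (\<lambda>(\<tau>, \<xi>). R2 \<tau> \<xi>) (UNIV \<times> ball 0 \<delta>) \<and>
        higher_order_bounds T (\<lambda>\<tau> \<xi>. H \<tau> (\<gamma> * \<xi>)) (\<lambda>k l \<tau>. (\<gamma> ^ k * cnj \<gamma> ^ l) *s h k l \<tau>) \<delta> K R1 R2 \<and>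
        invariant_for_reduced_system F u0 (\<lambda>\<tau>. \<gamma> *s v \<tau>) (\<lambda>\<tau> \<xi>. H \<tau> (\<gamma> * \<xi>)) \<delta> R1 R2
          \<alpha>1 (\<gamma> ^ 4 * \<alpha>2) (cnj \<gamma> ^ 4 * \<alpha>3) c (cnj \<gamma> ^ 4 * d)"
    proof (rule exI[of _ \<delta>], rule conjI[OF \<delta>], rule exI[of _ K], rule exI[of _ "\<lambda>\<tau> \<xi>. R1 \<tau> (\<gamma> * \<xi>)"],
        rule exI[of _ "\<lambda>\<tau> \<xi>. cnj \<gamma> * R2 \<tau> (\<gamma> * \<xi>)"], intro conjI)
      show "Ck_on 4 (\<lambda>(\<tau>, \<xi>). H \<tau> (\<gamma> * \<xi>)) (UNIV \<times> ball 0 \<delta>)"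
        by (rule comp[OF H bounded_linear_ident])
      show "Ck_on 1 (\<lambda>(\<tau>, \<xi>). R1 \<tau> (\<gamma> * \<xi>)) (UNIV \<times> ball 0 \<delta>)"
        by (rule comp[OF R1 bounded_linear_ident])
      show "Ck_on 1 (\<lambda>(\<tau>, \<xi>). cnj \<gamma> * R2 \<tau> (\<gamma> * \<xi>)) (UNIV \<times> ball 0 \<delta>)"
        by (rule comp[OF R2 bounded_linear_mult_right])
      show "higher_order_bounds T (\<lambda>\<tau> \<xi>. H \<tau> (\<gamma> * \<xi>)) (\<lambda>k l \<tau>. (\<gamma> ^ k * cnj \<gamma> ^ l) *s h k l \<tau>) \<delta> K
          (\<lambda>\<tau> \<xi>. R1 \<tau> (\<gamma> * \<xi>)) (\<lambda>\<tau> \<xi>. cnj \<gamma> * R2 \<tau> (\<gamma> * \<xi>))"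
        unfolding higher_order_bounds_def
      proof (intro allI ballI)
        fix \<tau> :: real and \<xi> assume "\<xi> \<in> ball (0::complex) \<delta>"
        then have "\<gamma> * \<xi> \<in> ball 0 \<delta>" by (simp add: n\<gamma>)
        note B = bounds[unfolded higher_order_bounds_def, rule_format, OF this, of \<tau>]
        have "(\<Sum>k\<le>3. \<Sum>l | 2 \<le> k + l \<and> k + l \<le> 3. (1 / (fact k * fact l) * \<xi> ^ k * cnj \<xi> ^ l) *s ((\<gamma> ^ k * cnj \<gamma> ^ l) *s h k l \<tau>))
          = (\<Sum>k\<le>3. \<Sum>l | 2 \<le> k + l \<and> k + l \<le> 3. (1 / (fact k * fact l) * (\<gamma> * \<xi>) ^ k * cnj (\<gamma> * \<xi>) ^ l) *s h k l \<tau>)"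
          by (intro sum.cong refl) (simp add: vector_smult_assoc power_mult_distrib mult_ac)
        with B show "H (\<tau> + 4 * T) (\<gamma> * \<xi>) = H \<tau> (\<gamma> * \<xi>) \<and>
           R1 (\<tau> + 4 * T) (\<gamma> * \<xi>) = R1 \<tau> (\<gamma> * \<xi>) \<and>
           cnj \<gamma> * R2 (\<tau> + 4 * T) (\<gamma> * \<xi>) = cnj \<gamma> * R2 \<tau> (\<gamma> * \<xi>) \<and>
           norm (cvec (H \<tau> (\<gamma> * \<xi>))
             - (\<Sum>k\<le>3. \<Sum>l | 2 \<le> k + l \<and> k + l \<le> 3.
                  (1 / (fact k * fact l) * \<xi> ^ k * cnj \<xi> ^ l) *s ((\<gamma> ^ k * cnj \<gamma> ^ l) *s h k l \<tau>))) \<le> K * cmod \<xi> ^ 4 \<and>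
           \<bar>R1 \<tau> (\<gamma> * \<xi>)\<bar> \<le> K * cmod \<xi> ^ 5 \<and>
           cmod (cnj \<gamma> * R2 \<tau> (\<gamma> * \<xi>)) \<le> K * cmod \<xi> ^ 5"
          by (simp only: n\<gamma> norm_mult complex_mod_cnj \<gamma> mult_1_left)
      qed
    next
      show "invariant_for_reduced_system F u0 (\<lambda>\<tau>. \<gamma> *s v \<tau>) (\<lambda>\<tau> \<xi>. H \<tau> (\<gamma> * \<xi>)) \<delta>
          (\<lambda>\<tau> \<xi>. R1 \<tau> (\<gamma> * \<xi>)) (\<lambda>\<tau> \<xi>. cnj \<gamma> * R2 \<tau> (\<gamma> * \<xi>))
          \<alpha>1 (\<gamma> ^ 4 * \<alpha>2) (cnj \<gamma> ^ 4 * \<alpha>3) c (cnj \<gamma> ^ 4 * d)"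
        unfolding invariant_for_reduced_system_def cm
      proof (intro allI impI)
        fix a b and \<theta> :: "real \<Rightarrow> real" and z :: "real \<Rightarrow> complex"
        assume sol: "\<forall>t\<in>{a<..<b}.
              z t \<in> ball 0 \<delta> \<and>
              ((\<lambda>s. complex_of_real (\<theta> s)) has_vector_derivative
                 1 + of_real \<alpha>1 * of_real (cmod (z t) ^ 2) + \<gamma> ^ 4 * \<alpha>2 * z t ^ 4 + cnj \<gamma> ^ 4 * \<alpha>3 * cnj (z t) ^ 4
                   + of_real (R1 (\<theta> t) (\<gamma> * z t))) (at t) \<and>
              (z has_vector_derivative
                 c * z t * of_real (cmod (z t) ^ 2) + cnj \<gamma> ^ 4 * d * cnj (z t) ^ 3 + cnj \<gamma> * R2 (\<theta> t) (\<gamma> * z t)) (at t)"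
        show "\<forall>t\<in>{a<..<b}. ((\<lambda>s. cm_param u0 v H (\<theta> s) (\<gamma> * z s)) has_vector_derivative
                 F (cm_param u0 v H (\<theta> t) (\<gamma> * z t))) (at t)"
        proof (rule inv[unfolded invariant_for_reduced_system_def, THEN spec[of _ a], THEN spec[of _ b], THEN spec[of _ \<theta>], THEN spec[of _ "\<lambda>t. \<gamma> * z t"], THEN mp],
            intro ballI conjI)
          fix t assume t: "t \<in> {a<..<b}"
          show "\<gamma> * z t \<in> ball 0 \<delta>" using sol t by (simp add: n\<gamma>)
          show "((\<lambda>s. complex_of_real (\<theta> s)) has_vector_derivative
                 1 + of_real \<alpha>1 * of_real (cmod (\<gamma> * z t) ^ 2) + \<alpha>2 * (\<gamma> * z t) ^ 4 + \<alpha>3 * cnj (\<gamma> * z t) ^ 4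
                   + of_real (R1 (\<theta> t) (\<gamma> * z t))) (at t)"
            using sol t by (simp add: n\<gamma> power_mult_distrib mult_ac)
          have "(z has_vector_derivative
                 c * z t * of_real (cmod (z t) ^ 2) + cnj \<gamma> ^ 4 * d * cnj (z t) ^ 3 + cnj \<gamma> * R2 (\<theta> t) (\<gamma> * z t)) (at t)"
            using sol t by blast
          from has_vector_derivative_mult_right[OF this, of \<gamma>]
          \<comment> \<open>The powers of \<open>\<gamma>\<close> are grouped so that
            \<open>\<gamma> * cnj \<gamma> = 1\<close> can be cancelled and
            \<open>cnj (\<gamma> * z t) ^ 3\<close> appears.\<close>
          have "((\<lambda>t. \<gamma> * z t) has_vector_derivative
                 c * (\<gamma> * z t) * of_real (cmod (z t) ^ 2) + d * ((\<gamma> * cnj \<gamma>) * (cnj \<gamma> * cnj (z t)) ^ 3) + (\<gamma> * cnj \<gamma>) * R2 (\<theta> t) (\<gamma> * z t)) (at t)"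
            by (simp add: algebra_simps power_mult_distrib power4_eq_xxxx power3_eq_cube)
          then show "((\<lambda>t. \<gamma> * z t) has_vector_derivative
                 c * (\<gamma> * z t) * of_real (cmod (\<gamma> * z t) ^ 2) + d * cnj (\<gamma> * z t) ^ 3 + R2 (\<theta> t) (\<gamma> * z t)) (at t)"
            by (simp add: \<gamma>1 n\<gamma>)
        qed
      qed
    qed
  qed
qed

text \<open>A coefficient belongs to a choice of normal form, so its behaviour under rotation is
  expressed by two claims: a normal form with the transformed values exists, and no other values are
  possible.\<close>

theorem mainTheorem7:
  fixes F :: "real^'n \<Rightarrow> real^'n" and u0 :: "real \<Rightarrow> real^'n" and T :: real
    and Y :: "real \<Rightarrow> real^'n^'n"
    and v vs :: "real \<Rightarrow> complex^'n" and \<phi> :: "real \<Rightarrow> real^'n"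
    and H :: "real \<Rightarrow> complex \<Rightarrow> real^'n" and h :: "nat \<Rightarrow> nat \<Rightarrow> real \<Rightarrow> complex^'n"
    and \<alpha>1 :: real and \<alpha>2 \<alpha>3 c d :: complex
  assumes smooth: "Ck_on 3 F UNIV"
    and periodic: "periodic_orbit F u0 T"
    and fundamental: "fundamental_solution F u0 Y"
    and R4: "R4_multipliers (cmat (Y T))"
    and eigenfunctions: "R4_eigenfunctions F u0 T v \<phi> vs"
    and normal_form: "R4_normal_form F u0 T v \<phi> H h \<alpha>1 \<alpha>2 \<alpha>3 c d"
  shows "unique_solution_on {0..T} (h20_problem F u0 T v) (h 2 0) \<and>
    (complex_of_real \<alpha>1
           = integral {0..T} (\<lambda>\<tau>. hinner (cvec (\<phi> \<tau>)) (Bform F u0 \<tau> (v \<tau>) (vcnj (v \<tau>))))) \<and>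
    unique_solution_on {0..T} (h11_problem F u0 T v \<phi> \<alpha>1) (h 1 1) \<and>
    (cnj c = 1/2 * integral {0..T} (\<lambda>\<tau>. hinner (vcnj (vs \<tau>))
           (Cform F u0 \<tau> (v \<tau>) (vcnj (v \<tau>)) (vcnj (v \<tau>))
            + Bform F u0 \<tau> (v \<tau>) (vcnj (h 2 0 \<tau>))
            + 2 *s Bform F u0 \<tau> (vcnj (v \<tau>)) (h 1 1 \<tau>)
            - (2 * of_real \<alpha>1) *s (cmat (Amat F u0 \<tau>) *v vcnj (v \<tau>))))) \<and>
    (d = 1/6 * integral {0..T} (\<lambda>\<tau>. hinner (vs \<tau>)
           (Cform F u0 \<tau> (vcnj (v \<tau>)) (vcnj (v \<tau>)) (vcnj (v \<tau>))
            + 3 *s Bform F u0 \<tau> (vcnj (v \<tau>)) (vcnj (h 2 0 \<tau>))))) \<and>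
    (\<forall>\<gamma>. cmod \<gamma> = 1 \<longrightarrow>
           (\<exists>vs' H' h' \<alpha>2' \<alpha>3'.
              R4_eigenfunctions F u0 T (\<lambda>\<tau>. \<gamma> *s v \<tau>) \<phi> vs' \<and>
              R4_normal_form F u0 T (\<lambda>\<tau>. \<gamma> *s v \<tau>) \<phi> H' h' \<alpha>1 \<alpha>2' \<alpha>3' c (cnj \<gamma> ^ 4 * d)) \<and>
           (\<forall>H' h' \<alpha>1' \<alpha>2' \<alpha>3' c' d'.
              R4_normal_form F u0 T (\<lambda>\<tau>. \<gamma> *s v \<tau>) \<phi> H' h' \<alpha>1' \<alpha>2' \<alpha>3' c' d' \<longrightarrow>
              c' = c \<and> d' = cnj \<gamma> ^ 4 * d))"
proof -
  \<comment> \<open>Both normal forms are evaluated with the same adjoint function. The integrals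
    involve h20 and h11 on \<open>{0..T}\<close> only, where these are unique once
    \<open>\<alpha>1\<close> is known to agree.\<close>
  have coefficients_determined: "c2 = c1 \<and> d2 = d1"
    if "R4_eigenfunctions F u0 T w \<phi> ws"
      and "R4_normal_form F u0 T w \<phi> H1 h1 a1 b1 e1 c1 d1"
      and "R4_normal_form F u0 T w \<phi> H2 h2 a2 b2 e2 c2 d2"
    for w ws H1 h1 a1 b1 e1 c1 d1 H2 h2 a2 b2 e2 c2 d2
  proof -
    note f1 = R4_formulas[OF smooth periodic fundamental R4 that(1,2)]
    note f2 = R4_formulas[OF smooth periodic fundamental R4 that(1,3)]
    have a: "a2 = a1" using f1(2) f2(2) by (metis of_real_eq_iff)
    have h20: "h2 2 0 \<tau> = h1 2 0 \<tau>" if "\<tau> \<in> {0..T}" for \<tau>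
      using f1(1) f2(1) that unfolding unique_solution_on_def by blast
    have h11: "h2 1 1 \<tau> = h1 1 1 \<tau>" if "\<tau> \<in> {0..T}" for \<tau>
      using f1(3) f2(3) that unfolding unique_solution_on_def a by blast
    have "cnj c2 = cnj c1"
      unfolding f1(4) f2(4) a
      by (intro arg_cong[where f = "\<lambda>x. 1/2 * x"] Henstock_Kurzweil_Integration.integral_cong) (simp only: h20 h11)
    moreover have "d2 = d1"
      unfolding f1(5) f2(5)
      by (intro arg_cong[where f = "\<lambda>x. 1/6 * x"] Henstock_Kurzweil_Integration.integral_cong) (simp only: h20)
    ultimately show ?thesis by simp
  qed
  show ?thesis
  proof (intro conjI allI impI)
    fix \<gamma> :: complex assume \<gamma>: "cmod \<gamma> = 1"
    note e = R4_eigenfunctions_rotate[OF eigenfunctions \<gamma>]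
    note n = R4_normal_form_rotate[OF normal_form \<gamma>]
    show "\<exists>vs' H' h' \<alpha>2' \<alpha>3'. R4_eigenfunctions F u0 T (\<lambda>\<tau>. \<gamma> *s v \<tau>) \<phi> vs' \<and>
        R4_normal_form F u0 T (\<lambda>\<tau>. \<gamma> *s v \<tau>) \<phi> H' h' \<alpha>1 \<alpha>2' \<alpha>3' c (cnj \<gamma> ^ 4 * d)"
      using e n by blast
    fix H' h' \<alpha>1' \<alpha>2' \<alpha>3' c' d'
    assume n': "R4_normal_form F u0 T (\<lambda>\<tau>. \<gamma> *s v \<tau>) \<phi> H' h' \<alpha>1' \<alpha>2' \<alpha>3' c' d'"
    show "c' = c" "d' = cnj \<gamma> ^ 4 * d" using coefficients_determined[OF e n n'] by auto
  qed (rule R4_formulas[OF smooth periodic fundamental R4 eigenfunctions normal_form])+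
qed

end
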